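(* Let $V_{jk}=\sum_{i=1}^{n} c_{ni}\, g\{R_{ni}^{jk}/(n+1)\}$ ($1\le j<k\le d$) be simple linear rank statistics whose regression constants $\{c_{n1},\ldots,c_{nn}\}$ satisfy $$\max_{1\leq i\leq n} |c_{ni}-\bar{c}_n|^2 \leq \frac{C_1^2}{n}\sum_{i=1}^n (c_{ni}-\bar{c}_n)^2, \qquad \Big|\sum_{i=1}^n (c_{ni}-\bar{c}_n)^3\Big|^2 \leq \frac{C_2^2}{n}\Big\{\sum_{i=1}^n (c_{ni}-\bar{c}_n)^2\Big\}^3,$$ where $\bar c_n=n^{-1}\sum_{i=1}^n c_{ni}$ and $C_1,C_2$ are two constants. Suppose further that the score function $g$ is differentiable with bounded Lipschitz constant. Let $L_n=\max_{j<k}|V_{jk}-E_{H_0}(V_{jk})|$ and $\sigma_V^2=n\,\mathrm{var}_{H_0}(V_{jk})$. Then, under $H_0$, if $\log d=o(n^{1/3})$ as $n$ grows, for any $y\in\mathbb{R}$, $$\Big|\mathrm{pr}\big(nL_n^2/\sigma_V^2 - 4\log d + \log\log d \leq y\big) - \exp\{-(8\pi)^{-1/2}\exp(-y/2)\}\Big| = o_y(1).$$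
   Context: Setting: $X=(X_1,\ldots,X_d)^{\mathrm T}$ is a continuous random vector in $\mathbb{R}^d$ (so ties occur with probability zero), and $X_{1,\cdot},\ldots,X_{n,\cdot}$, $X_{i,\cdot}=(X_{i,1},\ldots,X_{i,d})^{\mathrm T}$, are $n$ independent copies of $X$. The dimension $d=d_n$ is allowed to depend on $n$; both $n$ and $d$ tend to infinity (triangular array asymptotics). The null hypothesis is $H_0$: $X_1,\ldots,X_d$ are mutually independent. Relative ranks: $Q_{ni}^j$ is the rank of $X_{i,j}$ in $\{X_{1,j},\ldots,X_{n,j}\}$, and for $j\ne k$, $R_{ni}^{jk}=Q_{ni'}^k$ where $i'$ is the index with $Q_{ni'}^j=i$ ($i=1,\ldots,n$). Simple linear rank statistics: $\{c_{ni}\}$ is an array of real constants (regression constants) with $\sum_i c_{ni}^2>0$, and $g$ is a Lipschitz function (score function). Under $H_0$ the distribution of $V_{jk}$ does not depend on the distribution of $X$ nor on $(j,k)$; $E_{H_0}$, $\mathrm{var}_{H_0}$ are expectation and variance under $H_0$: $$E_{H_0}(V_{jk})=\bar g_n\sum_{i=1}^n c_{ni},\quad \mathrm{var}_{H_0}(V_{jk})=\frac1{n-1}\sum_{i=1}^n[g\{i/(n+1)\}-\bar g_n]^2\sum_{i=1}^n(c_{ni}-\bar c_n)^2,$$ with $\bar g_n=n^{-1}\sum_{i=1}^n g\{i/(n+1)\}$. It is understood that $\sigma_V>0$ (so that the statistic is defined). $o_y(1)$ denotes a quantity that tends to $0$ as $n\to\infty$ for each fixed $y$. *)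

theory Defs
  imports "HOL-Probability.Probability" "HOL-Library.Landau_Symbols"
begin

text \<open>
  Vectors in \<open>d\<close> dimensions are functions on \<open>{1..d}\<close>, since \<open>d\<close> varies with \<open>n\<close>.
\<close>

abbreviation vec_space :: "nat \<Rightarrow> (nat \<Rightarrow> real) measure" where
  "vec_space d \<equiv> Pi\<^sub>M {1..d} (\<lambda>_. borel)"

text \<open>
  A random vector is continuous if its distribution function is continuous; equivalently, no
  coordinate has an atom. No density is required.
\<close>

definition continuous_random_vector ::
    "'b measure \<Rightarrow> nat \<Rightarrow> ('b \<Rightarrow> nat \<Rightarrow> real) \<Rightarrow> bool" where
  "continuous_random_vector N d X \<longleftrightarrow>
     prob_space N \<and> X \<in> measurable N (vec_space d) \<and>
     (\<forall>j\<in>{1..d}. \<forall>x. measure N {\<omega> \<in> space N. X \<omega> j = x} = 0)"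

definition independent_components ::
    "'b measure \<Rightarrow> nat \<Rightarrow> ('b \<Rightarrow> nat \<Rightarrow> real) \<Rightarrow> bool" where
  "independent_components N d X \<longleftrightarrow>
     prob_space.indep_vars N (\<lambda>_. borel) (\<lambda>j \<omega>. X \<omega> j) {1..d}"

text \<open>
  \<open>S 1, \<dots>, S n\<close>, defined on \<open>M\<close>, are independent copies of the vector \<open>X\<close> defined on \<open>N\<close>.
\<close>

definition independent_copies ::
    "'a measure \<Rightarrow> nat \<Rightarrow> nat \<Rightarrow> (nat \<Rightarrow> 'a \<Rightarrow> nat \<Rightarrow> real) \<Rightarrow>
     'b measure \<Rightarrow> ('b \<Rightarrow> nat \<Rightarrow> real) \<Rightarrow> bool" where
  "independent_copies M n d S N X \<longleftrightarrow>
     prob_space M \<and>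
     prob_space.indep_vars M (\<lambda>_. vec_space d) S {1..n} \<and>
     (\<forall>i\<in>{1..n}. distr M (vec_space d) (S i) = distr N (vec_space d) X)"

definition rank_of :: "nat \<Rightarrow> (nat \<Rightarrow> real) \<Rightarrow> nat \<Rightarrow> nat" where
  "rank_of n x i = card {l \<in> {1..n}. x l \<le> x i}"

text \<open>
  The description picks the rank of \<open>y i'\<close> rather than the index \<open>i'\<close>: thus, even when there are
  ties, the value depends only on the ranks within the sample, so it is measurable.
\<close>

definition relative_rank :: "nat \<Rightarrow> (nat \<Rightarrow> real) \<Rightarrow> (nat \<Rightarrow> real) \<Rightarrow> nat \<Rightarrow> nat" where
  "relative_rank n x y i =
     (THE r. \<exists>i'\<in>{1..n}. rank_of n x i' = i \<and> r = rank_of n y i')"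

definition rank_stat ::
    "nat \<Rightarrow> (nat \<Rightarrow> real) \<Rightarrow> (real \<Rightarrow> real) \<Rightarrow> (nat \<Rightarrow> 'a \<Rightarrow> nat \<Rightarrow> real) \<Rightarrow>
     nat \<Rightarrow> nat \<Rightarrow> 'a \<Rightarrow> real" where
  "rank_stat n c g S j k \<omega> =
     (\<Sum>i=1..n. c i *
        g (real (relative_rank n (\<lambda>l. S l \<omega> j) (\<lambda>l. S l \<omega> k) i) / (real n + 1)))"

definition max_rank_stat ::
    "'a measure \<Rightarrow> nat \<Rightarrow> nat \<Rightarrow> (nat \<Rightarrow> real) \<Rightarrow> (real \<Rightarrow> real) \<Rightarrow>
     (nat \<Rightarrow> 'a \<Rightarrow> nat \<Rightarrow> real) \<Rightarrow> 'a \<Rightarrow> real" where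
  "max_rank_stat M n d c g S \<omega> =
     Max {\<bar>rank_stat n c g S j k \<omega> - prob_space.expectation M (rank_stat n c g S j k)\<bar> | j k.
            1 \<le> j \<and> j < k \<and> k \<le> d}"

text \<open>
  This is \<open>\<sigma>\<^sub>V\<^sup>2\<close>. For a sample with independent continuous components, all the statistics
  \<open>rank_stat n c g S j k\<close> with \<open>j < k\<close> have the same distribution, so the choice of the pair
  \<open>(1, 2)\<close> is immaterial.
\<close>

definition sigma_V_sq ::
    "'a measure \<Rightarrow> nat \<Rightarrow> (nat \<Rightarrow> real) \<Rightarrow> (real \<Rightarrow> real) \<Rightarrow>
     (nat \<Rightarrow> 'a \<Rightarrow> nat \<Rightarrow> real) \<Rightarrow> real" where
  "sigma_V_sq M n c g S = real n * prob_space.variance M (rank_stat n c g S 1 2)"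

definition mean_upto :: "nat \<Rightarrow> (nat \<Rightarrow> real) \<Rightarrow> real" where
  "mean_upto n c = (\<Sum>i=1..n. c i) / real n"

end

theory Submission
  imports Defs
    "HOL-Complex_Analysis.Complex_Analysis"
    "HOL-Combinatorics.Permutations"
    "HOL-Real_Asymp.Real_Asymp"
begin

text \<open>
  The rank vectors of the \<open>d\<close> coordinates are independent and uniform on the permutations of
  \<open>{1..n}\<close>, and \<open>V\<^sub>j\<^sub>k\<close> is a function of the relative permutation of the coordinates \<open>j\<close> and \<open>k\<close>.
  Think of the coordinates as the vertices of the complete graph and call an edge \<open>{j, k}\<close> bad if
  \<open>\<bar>V\<^sub>j\<^sub>k - E V\<^sub>j\<^sub>k\<bar>\<close> exceeds \<open>t\<close> standard deviations, where \<open>t\<^sup>2 = 4 log d - log log d + y\<close>. The event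
  of the theorem is that no edge is bad. Three facts give its probability.

  First, bad edges are nearly Poisson. If one of the two rank vectors is fixed, the relative
  permutation is still uniform; hence all edges have the same probability \<open>q\<close> of being bad, edges
  that share a vertex are pairwise independent, and an edge is independent of all the edges that
  are disjoint from it together. The Chen-Stein bound (\<open>poisson_approximation_no_event\<close>,
  \<open>no_edge_poisson\<close>) therefore gives \<open>exp (- d (d - 1) q / 2)\<close> up to an error of order
  \<open>d\<^sup>3 q\<^sup>2\<close>, which is of order \<open>1 / d\<close> as soon as \<open>d\<^sup>2 q\<close> is bounded.

  Second, \<open>q\<close> must be known up to a factor \<open>1 + o(1)\<close>, although \<open>t\<close> tends to infinity: this is a
  moderate deviation result (\<open>permutation_moderate_deviation_abs\<close>), valid for \<open>t = o(n\<^bsup>1/6\<^esup>)\<close>,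
  that is, for \<open>log d = o(n\<^bsup>1/3\<^esup>)\<close>. The standardised statistic is a sum \<open>W\<close> of terms
  \<open>c\<^sub>i\<^sub>,\<^sub>p\<^sub>(\<^sub>i\<^sub>)\<close> over a uniform permutation \<open>p\<close>, with entries of order \<open>n\<^bsup>-1/2\<^esup>\<close>. Its exponential moment
  \<open>E exp (z W)\<close> is a permanent divided by \<open>n!\<close>. The entries of this matrix are close to \<open>1\<close> when
  \<open>\<bar>z\<bar>\<close> is at most a small multiple of \<open>n\<^bsup>1/2\<^esup>\<close>, and, as Barvinok observed, such permanents do not vanish;
  changing one row changes them by a bounded factor (\<open>permanent_change_row\<close>). So
  \<open>E exp (z W)\<close> has an analytic logarithm of size \<open>O(n)\<close> on that disc, and the Cauchy estimate for its
  third derivative gives \<open>E exp (z W) = exp (z\<^sup>2 / 2 + O(\<bar>z\<bar>\<^sup>3 / n\<^bsup>1/2\<^esup>))\<close> (\<open>mgf_perm_stat\<close>).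

  Third, precise exponential moments at the complex points \<open>t + i u\<close>, with \<open>u\<close> of order \<open>t\<close>, determine
  the tail (\<open>sharp_upper_tail\<close>). Tilting by \<open>exp (t W)\<close> moves \<open>W\<close> close to \<open>t\<close>, and \<open>P (W > t)\<close> is
  an integral of the tilted law at the scale \<open>1 / t\<close>. At that scale the tilted law looks like a
  multiple of Lebesgue measure. This is seen by weighting it with an integrable window whose Fourier
  transform has compact support, so that only \<open>u\<close> of order \<open>t\<close> matters, and by applying the continuity
  theorem of Levy.

  The resulting asymptotics \<open>q \<sim> 2 exp (- t\<^sup>2 / 2) / (t (2 \<pi>)\<^bsup>1/2\<^esup>)\<close> gives
  \<open>d\<^sup>2 q / 2 \<longlonglongrightarrow> (8 \<pi>)\<^bsup>-1/2\<^esup> exp (- y / 2)\<close> (\<open>poisson_rate_limit\<close>).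
\<close>

section \<open>Permanents of matrices close to the all-ones matrix\<close>

text \<open>
  Bijections are taken extensional so that each one is counted once.
\<close>

definition bijections :: "'a set \<Rightarrow> 'b set \<Rightarrow> ('a \<Rightarrow> 'b) set" where
  "bijections I J = {p \<in> extensional I. bij_betw p I J}"

definition permanent :: "'a set \<Rightarrow> 'b set \<Rightarrow> ('a \<Rightarrow> 'b \<Rightarrow> complex) \<Rightarrow> complex" where
  "permanent I J A = (\<Sum>p\<in>bijections I J. \<Prod>i\<in>I. A i (p i))"

lemma bijections_empty: "bijections {} {} = {\<lambda>_. undefined}"
  by (auto simp: bijections_def bij_betw_def)

lemma permanent_empty: "permanent {} {} A = 1"
  by (simp add: permanent_def bijections_empty)

lemma finite_bijections: "finite I \<Longrightarrow> finite J \<Longrightarrow> finite (bijections I J)"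
proof -
  assume "finite I" "finite J"
  have "bijections I J \<subseteq> I \<rightarrow>\<^sub>E J"
    by (auto simp: bijections_def PiE_def dest: bij_betwE)
  thus ?thesis using finite_PiE[of I "\<lambda>_. J"] \<open>finite I\<close> \<open>finite J\<close> finite_subset by blast
qed

text \<open>
  A bijection on \<open>insert i I\<close> is its value \<open>j\<close> at \<open>i\<close> together with a bijection from \<open>I\<close> to \<open>J - {j}\<close>.
\<close>

lemma permanent_row_expansion:
  assumes "finite I" "finite J" "i \<notin> I"
  shows "permanent (insert i I) J A = (\<Sum>j\<in>J. A i j * permanent I (J - {j}) A)"
proof -
  have "(\<Sum>j\<in>J. A i j * permanent I (J - {j}) A)
      = (\<Sum>j\<in>J. \<Sum>q\<in>bijections I (J - {j}). A i j * (\<Prod>k\<in>I. A k (q k)))"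
    by (simp add: permanent_def sum_distrib_left)
  also have "\<dots> = (\<Sum>(j,q)\<in>Sigma J (\<lambda>j. bijections I (J - {j})). A i j * (\<Prod>k\<in>I. A k (q k)))"
    using assms by (subst sum.Sigma) (auto simp: finite_bijections)
  also have "\<dots> = (\<Sum>p\<in>bijections (insert i I) J. \<Prod>k\<in>insert i I. A k (p k))"
  proof (rule sum.reindex_bij_witness[where i="\<lambda>p. (p i, p(i := undefined))" and j="\<lambda>(j,q). q(i := j)"])
    fix a assume "a \<in> (SIGMA j:J. bijections I (J - {j}))"
    then obtain j q where a: "a = (j,q)" "j \<in> J" "q \<in> extensional I" "bij_betw q I (J - {j})"
      by (auto simp: bijections_def)
    show "(case a of (j, q) \<Rightarrow> q(i := j)) \<in> bijections (insert i I) J"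
    proof -
      have "bij_betw (q(i:=j)) I (J - {j})"
        using a assms(3) by (subst bij_betw_cong[where g=q]) auto
      hence "bij_betw (q(i:=j)) (insert i I) (insert j (J - {j}))"
        using assms(3) by (auto simp: bij_betw_def)
      moreover have "insert j (J - {j}) = J" using a by auto
      ultimately show ?thesis using a by (auto simp: bijections_def extensional_def)
    qed
    show "((case a of (j, q) \<Rightarrow> q(i := j)) i, (case a of (j, q) \<Rightarrow> q(i := j))(i := undefined)) = a"
      using a assms(3) by (auto simp: extensional_def fun_eq_iff)
    show "(\<Prod>k\<in>insert i I. A k ((case a of (j, q) \<Rightarrow> q(i := j)) k)) =
         (case a of (j, q) \<Rightarrow> A i j * (\<Prod>k\<in>I. A k (q k)))"
      using a assms by (auto intro!: prod.cong)
  next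
    fix p assume "p \<in> bijections (insert i I) J"
    hence p: "p \<in> extensional (insert i I)" "bij_betw p (insert i I) J" by (auto simp: bijections_def)
    show "(case (p i, p(i := undefined)) of (j, q) \<Rightarrow> q(i := j)) = p" by auto
    have "bij_betw p I (J - {p i})" using p(2) assms(3)
      by (auto simp: bij_betw_def) (metis image_eqI)
    hence "bij_betw (p(i:=undefined)) I (J - {p i})"
      using assms(3) by (subst bij_betw_cong[where g=p]) auto
    thus "(p i, p(i := undefined)) \<in> (SIGMA j:J. bijections I (J - {j}))"
      using p by (auto simp: bijections_def extensional_def bij_betw_def)
  qed
  finally show ?thesis by (simp add: permanent_def)
qed

lemma permanent_transpose:
  assumes "finite I"
  shows "permanent J I (\<lambda>j i. A i j) = permanent I J A"
proof -
  have inv: "restrict (inv_into X p) Y \<in> bijections Y X \<and>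
             restrict (inv_into Y (restrict (inv_into X p) Y)) X = p"
    if "p \<in> bijections X Y" for p and X :: "'x set" and Y :: "'y set"
  proof -
    have p: "p \<in> extensional X" "bij_betw p X Y" using that by (auto simp: bijections_def)
    have b: "bij_betw (restrict (inv_into X p) Y) Y X"
      using bij_betw_inv_into[OF p(2)] by (subst bij_betw_cong[where g="inv_into X p"]) auto
    have "restrict (inv_into Y (restrict (inv_into X p) Y)) X x = p x" for x
    proof (cases "x \<in> X")
      case True
      have "p x \<in> Y" using p True by (auto dest: bij_betwE)
      moreover have "restrict (inv_into X p) Y (p x) = x"
        using True p \<open>p x \<in> Y\<close> by (auto simp: bij_betw_def)
      ultimately have "inv_into Y (restrict (inv_into X p) Y) x = p x"
        using b by (metis bij_betw_inv_into_left)
      thus ?thesis using True by simp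
    qed (use p in \<open>auto simp: extensional_def\<close>)
    thus ?thesis using b by (auto simp: bijections_def)
  qed
  show ?thesis unfolding permanent_def
  proof (rule sum.reindex_bij_witness[where i="\<lambda>p. restrict (inv_into I p) J"
         and j="\<lambda>p. restrict (inv_into J p) I"])
    fix p assume pp: "p \<in> bijections J I"
    then have p: "bij_betw p J I" by (auto simp: bijections_def)
    show "(\<Prod>i\<in>I. A i (restrict (inv_into J p) I i)) = (\<Prod>j\<in>J. A (p j) j)"
      using prod.reindex_bij_betw[OF p, of "\<lambda>i. A i (restrict (inv_into J p) I i)"] p
      by (auto simp: bij_betw_def intro!: prod.cong)
  qed (use inv in auto)
qed

text \<open>
  The numerical core of Barvinok's argument. If all the \<open>p j\<close> lie within a third of \<open>\<bar>p j0\<bar>\<close> of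
  \<open>p j0\<close>, their sum has nearly no cancellation, and weights near \<open>1\<close> change it little. The
  constants are such that the ratio \<open>1/3\<close> that is assumed for the summands is reproduced for the sums:
  with \<open>m\<close> summands the sum has modulus at least \<open>4 m \<bar>p j0\<bar> / 7\<close>, the change of weights
  contributes at most \<open>4 m \<bar>p j0\<bar> / 21\<close>.
\<close>

lemma near_weighted_sums:
  fixes p a b :: "'c \<Rightarrow> complex"
  assumes T: "finite T" and j0: "j0 \<in> T" and p0: "p j0 \<noteq> 0"
    and p: "\<And>j. j \<in> T \<Longrightarrow> norm (p j - p j0) \<le> norm (p j0) / 3"
    and a: "\<And>j. j \<in> T \<Longrightarrow> norm (a j - 1) \<le> 1/14"
    and b: "\<And>j. j \<in> T \<Longrightarrow> norm (b j - 1) \<le> 1/14"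
  shows "(\<Sum>j\<in>T. a j * p j) \<noteq> 0"
    and "norm ((\<Sum>j\<in>T. b j * p j) - (\<Sum>j\<in>T. a j * p j)) \<le> norm (\<Sum>j\<in>T. a j * p j) / 3"
proof -
  define P where "P = norm (p j0)"
  define m where "m = real (card T)"
  have P: "P > 0" using p0 by (simp add: P_def)
  have m: "m > 0" using T j0 card_gt_0_iff unfolding m_def by fastforce
  have np: "norm (p j) \<le> 4/3 * P" if "j \<in> T" for j
    using p[OF that] norm_triangle_sub[of "p j" "p j0"] by (simp add: P_def)
  have "norm ((\<Sum>j\<in>T. a j * p j) - of_real m * p j0) = norm (\<Sum>j\<in>T. (a j - 1) * p j + (p j - p j0))"
    by (simp add: algebra_simps sum_subtractf m_def sum.distrib)
  also have "\<dots> \<le> (\<Sum>j\<in>T. (1/14) * (4/3 * P) + P / 3)"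
  proof (rule sum_norm_le)
    fix j assume j: "j \<in> T"
    have "norm ((a j - 1) * p j) \<le> (1/14) * (4/3*P)"
      unfolding norm_mult by (intro mult_mono a[OF j] np[OF j]) auto
    thus "norm ((a j - 1) * p j + (p j - p j0)) \<le> (1/14) * (4/3 * P) + P / 3"
      using p[OF j] norm_triangle_ineq[of "(a j - 1) * p j" "p j - p j0"] by (simp add: P_def)
  qed
  also have "\<dots> = m * P * (3/7)" by (simp add: m_def)
  finally have 1: "norm ((\<Sum>j\<in>T. a j * p j) - of_real m * p j0) \<le> m * P * (3/7)" .
  have "m * P = norm (of_real m * p j0)" using m by (simp add: P_def norm_mult)
  also have "\<dots> \<le> norm (\<Sum>j\<in>T. a j * p j) + m * P * (3/7)"
    using 1 norm_triangle_sub[of "of_real m * p j0" "(\<Sum>j\<in>T. a j * p j)"]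
    by (simp add: norm_minus_commute)
  finally have 2: "m * P * (4/7) \<le> norm (\<Sum>j\<in>T. a j * p j)" by simp
  have "m * P > 0" using m P by simp
  thus "(\<Sum>j\<in>T. a j * p j) \<noteq> 0" using 2 by (metis norm_zero mult_pos_pos not_less zero_less_divide_iff zero_less_numeral)
  have "norm ((\<Sum>j\<in>T. b j * p j) - (\<Sum>j\<in>T. a j * p j)) = norm (\<Sum>j\<in>T. (b j - a j) * p j)"
    by (simp add: algebra_simps sum_subtractf)
  also have "\<dots> \<le> (\<Sum>j\<in>T. (1/7) * (4/3 * P))"
  proof (rule sum_norm_le)
    fix j assume j: "j \<in> T"
    have "norm (b j - a j) \<le> 1/7"
      using a[OF j] b[OF j] norm_triangle_ineq4[of "b j - 1" "a j - 1"] by simp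
    thus "norm ((b j - a j) * p j) \<le> (1/7) * (4/3 * P)"
      unfolding norm_mult by (intro mult_mono np[OF j]) auto
  qed
  also have "\<dots> = m * P * (4/21)" by (simp add: m_def)
  finally show "norm ((\<Sum>j\<in>T. b j * p j) - (\<Sum>j\<in>T. a j * p j)) \<le> norm (\<Sum>j\<in>T. a j * p j) / 3"
    using 2 by simp
qed

text \<open>
  Removing the row that is exchanged leaves minors which pairwise differ in a single column. Transposed,
  they satisfy the same statement for a smaller size, so that \<open>near_weighted_sums\<close> applies to both
  expansions. Exchanging a row is expressed by choosing another index for it in one and the same
  infinite matrix; this makes the statement symmetric under transposition.
\<close>

lemma permanent_change_row:
  fixes A :: "nat \<Rightarrow> nat \<Rightarrow> complex"
  assumes "finite I" "finite J" "card J = Suc (card I)" "i \<notin> I" "i' \<notin> I"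
    and "\<And>i j. norm (A i j - 1) \<le> 1/14"
  shows "permanent (insert i I) J A \<noteq> 0 \<and>
         norm (permanent (insert i' I) J A - permanent (insert i I) J A)
           \<le> norm (permanent (insert i I) J A) / 3"
  using assms
proof (induction "card I" arbitrary: I J i i' A)
  case 0
  hence I: "I = {}" by simp
  obtain j where J: "J = {j}" using 0 by (auto simp: card_Suc_eq)
  show ?case
    using near_weighted_sums[of J j "\<lambda>_. 1" "A i" "A i'"] 0
    by (auto simp: I J permanent_row_expansion permanent_empty)
next
  case (Suc m)
  obtain j0 where j0: "j0 \<in> J" using Suc by fastforce
  have tr: "permanent K I (\<lambda>j i. A i j) = permanent I K A" for K
    by (rule permanent_transpose) fact
  have minor: "permanent I (J - {j0}) A \<noteq> 0 \<and>
      norm (permanent I (J - {j}) A - permanent I (J - {j0}) A) \<le> norm (permanent I (J - {j0}) A) / 3"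
    if j: "j \<in> J" for j
  proof (cases "j = j0")
    case True
    have "card J \<ge> 2" using Suc by simp
    hence "card (J - {j0}) \<noteq> 0" using j0 Suc.prems(2) by simp
    then obtain j1 where j1: "j1 \<in> J - {j0}" by (metis card.empty equals0I)
    have eq: "J - {j0} = insert j1 (J - {j0} - {j1})" using j1 by auto
    have "permanent (insert j1 (J - {j0} - {j1})) I (\<lambda>j i. A i j) \<noteq> 0"
      using Suc.hyps(1)[of "J - {j0} - {j1}" I j1 j1 "\<lambda>j i. A i j"] Suc.prems Suc.hyps(2) j0 j1
      by (auto simp: card_Diff_singleton_if)
    hence "permanent (J - {j0}) I (\<lambda>j i. A i j) \<noteq> 0" by (metis eq)
    hence "permanent I (J - {j0}) A \<noteq> 0" by (simp only: tr not_False_eq_True)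
    thus ?thesis using True by simp
  next
    case False
    have e0: "J - {j0} = insert j (J - {j0} - {j})" and e1: "J - {j} = insert j0 (J - {j0} - {j})"
      using False j j0 by auto
    have "m = card (J - {j0} - {j})" using Suc.prems Suc.hyps(2) j j0 False
      by (auto simp: card_Diff_singleton_if)
    thus ?thesis
      using Suc.hyps(1)[of "J - {j0} - {j}" I j j0 "\<lambda>j i. A i j"] Suc.prems Suc.hyps(2)
      unfolding e0[symmetric] e1[symmetric] tr by simp
  qed
  show ?case
    using near_weighted_sums[of J j0 "\<lambda>j. permanent I (J - {j}) A" "A i" "A i'"] minor j0 Suc.prems
    by (simp add: permanent_row_expansion)
qed

section \<open>Exponential moments of sums over a random permutation\<close>

text \<open>
  Serves as the starting point when rows of ones are replaced one by one.
\<close>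

lemma permanent_ones:
  assumes "finite I" "finite J" "card I = card J" "\<And>i j. i \<in> I \<Longrightarrow> j \<in> J \<Longrightarrow> A i j = 1"
  shows "permanent I J A = fact (card I)"
  using assms
proof (induction I arbitrary: J rule: finite_induct)
  case empty
  thus ?case by (simp add: permanent_empty)
next
  case (insert i I)
  have "permanent (insert i I) J A = (\<Sum>j\<in>J. A i j * permanent I (J - {j}) A)"
    using insert by (intro permanent_row_expansion) auto
  also have "\<dots> = (\<Sum>j\<in>J. fact (card I))"
  proof (intro sum.cong refl)
    fix j assume j: "j \<in> J"
    have "card (J - {j}) = card I" using insert.hyps insert.prems(2) j by (simp add: insert.prems(1))
    thus "A i j * permanent I (J - {j}) A = fact (card I)"
      using insert.IH[of "J - {j}"] insert.prems j by simp
  qed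
  also have "\<dots> = fact (card (insert i I))"
    using insert.hyps by (simp flip: insert.prems(2))
  finally show ?case .
qed

lemma sum_permutations_eq_permanent:
  assumes "finite S"
  shows "(\<Sum>p | p permutes S. \<Prod>i\<in>S. A i (p i)) = permanent S S A"
  unfolding permanent_def
proof (rule sum.reindex_bij_witness[where i="\<lambda>p i. if i \<in> S then p i else i" and j="\<lambda>p. restrict p S"])
  fix p assume "p \<in> {p. p permutes S}"
  hence p: "p permutes S" by simp
  show "(\<lambda>i. if i \<in> S then restrict p S i else i) = p"
    using p by (auto simp: fun_eq_iff permutes_def)
  show "restrict p S \<in> bijections S S"
    using permutes_imp_bij[OF p] by (auto simp: bijections_def bij_betw_def inj_on_def)
next
  fix p assume p: "p \<in> bijections S S"
  show "restrict (\<lambda>i. if i \<in> S then p i else i) S = p"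
    using p by (auto simp: bijections_def extensional_def fun_eq_iff)
  have "bij_betw (\<lambda>i. if i \<in> S then p i else i) S S"
    using p by (subst bij_betw_cong[where g=p]) (auto simp: bijections_def)
  thus "(\<lambda>i. if i \<in> S then p i else i) \<in> {p. p permutes S}"
    by (auto intro: bij_imp_permutes)
qed auto

text \<open>
  Replacing the rows of the all-ones matrix one by one writes the permanent as a product of \<open>n\<close> ratios,
  each within \<open>1/3\<close> of \<open>1\<close> and holomorphic in \<open>z\<close>. The sum of their principal logarithms is a
  logarithm of the permanent, and its size is at most \<open>n\<close> for free.
\<close>

lemma log_permanent_exp:
  fixes c :: "nat \<Rightarrow> nat \<Rightarrow> real"
  assumes \<rho>: "\<rho> > 0" and c: "\<And>i j. i \<in> {1..n} \<Longrightarrow> j \<in> {1..n} \<Longrightarrow> \<rho> * \<bar>c i j\<bar> \<le> 1/28"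
  obtains f where "f holomorphic_on ball 0 \<rho>" "f 0 = 0"
    "\<And>z. z \<in> ball 0 \<rho> \<Longrightarrow> norm (f z) \<le> real n"
    "\<And>z. z \<in> ball 0 \<rho> \<Longrightarrow> exp (f z) = permanent {1..n} {1..n} (\<lambda>i j. exp (z * c i j)) / fact n"
proof -
  define B where "B = (\<lambda>z i j. if i \<in> {1..n} \<and> j \<in> {1..n} then exp (z * complex_of_real (c i j)) else 1)"
  \<comment> \<open>The row indices \<open>n+1..2*n\<close> carry rows of ones; \<open>I k\<close> uses the first \<open>k\<close> proper rows and
    \<open>n - k\<close> rows of ones, and \<open>U k\<close> are the rows that \<open>I k\<close> and \<open>I (Suc k)\<close> have in common.\<close>
  define U where "U = (\<lambda>k. {1..k} \<union> {n+k+2..2*n})"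
  define I where "I = (\<lambda>k. {1..k} \<union> {n+k+1..2*n})"
  define P where "P = (\<lambda>k z. permanent (I k) {1..n} (B z))"
  have IU: "I k = insert (n+k+1) (U k)" "I (Suc k) = insert (k+1) (U k)"
      "n+k+1 \<notin> U k" "k+1 \<notin> U k" if "k < n" for k
    using that by (auto simp: I_def U_def)
  have finU: "finite (U k)" for k by (simp add: U_def)
  have cardU: "n = Suc (card (U k))" if "k < n" for k
  proof -
    have "card (U k) = card {1..k} + card {n+k+2..2*n}"
      unfolding U_def using that by (intro card_Un_disjoint) auto
    thus ?thesis using that by simp
  qed
  have B1: "norm (B z i j - 1) \<le> 1/14" if z: "z \<in> ball 0 \<rho>" for z i j
  proof (cases "i \<in> {1..n} \<and> j \<in> {1..n}")
    case True
    have "norm (z * c i j) \<le> \<rho> * \<bar>c i j\<bar>"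
      unfolding norm_mult using z \<rho> by (intro mult_mono) auto
    also have "\<dots> \<le> 1/28" using c True by blast
    finally have *: "norm (z * c i j) \<le> 1/28" .
    hence "norm (exp (z * c i j) - 1) \<le> 2 * norm (z * c i j)"
      using norm_exp_bounds(2)[of "z * c i j"] norm_ge_zero[of "z * c i j"] by linarith
    thus ?thesis using * True by (simp add: B_def)
  next
    case False
    hence "B z i j = 1" unfolding B_def by (rule if_not_P)
    thus ?thesis by simp
  qed
  have step: "P k z \<noteq> 0 \<and> norm (P (Suc k) z / P k z - 1) \<le> 1/3"
    if k: "k < n" and z: "z \<in> ball 0 \<rho>" for k z
  proof -
    have "P k z \<noteq> 0 \<and> norm (P (Suc k) z - P k z) \<le> norm (P k z) / 3"
      unfolding P_def IU(1,2)[OF k]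
      by (rule permanent_change_row) (use finU cardU[OF k] IU[OF k] B1[OF z] in auto)
    moreover from this have "P (Suc k) z / P k z - 1 = (P (Suc k) z - P k z) / P k z"
      by (simp add: field_simps)
    ultimately show ?thesis by (simp add: norm_divide field_simps)
  qed
  have holP: "P k holomorphic_on A" for k A
  proof -
    have "(\<lambda>z. B z i j) holomorphic_on A" for i j
      unfolding B_def by (cases "i \<in> {1..n} \<and> j \<in> {1..n}") (auto intro!: holomorphic_intros)
    thus ?thesis unfolding P_def permanent_def by (intro holomorphic_intros)
  qed
  define f where "f = (\<lambda>z. \<Sum>k<n. Ln (P (Suc k) z / P k z))"
  have Re: "P (Suc k) z / P k z \<notin> \<real>\<^sub>\<le>\<^sub>0" if "k < n" "z \<in> ball 0 \<rho>" for k z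
  proof -
    have "\<bar>Re (P (Suc k) z / P k z - 1)\<bar> \<le> 1/3"
      using step[OF that] abs_Re_le_cmod order_trans by blast
    hence "Re (P (Suc k) z / P k z) > 0" by (simp only: minus_complex.simps one_complex.simps)
    thus ?thesis by (auto simp: complex_nonpos_Reals_iff)
  qed
  show ?thesis
  proof (rule that)
    show "f holomorphic_on ball 0 \<rho>"
      unfolding f_def by (intro holomorphic_intros holP) (use step Re in auto)
    have "P k 0 = fact n" if "k \<le> n" for k
    proof -
      have "card (I k) = card {1..k} + card {n+k+1..2*n}"
        unfolding I_def using that by (intro card_Un_disjoint) auto
      hence "card (I k) = n" using that by simp
      thus ?thesis unfolding P_def
        by (subst permanent_ones) (auto simp: B_def I_def)
    qed
    thus "f 0 = 0" by (simp add: f_def)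
    show "norm (f z) \<le> real n" if z: "z \<in> ball 0 \<rho>" for z
    proof -
      have "norm (f z) \<le> (\<Sum>k<n. 1)"
        unfolding f_def
      proof (rule sum_norm_le)
        fix k assume "k \<in> {..<n}"
        hence s: "norm (P (Suc k) z / P k z - 1) \<le> 1/3" using step z by auto
        show "norm (Ln (P (Suc k) z / P k z)) \<le> 1"
          using norm_Ln_le[of "P (Suc k) z / P k z - 1"] s by simp
      qed
      thus ?thesis by simp
    qed
    show "exp (f z) = permanent {1..n} {1..n} (\<lambda>i j. exp (z * c i j)) / fact n"
      if z: "z \<in> ball 0 \<rho>" for z
    proof -
      have ex: "exp (\<Sum>k<m. Ln (P (Suc k) z / P k z)) = P m z / P 0 z" if "m \<le> n" for m
        using that
      proof (induction m)
        case 0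
        show ?case
        proof (cases "n = 0")
          case True
          thus ?thesis by (simp add: P_def I_def permanent_empty)
        next
          case False
          thus ?thesis using step[of 0 z] z by simp
        qed
      next
        case (Suc m)
        have "P (Suc m) z / P m z \<noteq> 0" using Re[of m z] Suc.prems z by (auto simp del: divide_eq_0_iff)
        thus ?case using Suc step[of m z] z by (simp add: exp_add)
      qed
      have "P 0 z = fact n"
        unfolding P_def by (subst permanent_ones) (auto simp: B_def I_def)
      moreover have "P n z = permanent {1..n} {1..n} (\<lambda>i j. exp (z * c i j))"
        unfolding P_def permanent_def I_def B_def
        by (intro sum.cong prod.cong) (auto simp: bijections_def dest!: bij_betwE)
      ultimately show ?thesis using ex[of n] by (simp add: f_def)
    qed
  qed
qed

text \<open>
  The value and the first two derivatives of the logarithm at \<open>0\<close> are \<open>0\<close>, the mean \<open>0\<close> and the variance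
  \<open>1\<close>. The third derivative on the disc of radius \<open>\<rho> / 4\<close> is bounded by Cauchy's inequality on circles
  of radius \<open>\<rho> / 4\<close>, which stay inside the domain.
\<close>

lemma log_mgf_Taylor:
  fixes W :: "'a \<Rightarrow> real"
  assumes fin: "finite \<Omega>" "\<Omega> \<noteq> {}"
    and mean: "(\<Sum>\<omega>\<in>\<Omega>. W \<omega>) = 0" and var: "(\<Sum>\<omega>\<in>\<Omega>. (W \<omega>)\<^sup>2) = card \<Omega>"
    and \<rho>: "\<rho> > 0" and hol: "f holomorphic_on ball 0 \<rho>" and f0: "f 0 = 0"
    and bound: "\<And>z. z \<in> ball 0 \<rho> \<Longrightarrow> norm (f z) \<le> B"
    and ex: "\<And>z. z \<in> ball 0 \<rho> \<Longrightarrow> exp (f z) = (\<Sum>\<omega>\<in>\<Omega>. exp (z * W \<omega>)) / card \<Omega>"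
    and z: "norm z \<le> \<rho> / 4"
  shows "norm (f z - z\<^sup>2 / 2) \<le> 192 * B * (norm z / \<rho>) ^ 3"
proof -
  define N where "N = complex_of_nat (card \<Omega>)"
  have N: "N \<noteq> 0" using fin by (simp add: N_def)
  let ?F = "\<lambda>z::complex. (\<Sum>\<omega>\<in>\<Omega>. exp (z * W \<omega>)) / N"
  let ?F1 = "\<lambda>z::complex. (\<Sum>\<omega>\<in>\<Omega>. W \<omega> * exp (z * W \<omega>)) / N"
  let ?F2 = "\<lambda>z::complex. (\<Sum>\<omega>\<in>\<Omega>. (W \<omega>)\<^sup>2 * exp (z * W \<omega>)) / N"
  have F: "(?F has_field_derivative ?F1 z) (at z)" for z
    by (rule derivative_eq_intros refl | use N in \<open>simp add: sum_divide_distrib mult_ac\<close>)+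
  have F1: "(?F1 has_field_derivative ?F2 z) (at z)" for z
    by (rule derivative_eq_intros refl | use N in \<open>simp add: sum_divide_distrib mult_ac power2_eq_square\<close>)+
  have higher: "((deriv ^^ i) f has_field_derivative (deriv ^^ Suc i) f x) (at x)" if "x \<in> ball 0 \<rho>" for x i
    using holomorphic_higher_deriv[OF hol open_ball, of i] that
    by (auto intro!: holomorphic_derivI[of _ "ball 0 \<rho>"])
  have d1: "deriv f x * exp (f x) = ?F1 x" if x: "x \<in> ball 0 \<rho>" for x
  proof -
    have "((\<lambda>z. exp (f z)) has_field_derivative exp (f x) * deriv f x) (at x)"
      using higher[OF x, of 0] by (auto intro!: derivative_eq_intros)
    moreover have "((\<lambda>z. exp (f z)) has_field_derivative ?F1 x) (at x)"
      by (rule has_field_derivative_transform_within_open[OF F open_ball x])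
         (simp add: ex N_def)
    ultimately show ?thesis using DERIV_unique by (metis mult.commute)
  qed
  have 0: "0 \<in> ball (0::complex) \<rho>" using \<rho> by simp
  have mean': "(\<Sum>\<omega>\<in>\<Omega>. complex_of_real (W \<omega>)) = 0" by (metis mean of_real_sum of_real_0)
  have var': "(\<Sum>\<omega>\<in>\<Omega>. (complex_of_real (W \<omega>))\<^sup>2) = N"
    using arg_cong[OF var, of complex_of_real] by (simp add: N_def)
  have f1: "deriv f 0 = 0" using d1[OF 0] by (simp add: f0 mean')
  have "((\<lambda>x. deriv f x * exp (f x)) has_field_derivative (deriv ^^ 2) f 0 * exp (f 0) + exp (f 0) * deriv f 0 * deriv f 0) (at 0)"
    using higher[OF 0, of 0] higher[OF 0, of 1]
    by (auto intro!: derivative_eq_intros simp: numeral_2_eq_2)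
  moreover have "((\<lambda>x. deriv f x * exp (f x)) has_field_derivative ?F2 0) (at 0)"
    by (rule has_field_derivative_transform_within_open[OF F1 open_ball 0]) (simp add: d1)
  ultimately have "(deriv ^^ 2) f 0 * exp (f 0) + exp (f 0) * deriv f 0 * deriv f 0 = ?F2 0"
    by (rule DERIV_unique)
  hence f2: "(deriv ^^ 2) f 0 = 1" using N by (simp add: f0 f1 var')
  have "norm (f z - (\<Sum>i\<le>2. (deriv ^^ i) f 0 * (z - 0) ^ i / fact i))
      \<le> (384 * B / \<rho> ^ 3) * norm (z - 0) ^ Suc 2 / fact 2"
  proof (rule complex_Taylor[of "cball 0 (\<rho>/4)" 2 "\<lambda>i. (deriv ^^ i) f", simplified funpow_0])
    fix i x assume "x \<in> cball (0::complex) (\<rho>/4)"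
    hence "x \<in> ball 0 \<rho>" using \<rho> by simp
    thus "((deriv ^^ i) f has_field_derivative (deriv ^^ Suc i) f x) (at x within cball 0 (\<rho>/4))"
      using higher has_field_derivative_at_within by blast
  next
    fix x assume x: "x \<in> cball (0::complex) (\<rho>/4)"
    have sub: "cball x (\<rho>/4) \<subseteq> ball 0 \<rho>"
    proof
      fix y assume "y \<in> cball x (\<rho>/4)"
      hence "norm (x - y) \<le> \<rho>/4" by (simp add: dist_norm)
      hence "norm y \<le> norm x + \<rho>/4" using norm_triangle_sub[of y x] by (simp add: norm_minus_commute)
      thus "y \<in> ball 0 \<rho>" using x \<rho> by simp
    qed
    have "norm ((deriv ^^ 3) f x) \<le> fact 3 * B / (\<rho>/4) ^ 3"
    proof (rule Cauchy_inequality)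
      show "f holomorphic_on ball x (\<rho>/4)"
        using hol sub by (meson ball_subset_cball holomorphic_on_subset order_trans)
      show "continuous_on (cball x (\<rho>/4)) f"
        using hol sub holomorphic_on_imp_continuous_on holomorphic_on_subset by blast
      fix y assume "norm (x - y) = \<rho>/4"
      thus "norm (f y) \<le> B" using sub by (intro bound) (auto simp: dist_norm)
    qed (use \<rho> in auto)
    also have "fact 3 * B / (\<rho>/4) ^ 3 = 384 * B / \<rho> ^ 3"
      by (simp add: fact_numeral power_divide)
    finally show "norm ((deriv ^^ Suc 2) f x) \<le> 384 * B / \<rho> ^ 3" by (simp add: numeral_3_eq_3 numeral_2_eq_2)
  qed (use z \<rho> in auto)
  also have "(\<Sum>i\<le>2. (deriv ^^ i) f 0 * (z - 0) ^ i / fact i) = z\<^sup>2 / 2"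
    using f1 f2 by (simp add: numeral_2_eq_2 f0)
  finally show ?thesis by (simp add: power_divide numeral_3_eq_3 mult_ac)
qed

definition perm_stat :: "nat \<Rightarrow> (nat \<Rightarrow> nat \<Rightarrow> real) \<Rightarrow> (nat \<Rightarrow> nat) \<Rightarrow> real" where
  "perm_stat n c p = (\<Sum>i=1..n. c i (p i))"

text \<open>
  With \<open>\<rho>\<close> of order \<open>sqrt n\<close> and a logarithm of size \<open>n\<close>, the cubic remainder \<open>n (\<bar>z\<bar> / \<rho>)\<^sup>3\<close> has order
  \<open>\<bar>z\<bar>\<^sup>3 / sqrt n\<close>.
\<close>

lemma mgf_perm_stat:
  fixes c :: "nat \<Rightarrow> nat \<Rightarrow> real" and z :: complex
  assumes n: "n \<ge> 1" and K: "K > 0"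
    and c: "\<And>i j. i \<in> {1..n} \<Longrightarrow> j \<in> {1..n} \<Longrightarrow> \<bar>c i j\<bar> \<le> K / sqrt n"
    and mean: "(\<Sum>p | p permutes {1..n}. perm_stat n c p) = 0"
    and var: "(\<Sum>p | p permutes {1..n}. (perm_stat n c p)\<^sup>2) = fact n"
    and z: "norm z \<le> sqrt n / (112 * K)"
  obtains R where "norm R \<le> 192 * (28 * K) ^ 3 * norm z ^ 3 / sqrt n"
    "(\<Sum>p | p permutes {1..n}. exp (z * perm_stat n c p)) / fact n = exp (z\<^sup>2 / 2 + R)"
proof -
  define \<rho> where "\<rho> = sqrt n / (28 * K)"
  have \<rho>: "\<rho> > 0" using n K by (simp add: \<rho>_def)
  have "\<rho> * \<bar>c i j\<bar> \<le> 1/28" if "i \<in> {1..n}" "j \<in> {1..n}" for i j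
  proof -
    have "\<rho> * \<bar>c i j\<bar> \<le> \<rho> * (K / sqrt n)" using c[OF that] \<rho> by (intro mult_left_mono) auto
    also have "\<dots> = 1/28" using n K by (simp add: \<rho>_def)
    finally show ?thesis .
  qed
  then obtain f where f: "f holomorphic_on ball 0 \<rho>" "f 0 = 0"
    "\<And>z. z \<in> ball 0 \<rho> \<Longrightarrow> norm (f z) \<le> real n"
    "\<And>z. z \<in> ball 0 \<rho> \<Longrightarrow> exp (f z) = permanent {1..n} {1..n} (\<lambda>i j. exp (z * c i j)) / fact n"
    using log_permanent_exp[OF \<rho>] by blast
  have per: "permanent {1..n} {1..n} (\<lambda>i j. exp (z * c i j))
      = (\<Sum>p | p permutes {1..n}. exp (z * perm_stat n c p))" for z :: complex
    by (simp add: sum_permutations_eq_permanent[symmetric] perm_stat_def sum_distrib_left exp_sum)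
  have card: "card {p. p permutes {1..n}} = fact n" by (simp add: card_permutations)
  have fin: "finite {p. p permutes {1..n}}" by (simp add: finite_permutations)
  have ne: "{p. p permutes {1..n}} \<noteq> {}" using permutes_id by blast
  have z4: "norm z \<le> \<rho> / 4" using z by (simp add: \<rho>_def)
  have "norm (f z - z\<^sup>2 / 2) \<le> 192 * real n * (norm z / \<rho>) ^ 3"
    by (rule log_mgf_Taylor[OF fin ne mean _ \<rho> f(1,2,3) _ z4]) (simp_all add: var card f(4) per del: One_nat_def)
  also have "\<dots> = 192 * (28 * K) ^ 3 * norm z ^ 3 * (n / sqrt n ^ 3)"
    by (simp add: \<rho>_def power_mult_distrib power_divide)
  also have "n / sqrt n ^ 3 = 1 / sqrt n" using n by (simp add: power3_eq_cube field_simps)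
  finally have 1: "norm (f z - z\<^sup>2 / 2) \<le> 192 * (28 * K) ^ 3 * norm z ^ 3 / sqrt n" by simp
  have "z \<in> ball 0 \<rho>" using z4 \<rho> by simp
  hence "(\<Sum>p | p permutes {1..n}. exp (z * perm_stat n c p)) / fact n = exp (z\<^sup>2 / 2 + (f z - z\<^sup>2 / 2))"
    by (simp add: f(4) per del: One_nat_def)
  with 1 show ?thesis using that by blast
qed

section \<open>A window with compactly supported Fourier transform\<close>

text \<open>
  The autocorrelation of \<open>exp (- v)\<close> restricted to \<open>[0, 1]\<close>; the maximum cuts off the formula
  outside \<open>[-1, 1]\<close>. Hence its Fourier transform is the squared modulus of the transform of a truncated exponential. In contrast to the kernel of Fejer,
  which also has a compactly supported transform, this has no real zeros, and one can divide by it.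
\<close>

definition window_hat :: "real \<Rightarrow> real" where
  "window_hat v = max 0 ((exp (- \<bar>v\<bar>) - exp (\<bar>v\<bar> - 2)) / 2)"

definition window :: "real \<Rightarrow> real" where
  "window x = (1 - 2 * exp (-1) * cos x + exp (-2)) / (1 + x\<^sup>2)"

lemma window_hat_nonneg [simp]: "window_hat v \<ge> 0"
  and window_hat_le: "window_hat v \<le> 1"
  and window_hat_zero: "\<bar>v\<bar> \<ge> 1 \<Longrightarrow> window_hat v = 0"
  and window_hat_inside: "\<bar>v\<bar> \<le> 1 \<Longrightarrow> window_hat v = (exp (- \<bar>v\<bar>) - exp (\<bar>v\<bar> - 2)) / 2"
  and window_hat_minus [simp]: "window_hat (- v) = window_hat v"
  and window_hat_0: "window_hat 0 > 0"
proof -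
  show "window_hat v \<le> 1"
  proof -
    have "exp (- \<bar>v\<bar>) \<le> 1" "exp (\<bar>v\<bar> - 2) \<ge> 0" by simp_all
    moreover have "(a - b) / 2 \<le> 1" if "a \<le> 1" "b \<ge> 0" for a b :: real using that by simp
    ultimately have "(exp (- \<bar>v\<bar>) - exp (\<bar>v\<bar> - 2)) / 2 \<le> 1" by blast
    thus ?thesis unfolding window_hat_def by (intro max.boundedI zero_le_one)
  qed
qed (auto simp: window_hat_def max_def)

lemma continuous_window_hat: "isCont window_hat v"
  unfolding window_hat_def[abs_def] by (intro continuous_intros) auto

lemma borel_measurable_window_hat [measurable]: "window_hat \<in> borel_measurable borel"
  by (intro borel_measurable_continuous_onI continuous_at_imp_continuous_on) (auto intro: continuous_window_hat)

lemma integrable_window_hat [simp]: "integrable lborel window_hat"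
proof (rule Bochner_Integration.integrable_bound)
  show "integrable lborel (indicator {-1..1} :: real \<Rightarrow> real)" by simp
  show "AE x in lborel. norm (window_hat x) \<le> norm (indicator {-1..1} x :: real)"
    using window_hat_le window_hat_zero by (auto simp: indicator_def)
qed measurable

lemma window_pos: "window x > 0" and window_lower: "window x \<ge> (1 - exp (-1))\<^sup>2 / (1 + x\<^sup>2)"
  and window_upper: "window x \<le> 4 / (1 + x\<^sup>2)"
proof -
  have e: "exp (-2) = exp (-1 :: real) ^ 2" by (simp flip: exp_of_nat_mult)
  have "exp (-1 :: real) * cos x \<le> exp (-1) * 1" by (intro mult_left_mono) auto
  hence n: "(1 - exp (-1))\<^sup>2 \<le> 1 - 2 * exp (-1) * cos x + exp (-2)"
    by (simp add: e power2_eq_square algebra_simps)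
  have "exp (-1 :: real) * (-1) \<le> exp (-1) * cos x" by (intro mult_left_mono) auto
  moreover have "exp (-1 :: real) \<le> 1" "exp (-2 :: real) \<le> 1" by auto
  ultimately have u: "1 - 2 * exp (-1) * cos x + exp (-2) \<le> 4" by linarith
  have p: "1 + x\<^sup>2 > 0" by (simp add: add_pos_nonneg)
  show l: "window x \<ge> (1 - exp (-1))\<^sup>2 / (1 + x\<^sup>2)"
    unfolding window_def using n p by (intro divide_right_mono) auto
  show "window x \<le> 4 / (1 + x\<^sup>2)"
    unfolding window_def using u p by (intro divide_right_mono) auto
  have "exp (-1 :: real) \<noteq> 1" by simp
  hence "(1 - exp (-1 :: real))\<^sup>2 > 0" by simp
  hence "(1 - exp (-1))\<^sup>2 / (1 + x\<^sup>2) > 0" using p by simp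
  thus "window x > 0" using l by linarith
qed

lemma continuous_window: "isCont window x"
proof -
  have "1 + x\<^sup>2 \<noteq> 0" by (metis add_pos_nonneg less_irrefl zero_le_power2 zero_less_one)
  thus ?thesis unfolding window_def[abs_def] by (intro continuous_intros) auto
qed

lemma borel_measurable_window [measurable]: "window \<in> borel_measurable borel"
  by (intro borel_measurable_continuous_onI continuous_at_imp_continuous_on) (auto intro: continuous_window)

lemma integrable_window [simp]: "integrable lborel window"
proof (rule Bochner_Integration.integrable_bound)
  have "integrable lborel (\<lambda>x::real. inverse (1 + x\<^sup>2))"
    using Sinc_Integral.integrable_inverse_1_plus_square by (simp add: set_integrable_def)
  thus "integrable lborel (\<lambda>x::real. 4 * inverse (1 + x\<^sup>2))" by simp
  show "AE x in lborel. norm (window x) \<le> norm (4 * inverse (1 + x\<^sup>2))"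
    using window_upper window_pos by (auto simp: divide_inverse less_imp_le)
qed measurable

text \<open>
  On either side of \<open>0\<close> the integrand is a combination of exponentials with explicit antiderivative.
\<close>

lemma window_fourier:
  "(LINT v|lborel. window_hat v * iexp (v * x)) = complex_of_real (window x)"
proof -
  define a where "a = \<i> * x - 1"
  define b where "b = \<i> * x + 1"
  define q where "q = complex_of_real (exp (-2))"
  have ab: "a \<noteq> 0" "b \<noteq> 0" by (auto simp: a_def b_def complex_eq_iff)
  \<comment> \<open>\<open>window_hat v * iexp (v * x)\<close> for positive and for negative \<open>v\<close>\<close>
  define f1 where "f1 = (\<lambda>v::real. (exp (a * v) - q * exp (b * v)) / 2)"
  define f2 where "f2 = (\<lambda>v::real. (exp (b * v) - q * exp (a * v)) / 2)"
  define F1 where "F1 = (\<lambda>v::real. (exp (a * v) / a - q * (exp (b * v) / b)) / 2)"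
  define F2 where "F2 = (\<lambda>v::real. (exp (b * v) / b - q * (exp (a * v) / a)) / 2)"
  have 1: "has_bochner_integral lborel (\<lambda>v. indicator {0..1} v *\<^sub>R f1 v) (F1 1 - F1 0)"
  proof (rule has_bochner_integral_FTC_Icc)
    fix v :: real
    show "(F1 has_vector_derivative f1 v) (at v within {0..1})"
      unfolding F1_def f1_def using ab
      by (auto intro!: derivative_eq_intros has_vector_derivative_real_field)
    show "continuous_on {0..1} f1" unfolding f1_def by (intro continuous_intros) auto
  qed simp
  have 2: "has_bochner_integral lborel (\<lambda>v. indicator {-1..0} v *\<^sub>R f2 v) (F2 0 - F2 (-1))"
  proof (rule has_bochner_integral_FTC_Icc)
    fix v :: real
    show "(F2 has_vector_derivative f2 v) (at v within {-1..0})"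
      unfolding F2_def f2_def using ab
      by (auto intro!: derivative_eq_intros has_vector_derivative_real_field)
    show "continuous_on {-1..0} f2" unfolding f2_def by (intro continuous_intros) auto
  qed simp
  have "has_bochner_integral lborel (\<lambda>v. window_hat v * iexp (v * x)) (F1 1 - F1 0 + (F2 0 - F2 (-1)))"
  proof (rule has_bochner_integral_cong_AE[THEN iffD1, OF _ _ _ has_bochner_integral_add[OF 1 2]])
    have "AE v in lborel. v \<noteq> (0::real)" by (rule AE_lborel_singleton)
    thus "AE v in lborel. indicator {0..1} v *\<^sub>R f1 v + indicator {-1..0} v *\<^sub>R f2 v = window_hat v * iexp (v * x)"
    proof (rule AE_mp, intro AE_I2 impI)
      fix v :: real assume v: "v \<noteq> 0"
      show "indicator {0..1} v *\<^sub>R f1 v + indicator {-1..0} v *\<^sub>R f2 v = window_hat v * iexp (v * x)"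
      proof (cases "\<bar>v\<bar> \<le> 1")
        case True
        consider "v > 0" | "v < 0" using v by linarith
        thus ?thesis
        proof cases
          case 1
          thus ?thesis using True
            by (simp add: window_hat_inside f1_def a_def b_def q_def exp_diff exp_add exp_of_real[symmetric]
               exp_minus algebra_simps indicator_def divide_simps)
        next
          case 2
          thus ?thesis using True
            by (simp add: window_hat_inside f2_def a_def b_def q_def exp_diff exp_add exp_of_real[symmetric]
               exp_minus algebra_simps indicator_def divide_simps)
        qed
      next
        case False
        thus ?thesis using window_hat_zero[of v] by (auto simp: indicator_def)
      qed
    qed
  qed (use f1_def f2_def in auto)
  hence "(LINT v|lborel. window_hat v * iexp (v * x)) = F1 1 - F1 0 + (F2 0 - F2 (-1))"
    by (rule has_bochner_integral_integral_eq)
  also have "\<dots> = complex_of_real (window x)"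
  proof -
    define E where "E = exp (\<i> * x - 1)"
    define E' where "E' = exp (-1 - \<i> * x)"
    have e: "exp a = E" "q * exp b = E" "exp (- b) = E'" "q * exp (- a) = E'"
      by (auto simp: E_def E'_def a_def b_def q_def exp_of_real[symmetric] exp_add[symmetric] algebra_simps)
    have "F1 1 - F1 0 + (F2 0 - F2 (-1)) = (E + E' - 1 - q) * (1 / a - 1 / b) / 2"
      unfolding F1_def F2_def using ab
      by (simp add: e algebra_simps add_divide_distrib diff_divide_distrib)
    also have "1 / a - 1 / b = 2 / (a * b)" using ab by (simp add: field_simps) (simp add: a_def b_def)
    also have "a * b = - complex_of_real (1 + x\<^sup>2)"
      by (simp add: a_def b_def algebra_simps power2_eq_square)
    also have "E + E' = complex_of_real (2 * exp (-1) * cos x)"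
    proof -
      have "E + E' = exp (-1) * (exp (\<i> * x) + exp (- (\<i> * x)))"
        unfolding E_def E'_def by (simp add: exp_add[symmetric] algebra_simps)
      also have "exp (\<i> * x) + exp (- (\<i> * x)) = 2 * complex_of_real (cos x)"
        by (simp add: cos_exp_eq flip: cos_of_real)
      finally show ?thesis by (simp flip: exp_of_real)
    qed
    also have "(complex_of_real (2 * exp (-1) * cos x) - 1 - q) * (2 / (- complex_of_real (1 + x\<^sup>2))) / 2
        = complex_of_real ((2 * exp (-1) * cos x - 1 - exp (-2)) * (2 / (- (1 + x\<^sup>2))) / 2)"
      unfolding q_def by simp
    also have "(2 * exp (-1) * cos x - 1 - exp (-2)) * (2 / (- (1 + x\<^sup>2))) / 2 = window x"
    proof -
      have "1 + x\<^sup>2 \<noteq> 0" by (metis add_pos_nonneg less_irrefl zero_le_power2 zero_less_one)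
      thus ?thesis unfolding window_def by (simp add: field_simps)
    qed
    finally show ?thesis .
  qed
  finally show ?thesis .
qed

lemma gaussian_fourier:
  assumes h: "h > 0"
  shows "(CLINT x|lborel. iexp (t * x) * exp (- (x / h)\<^sup>2 / 2)) = complex_of_real (h * sqrt (2 * pi) * exp (- (t * h)\<^sup>2 / 2))"
    and "integrable lborel (\<lambda>x. exp (- (x / h)\<^sup>2 / 2))"
    and "(LINT x|lborel. exp (- (x / h)\<^sup>2 / 2)) = h * sqrt (2 * pi)"
proof -
  have d: "exp (- x\<^sup>2 / 2) = sqrt (2 * pi) * std_normal_density x" for x
    by (simp add: std_normal_density_def)
  hence dc: "complex_of_real (exp (- (x\<^sup>2 / 2))) = complex_of_real (sqrt (2 * pi)) * complex_of_real (std_normal_density x)" for x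
    by (metis minus_divide_left of_real_mult)
  have "(CLINT x|lborel. iexp (t * x) * exp (- (x / h)\<^sup>2 / 2))
      = \<bar>h\<bar> *\<^sub>R (CLINT x|lborel. iexp (t * (0 + h * x)) * exp (- ((0 + h * x) / h)\<^sup>2 / 2))"
    by (rule lborel_integral_real_affine) (use h in simp)
  also have "(CLINT x|lborel. iexp (t * (0 + h * x)) * exp (- ((0 + h * x) / h)\<^sup>2 / 2))
      = (CLINT x|lborel. sqrt (2 * pi) * (std_normal_density x *\<^sub>R iexp (t * h * x)))"
    using h by (intro Bochner_Integration.integral_cong refl) (simp add: dc mult_ac scaleR_conv_of_real)
  also have "\<dots> = sqrt (2 * pi) * char std_normal_distribution (t * h)"
    by (subst integral_mult_right_zero) (simp add: char_def integral_density)
  finally show "(CLINT x|lborel. iexp (t * x) * exp (- (x / h)\<^sup>2 / 2)) = complex_of_real (h * sqrt (2 * pi) * exp (- (t * h)\<^sup>2 / 2))"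
    using h by (simp add: char_std_normal_distribution scaleR_conv_of_real)
  have "integrable lborel (\<lambda>x. sqrt (2 * pi) * std_normal_density x)" by simp
  hence g: "integrable lborel (\<lambda>x::real. exp (- x\<^sup>2 / 2))" by (simp only: d)
  have g1: "(LINT x|lborel. exp (- x\<^sup>2 / 2)) = sqrt (2 * pi)"
    by (simp only: d integral_mult_right_zero integral_normal_density mult_1_right)
  have i: "integrable lborel (\<lambda>x. exp (- (0 + (1/h) * x)\<^sup>2 / 2))"
    by (subst lborel_integrable_real_affine_iff[of "1/h" "\<lambda>x. exp (- x\<^sup>2 / 2)" 0])
       (use h g in auto)
  thus "integrable lborel (\<lambda>x. exp (- (x / h)\<^sup>2 / 2))" by simp
  have "(LINT x|lborel. exp (- (x / h)\<^sup>2 / 2)) = \<bar>h\<bar> *\<^sub>R (LINT x|lborel. exp (- ((0 + h * x) / h)\<^sup>2 / 2))"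
    by (rule lborel_integral_real_affine) (use h in simp)
  thus "(LINT x|lborel. exp (- (x / h)\<^sup>2 / 2)) = h * sqrt (2 * pi)"
    using h g1 by simp
qed

text \<open>
  After the substitution \<open>v = - s + u / h\<close> the Gaussian no longer depends on \<open>h\<close>, and dominated
  convergence applies.
\<close>

lemma gaussian_approximate_identity:
  assumes h: "filterlim h at_top sequentially" and pos: "\<And>n. h n > 0"
  shows "(\<lambda>n::nat. h n * (LINT v|lborel. window_hat v * exp (- ((s + v) * h n)\<^sup>2 / 2)))
           \<longlonglongrightarrow> sqrt (2 * pi) * window_hat s"
proof -
  have eq: "h n * (LINT v|lborel. window_hat v * exp (- ((s + v) * h n)\<^sup>2 / 2))
      = (LINT u|lborel. window_hat (-s + u / h n) * exp (- u\<^sup>2 / 2))" for n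
  proof -
    have "(LINT v|lborel. window_hat v * exp (- ((s + v) * h n)\<^sup>2 / 2))
      = \<bar>1 / h n\<bar> *\<^sub>R (LINT u|lborel. window_hat (-s + (1 / h n) * u) * exp (- ((s + (-s + (1 / h n) * u)) * h n)\<^sup>2 / 2))"
      by (rule lborel_integral_real_affine) (use pos[of n] in simp)
    thus ?thesis using pos[of n] by simp
  qed
  have "(\<lambda>n. LINT u|lborel. window_hat (-s + u / h n) * exp (- u\<^sup>2 / 2))
          \<longlonglongrightarrow> (LINT u|lborel. window_hat (-s) * exp (- u\<^sup>2 / 2))"
  proof (rule integral_dominated_convergence[where w="\<lambda>u. exp (- u\<^sup>2 / 2)"])
    show "integrable lborel (\<lambda>u::real. exp (- u\<^sup>2 / 2))"
      using gaussian_fourier(2)[of 1] by simp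
    show "AE u in lborel. (\<lambda>n. window_hat (-s + u / h n) * exp (- u\<^sup>2 / 2)) \<longlonglongrightarrow> window_hat (-s) * exp (- u\<^sup>2 / 2)"
    proof (rule AE_I2)
      fix u :: real
      have "(\<lambda>n. u / h n) \<longlonglongrightarrow> 0"
        by (rule tendsto_divide_0[OF tendsto_const filterlim_at_top_imp_at_infinity[OF h]])
      hence "(\<lambda>n. -s + u / h n) \<longlonglongrightarrow> -s" by (auto intro: tendsto_eq_intros)
      thus "(\<lambda>n. window_hat (-s + u / h n) * exp (- u\<^sup>2 / 2)) \<longlonglongrightarrow> window_hat (-s) * exp (- u\<^sup>2 / 2)"
        by (intro tendsto_mult isCont_tendsto_compose[OF continuous_window_hat] tendsto_const)
    qed
    show "AE u in lborel. norm (window_hat (-s + u / h n) * exp (- u\<^sup>2 / 2)) \<le> exp (- u\<^sup>2 / 2)" for n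
      using mult_right_mono[OF window_hat_le] by (intro AE_I2) (auto simp: abs_mult)
  qed measurable
  also have "(LINT u|lborel. window_hat (-s) * exp (- u\<^sup>2 / 2)) = sqrt (2 * pi) * window_hat s"
    using gaussian_fourier(3)[of 1] by simp
  finally show ?thesis by (simp only: eq)
qed

text \<open>
  Fourier inversion for the window. A wide Gaussian factor makes Fubini's theorem applicable; its
  effect disappears in the limit on the one side, and on the other side it becomes an approximate
  identity.
\<close>

lemma window_hat_fourier:
  "(CLINT x|lborel. window x * iexp (s * x)) = complex_of_real (2 * pi * window_hat s)"
proof (rule LIMSEQ_unique)
  let ?h = "\<lambda>n. real (Suc n)"
  have hlim: "filterlim ?h at_top sequentially"
    by (rule filterlim_compose[OF filterlim_real_sequentially filterlim_Suc])
  show "(\<lambda>n. CLINT x|lborel. window x * iexp (s * x) * exp (- (x / ?h n)\<^sup>2 / 2))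
           \<longlonglongrightarrow> (CLINT x|lborel. window x * iexp (s * x))"
  proof (rule integral_dominated_convergence[where w=window])
    show "AE x in lborel. (\<lambda>n. window x * iexp (s * x) * exp (- (x / ?h n)\<^sup>2 / 2)) \<longlonglongrightarrow> window x * iexp (s * x)"
    proof (rule AE_I2)
      fix x :: real
      have "(\<lambda>n. x / ?h n) \<longlonglongrightarrow> 0"
        by (rule tendsto_divide_0[OF tendsto_const filterlim_at_top_imp_at_infinity[OF hlim]])
      hence "(\<lambda>n. exp (- (x / ?h n)\<^sup>2 / 2)) \<longlonglongrightarrow> exp (- 0\<^sup>2 / 2)" by (intro tendsto_intros) auto
      hence "(\<lambda>n. complex_of_real (exp (- (x / ?h n)\<^sup>2 / 2))) \<longlonglongrightarrow> 1"
        using tendsto_of_real[where 'a=complex] by fastforce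
      from tendsto_mult[OF tendsto_const this, of "window x * iexp (s * x)"]
      show "(\<lambda>n. window x * iexp (s * x) * exp (- (x / ?h n)\<^sup>2 / 2)) \<longlonglongrightarrow> window x * iexp (s * x)"
        by (simp only: mult_1_right)
    qed
    show "AE x in lborel. norm (window x * iexp (s * x) * exp (- (x / ?h n)\<^sup>2 / 2)) \<le> window x" for n
      using window_pos by (intro AE_I2) (auto simp: norm_mult less_imp_le intro!: mult_left_le)
    show "(\<lambda>x. window x * iexp (s * x)) \<in> borel_measurable lborel" by measurable
    show "(\<lambda>x. window x * iexp (s * x) * exp (- (x / ?h n)\<^sup>2 / 2)) \<in> borel_measurable lborel" for n
      by measurable
  qed simp
  have "(CLINT x|lborel. window x * iexp (s * x) * exp (- (x / h)\<^sup>2 / 2))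
      = sqrt (2 * pi) * (h * (LINT v|lborel. window_hat v * exp (- ((s + v) * h)\<^sup>2 / 2)))"
    if h: "h > 0" for h :: real
  proof -
    let ?f = "\<lambda>x v. window_hat v * (iexp ((s + v) * x) * exp (- (x / h)\<^sup>2 / 2)) :: complex"
    have "(CLINT x|lborel. window x * iexp (s * x) * exp (- (x / h)\<^sup>2 / 2))
        = (CLINT x|lborel. CLINT v|lborel. ?f x v)"
    proof (rule Bochner_Integration.integral_cong[OF refl])
      fix x
      have "(CLINT v|lborel. ?f x v)
          = (CLINT v|lborel. window_hat v * iexp (v * x) * (iexp (s * x) * exp (- (x / h)\<^sup>2 / 2)))"
        by (intro Bochner_Integration.integral_cong refl) (simp add: algebra_simps exp_add)
      also have "\<dots> = window x * (iexp (s * x) * exp (- (x / h)\<^sup>2 / 2))"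
        by (subst integral_mult_left_zero) (simp only: window_fourier)
      finally show "window x * iexp (s * x) * exp (- (x / h)\<^sup>2 / 2) = (CLINT v|lborel. ?f x v)"
        by (simp add: mult_ac)
    qed
    also have "\<dots> = (CLINT v|lborel. CLINT x|lborel. ?f x v)"
    proof (rule lborel_pair.Fubini_integral[symmetric], rule lborel_pair.Fubini_integrable)
      have n: "norm (?f x v) = exp (- (x / h)\<^sup>2 / 2) * window_hat v" for x v by (simp add: norm_mult)
      show "integrable lborel (\<lambda>x. LINT v|lborel. norm (case (x, v) of (x, v) \<Rightarrow> ?f x v))"
        unfolding prod.case n integral_mult_right_zero
        by (rule integrable_mult_left[OF gaussian_fourier(2)[OF h]])
      have "integrable lborel (\<lambda>v. ?f x v)" for x
      proof (rule Bochner_Integration.integrable_bound[OF integrable_window_hat])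
        show "AE v in lborel. norm (?f x v) \<le> norm (window_hat v)"
          unfolding n real_norm_def abs_of_nonneg[OF window_hat_nonneg]
          by (intro AE_I2 mult_left_le_one_le) auto
      qed measurable
      thus "AE x in lborel. integrable lborel (\<lambda>v. case (x, v) of (x, v) \<Rightarrow> ?f x v)" by simp
    qed measurable
    also have "\<dots> = (CLINT v|lborel. complex_of_real (sqrt (2 * pi) * (h * (window_hat v * exp (- ((s + v) * h)\<^sup>2 / 2)))))"
      by (intro Bochner_Integration.integral_cong refl, subst integral_mult_right_zero, subst gaussian_fourier(1)[OF h])
         (simp add: mult_ac)
    also have "\<dots> = sqrt (2 * pi) * (h * (LINT v|lborel. window_hat v * exp (- ((s + v) * h)\<^sup>2 / 2)))"
      by (simp only: integral_complex_of_real) simp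
    finally show ?thesis .
  qed
  moreover have "(\<lambda>n. complex_of_real (sqrt (2 * pi) * (?h n * (LINT v|lborel. window_hat v * exp (- ((s + v) * ?h n)\<^sup>2 / 2)))))
      \<longlonglongrightarrow> complex_of_real (sqrt (2 * pi) * (sqrt (2 * pi) * window_hat s))"
    by (intro tendsto_of_real tendsto_mult tendsto_const gaussian_approximate_identity[OF hlim]) simp
  ultimately show "(\<lambda>n. CLINT x|lborel. window x * iexp (s * x) * exp (- (x / ?h n)\<^sup>2 / 2))
           \<longlonglongrightarrow> complex_of_real (2 * pi * window_hat s)"
    by (simp add: mult.assoc[symmetric] del: of_nat_Suc)
qed

section \<open>Sharp tails from complex exponential moments\<close>

text \<open>
  With \<open>X = h (W - h)\<close>, the tail is \<open>E (exp (- X) 1\<^bsub>X > 0\<^esub>)\<close> under the law tilted by \<open>exp (h W)\<close>, up to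
  the normalisation. The claim is that the tilted law of \<open>X\<close>, multiplied by \<open>h\<close>, converges to
  Lebesgue measure divided by \<open>sqrt (2 \<pi>)\<close>. These measures have unbounded mass; weighted with the
  window they become finite, and the window being a Fourier integral over \<open>[-1, 1]\<close>, their
  characteristic functions are averages of \<open>E exp ((h + i u) W)\<close> over \<open>\<bar>u\<bar> \<le> (\<bar>s\<bar> + 1) h\<close>. The assumption
  identifies the limit there, and Levy's theorem yields weak convergence. Since the window has no
  zeros, \<open>exp (- X) 1\<^bsub>X > 0\<^esub>\<close> divided by the window is a bounded test function that is continuous except at
  \<open>0\<close>.
\<close>

lemma sharp_upper_tail:
  fixes \<Omega> :: "nat \<Rightarrow> 'a set" and W :: "nat \<Rightarrow> 'a \<Rightarrow> real" and h :: "nat \<Rightarrow> real"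
  assumes fin: "\<And>n. finite (\<Omega> n)" and ne: "\<And>n. \<Omega> n \<noteq> {}"
    and h: "filterlim h at_top sequentially" and pos: "\<And>n. h n > 0"
    and mgf: "\<And>K \<epsilon>. K > 0 \<Longrightarrow> \<epsilon> > 0 \<Longrightarrow> \<forall>\<^sub>F n in sequentially. \<forall>u. \<bar>u\<bar> \<le> K * h n \<longrightarrow>
          norm ((\<Sum>\<omega>\<in>\<Omega> n. exp (Complex (h n) u * W n \<omega>)) / card (\<Omega> n) - exp ((Complex (h n) u)\<^sup>2 / 2))
            \<le> \<epsilon> * exp (((h n)\<^sup>2 - u\<^sup>2) / 2)"
  shows "(\<lambda>n. h n * sqrt (2 * pi) * exp ((h n)\<^sup>2 / 2) * (card {\<omega>\<in>\<Omega> n. W n \<omega> > h n} / card (\<Omega> n))) \<longlonglongrightarrow> 1"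
proof -
  define X where "X = (\<lambda>n \<omega>. h n * (W n \<omega> - h n))"
  define wt where "wt = (\<lambda>n \<omega>. h n * exp (h n * W n \<omega> - (h n)\<^sup>2 / 2) / card (\<Omega> n))"
  define \<alpha> where "\<alpha> = (\<lambda>n s. \<Sum>\<omega>\<in>\<Omega> n. complex_of_real (wt n \<omega> * window (X n \<omega>)) * iexp (s * X n \<omega>))"
  define Z where "Z = (\<lambda>n. \<Sum>\<omega>\<in>\<Omega> n. wt n \<omega> * window (X n \<omega>))"
  have card: "card (\<Omega> n) > 0" for n using fin ne by (simp add: card_gt_0_iff)
  have wt: "wt n \<omega> > 0" for n \<omega> using pos card by (simp add: wt_def)
  have Z: "Z n > 0" for n unfolding Z_def using wt window_pos fin ne by (intro sum_pos) auto
  let ?\<phi> = "\<lambda>n s v. exp (- ((s + v) * h n)\<^sup>2 / 2)"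
  define G where "G = (\<lambda>n s. h n * (LINT v|lborel. window_hat v * ?\<phi> n s v))"
  have G: "(\<lambda>n. G n s) \<longlonglongrightarrow> sqrt (2 * pi) * window_hat s" for s
    unfolding G_def by (rule gaussian_approximate_identity[OF h pos])
  have int_r: "integrable lborel (\<lambda>v. window_hat v * ?\<phi> n s v)" for n s
  proof (rule Bochner_Integration.integrable_bound[OF integrable_window_hat])
    show "AE v in lborel. norm (window_hat v * ?\<phi> n s v) \<le> norm (window_hat v)"
      by (intro AE_I2) (auto simp: abs_mult intro!: mult_left_le)
  qed measurable
  have int_c: "integrable lborel (\<lambda>v. window_hat v * iexp (v * x))" for x
  proof (rule Bochner_Integration.integrable_bound[OF integrable_window_hat])
    show "AE v in lborel. norm (window_hat v * iexp (v * x)) \<le> norm (window_hat v)"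
      by (intro AE_I2) (auto simp: norm_mult)
  qed measurable

  have \<alpha>_lim: "(\<lambda>n. \<alpha> n s) \<longlonglongrightarrow> complex_of_real (sqrt (2 * pi) * window_hat s)" for s
  proof -
    \<comment> \<open>By \<open>T_bound\<close> below, close to the Gaussian \<open>h exp (- u\<^sup>2 / 2)\<close> at \<open>u = (s + v) h\<close>.\<close>
    define T where "T = (\<lambda>n v. \<Sum>\<omega>\<in>\<Omega> n. wt n \<omega> * iexp ((s + v) * X n \<omega>))"
    have \<alpha>_eq: "\<alpha> n s = (CLINT v|lborel. window_hat v * T n v)"
      and T_int: "integrable lborel (\<lambda>v. window_hat v * T n v)" for n
    proof -
      have eq: "complex_of_real (window_hat v) * T n v
          = (\<Sum>\<omega>\<in>\<Omega> n. (wt n \<omega> * iexp (s * X n \<omega>)) * (window_hat v * iexp (v * X n \<omega>)))" for v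
        by (simp add: T_def sum_distrib_left algebra_simps exp_add)
      show "integrable lborel (\<lambda>v. window_hat v * T n v)"
        unfolding eq by (intro Bochner_Integration.integrable_sum integrable_mult_right int_c)
      have "(CLINT v|lborel. window_hat v * T n v)
          = (\<Sum>\<omega>\<in>\<Omega> n. (wt n \<omega> * iexp (s * X n \<omega>)) * (CLINT v|lborel. window_hat v * iexp (v * X n \<omega>)))"
        unfolding eq
        by (subst Bochner_Integration.integral_sum) (intro integrable_mult_right int_c, simp only: integral_mult_right_zero)
      thus "\<alpha> n s = (CLINT v|lborel. window_hat v * T n v)"
        by (simp only: window_fourier \<alpha>_def) (simp add: mult_ac)
    qed
    have T_bound: "norm (T n v - h n * ?\<phi> n s v) \<le> \<epsilon> * (h n * ?\<phi> n s v)"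
      if b: "norm ((\<Sum>\<omega>\<in>\<Omega> n. exp (Complex (h n) ((s+v) * h n) * W n \<omega>)) / card (\<Omega> n) - exp ((Complex (h n) ((s+v) * h n))\<^sup>2 / 2))
            \<le> \<epsilon> * exp (((h n)\<^sup>2 - ((s+v) * h n)\<^sup>2) / 2)" for n v \<epsilon>
    proof -
      define u where "u = (s + v) * h n"
      define c where "c = h n * exp (- complex_of_real ((h n)\<^sup>2 / 2) - \<i> * (u * h n))"
      have nc: "norm c = h n * exp (- ((h n)\<^sup>2 / 2))"
        using pos[of n] by (simp add: c_def norm_mult)
      have "wt n \<omega> * iexp ((s + v) * X n \<omega>) = c * exp (Complex (h n) u * W n \<omega>) / card (\<Omega> n)" for \<omega>
        unfolding wt_def c_def X_def u_def Complex_eq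
        by (simp add: exp_add[symmetric] exp_of_real[symmetric] algebra_simps power2_eq_square)
      hence 1: "T n v = c * ((\<Sum>\<omega>\<in>\<Omega> n. exp (Complex (h n) u * W n \<omega>)) / card (\<Omega> n))"
        unfolding T_def by (simp add: sum_distrib_left sum_divide_distrib)
      have 2: "h n * exp (- u\<^sup>2 / 2) = c * exp ((Complex (h n) u)\<^sup>2 / 2)"
      proof -
        define A B D where "A = complex_of_real ((h n)\<^sup>2 / 2)" and "B = \<i> * complex_of_real (u * h n)"
          and "D = complex_of_real (u\<^sup>2 / 2)"
        have "(Complex (h n) u)\<^sup>2 / 2 = A - D + B"
          by (simp add: A_def B_def D_def complex_eq_iff power2_eq_square diff_divide_distrib)
        hence "c * exp ((Complex (h n) u)\<^sup>2 / 2) = h n * (exp (- A - B) * exp (A - D + B))"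
          by (simp only: c_def A_def B_def mult.assoc of_real_mult)
        also have "exp (- A - B) * exp (A - D + B) = exp (- D)"
          by (simp only: exp_add[symmetric]) simp
        finally have "c * exp ((Complex (h n) u)\<^sup>2 / 2) = h n * exp (- complex_of_real (u\<^sup>2 / 2))"
          by (simp only: D_def)
        thus ?thesis by (simp add: exp_of_real[symmetric])
      qed
      have "norm (T n v - h n * exp (- u\<^sup>2 / 2)) \<le> norm c * (\<epsilon> * exp (((h n)\<^sup>2 - u\<^sup>2) / 2))"
        unfolding 1 2 right_diff_distrib[symmetric] norm_mult
        using b by (intro mult_left_mono) (auto simp: u_def)
      also have "\<dots> = \<epsilon> * (h n * exp (- u\<^sup>2 / 2))"
        by (simp add: nc mult_exp_exp diff_divide_distrib)
      finally show ?thesis by (simp only: u_def)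
    qed
    have "(\<lambda>n. \<alpha> n s - complex_of_real (G n s)) \<longlonglongrightarrow> 0"
    proof (rule tendstoI)
      fix e :: real assume e: "e > 0"
      define L where "L = sqrt (2 * pi) * window_hat s + 1"
      have L: "L > 0" unfolding L_def by (intro add_nonneg_pos mult_nonneg_nonneg) auto
      define \<epsilon> where "\<epsilon> = e / (2 * L)"
      have \<epsilon>: "\<epsilon> > 0" using e L by (simp add: \<epsilon>_def)
      have "\<bar>s\<bar> + 1 > 0" by simp
      from mgf[OF this \<epsilon>] show "\<forall>\<^sub>F n in sequentially. dist (\<alpha> n s - complex_of_real (G n s)) 0 < e"
        using order_tendstoD(2)[OF G[of s], of L, unfolded L_def, simplified, folded L_def]
      proof eventually_elim
        case (elim n)
        let ?g = "\<lambda>v. window_hat v * ?\<phi> n s v"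
        have GL: "G n s < L" using elim by (simp add: L_def)
        have "\<alpha> n s - complex_of_real (G n s)
            = (CLINT v|lborel. window_hat v * T n v) - (CLINT v|lborel. complex_of_real (h n * ?g v))"
          by (simp only: \<alpha>_eq G_def integral_complex_of_real integral_mult_right_zero)
        also have "\<dots> = (CLINT v|lborel. window_hat v * T n v - complex_of_real (h n * ?g v))"
          by (rule Bochner_Integration.integral_diff[symmetric])
             (intro T_int integrable_of_real integrable_mult_right int_r)+
        also have "norm \<dots> \<le> (LINT v|lborel. \<epsilon> * (h n * ?g v))"
        proof (rule Bochner_Integration.integral_norm_bound_integral)
          show "integrable lborel (\<lambda>v. window_hat v * T n v - complex_of_real (h n * ?g v))"
            by (intro Bochner_Integration.integrable_diff T_int integrable_of_real integrable_mult_right int_r)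
          show "integrable lborel (\<lambda>v. \<epsilon> * (h n * ?g v))"
            by (intro integrable_mult_right int_r)
          fix v
          show "norm (window_hat v * T n v - complex_of_real (h n * ?g v)) \<le> \<epsilon> * (h n * ?g v)"
          proof (cases "\<bar>v\<bar> \<le> 1")
            case True
            hence "\<bar>(s + v) * h n\<bar> \<le> (\<bar>s\<bar> + 1) * h n"
              unfolding abs_mult using pos[of n] by (intro mult_mono) auto
            hence "norm (T n v - h n * ?\<phi> n s v) \<le> \<epsilon> * (h n * ?\<phi> n s v)"
              using elim by (intro T_bound) blast
            hence "window_hat v * norm (T n v - h n * ?\<phi> n s v) \<le> window_hat v * (\<epsilon> * (h n * ?\<phi> n s v))"
              by (intro mult_left_mono) auto
            moreover have "window_hat v * T n v - complex_of_real (h n * ?g v)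
                = window_hat v * (T n v - h n * ?\<phi> n s v)" by (simp add: algebra_simps)
            ultimately show ?thesis by (simp add: norm_mult mult_ac)
          next
            case False
            thus ?thesis by (simp add: window_hat_zero)
          qed
        qed
        also have "\<dots> = \<epsilon> * G n s" by (simp only: G_def integral_mult_right_zero)
        also have "\<dots> \<le> \<epsilon> * L" using \<epsilon> GL by (intro mult_left_mono) auto
        also have "\<dots> < e" using e L by (simp add: \<epsilon>_def)
        finally show ?case by (simp add: dist_norm)
      qed
    qed
    from tendsto_add[OF this tendsto_of_real[OF G[of s]]] show ?thesis by simp
  qed

  have "\<alpha> n 0 = complex_of_real (Z n)" for n by (simp add: \<alpha>_def Z_def)
  hence Z_lim: "Z \<longlonglongrightarrow> sqrt (2 * pi) * window_hat 0"
    using \<alpha>_lim[of 0] by (simp add: tendsto_of_real_iff del: of_real_mult)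

  define \<mu> where "\<mu> = (\<lambda>n. distr (point_measure (\<Omega> n) (\<lambda>\<omega>. ennreal (wt n \<omega> * window (X n \<omega>) / Z n))) borel (X n))"
  define \<mu>' where "\<mu>' = density lborel (\<lambda>x. ennreal (window x / (2 * pi * window_hat 0)))"
  have wnn: "0 \<le> wt n \<omega> * window (X n \<omega>) / Z n" for n \<omega>
    using wt window_pos Z by (simp add: less_imp_le)
  have int_\<mu>: "integral\<^sup>L (\<mu> n) f = (\<Sum>\<omega>\<in>\<Omega> n. (wt n \<omega> * window (X n \<omega>) / Z n) *\<^sub>R f (X n \<omega>))"
    if "f \<in> borel_measurable borel" for n and f :: "real \<Rightarrow> 'c :: {banach, second_countable_topology}"
    unfolding \<mu>_def using that fin wnn
    by (subst integral_distr) (auto simp: point_measure_def lebesgue_integral_point_measure_finite[unfolded point_measure_def])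
  have r0: "2 * pi * window_hat 0 > 0" using window_hat_0 by simp
  have int_\<mu>': "integral\<^sup>L \<mu>' f = (\<integral>x. (window x / (2 * pi * window_hat 0)) *\<^sub>R f x \<partial>lborel)"
    if "f \<in> borel_measurable borel" for f :: "real \<Rightarrow> 'c :: {banach, second_countable_topology}"
    unfolding \<mu>'_def using that r0 window_pos
    by (subst integral_density) (auto simp: less_imp_le intro!: AE_I2 divide_nonneg_pos)
  have d\<mu>: "real_distribution (\<mu> n)" for n
  proof -
    have "emeasure (point_measure (\<Omega> n) (\<lambda>\<omega>. ennreal (wt n \<omega> * window (X n \<omega>) / Z n))) (\<Omega> n)
        = ennreal (\<Sum>\<omega>\<in>\<Omega> n. wt n \<omega> * window (X n \<omega>) / Z n)"
      using fin wnn by (subst emeasure_point_measure_finite) auto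
    also have "(\<Sum>\<omega>\<in>\<Omega> n. wt n \<omega> * window (X n \<omega>) / Z n) = 1"
      using Z[of n] unfolding sum_divide_distrib[symmetric] by (simp add: Z_def)
    finally have "prob_space (point_measure (\<Omega> n) (\<lambda>\<omega>. ennreal (wt n \<omega> * window (X n \<omega>) / Z n)))"
      by (intro prob_spaceI) (simp add: space_point_measure)
    then interpret prob_space "point_measure (\<Omega> n) (\<lambda>\<omega>. ennreal (wt n \<omega> * window (X n \<omega>) / Z n))" .
    show ?thesis unfolding \<mu>_def by (rule real_distribution_distr) (simp add: point_measure_def)
  qed
  have int_w: "(LINT x|lborel. window x) = 2 * pi * window_hat 0"
  proof -
    have "complex_of_real (LINT x|lborel. window x) = complex_of_real (2 * pi * window_hat 0)"
      using window_hat_fourier[of 0] by (simp add: integral_complex_of_real del: of_real_mult)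
    thus ?thesis by (simp only: of_real_eq_iff)
  qed
  have d\<mu>': "real_distribution \<mu>'"
  proof -
    have "emeasure \<mu>' (space \<mu>') = (\<integral>\<^sup>+x. ennreal (window x / (2 * pi * window_hat 0)) \<partial>lborel)"
      unfolding \<mu>'_def by (subst emeasure_density) auto
    also have "\<dots> = ennreal (LINT x|lborel. window x / (2 * pi * window_hat 0))"
      using r0 window_pos by (intro nn_integral_eq_integral) (auto simp: less_imp_le intro!: divide_nonneg_pos AE_I2)
    also have "\<dots> = 1" using int_w window_hat_0[THEN less_imp_neq] by simp
    finally have "prob_space \<mu>'" by (rule prob_spaceI)
    thus ?thesis by (auto simp: real_distribution_def real_distribution_axioms_def \<mu>'_def)
  qed
  have weak: "weak_conv_m \<mu> \<mu>'"
  proof (rule levy_continuity[OF d\<mu> d\<mu>'])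
    fix s
    have "char (\<mu> n) s = \<alpha> n s / complex_of_real (Z n)" for n
      unfolding char_def
      by (subst int_\<mu>) (auto simp: \<alpha>_def sum_divide_distrib scaleR_conv_of_real)
    moreover have "char \<mu>' s = complex_of_real (sqrt (2 * pi) * window_hat s) / complex_of_real (sqrt (2 * pi) * window_hat 0)"
    proof -
      have "char \<mu>' s = (CLINT x|lborel. (window x * iexp (s * x)) / complex_of_real (2 * pi * window_hat 0))"
        unfolding char_def by (subst int_\<mu>') (auto simp: scaleR_conv_of_real)
      also have "\<dots> = complex_of_real (2 * pi * window_hat s) / complex_of_real (2 * pi * window_hat 0)"
        by (simp only: integral_divide_zero window_hat_fourier)
      finally show ?thesis by simp
    qed
    moreover have "(\<lambda>n. \<alpha> n s / complex_of_real (Z n)) \<longlonglongrightarrow>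
        complex_of_real (sqrt (2 * pi) * window_hat s) / complex_of_real (sqrt (2 * pi) * window_hat 0)"
      using window_hat_0 by (intro tendsto_divide \<alpha>_lim tendsto_of_real Z_lim) auto
    ultimately show "(\<lambda>n. char (\<mu> n) s) \<longlonglongrightarrow> char \<mu>' s" by simp
  qed

  \<comment> \<open>the test function that turns the weighted law back into the tail\<close>
  define f where "f = (\<lambda>x::real. if x > 0 then exp (- x) / window x else 0)"
  have f_meas [measurable]: "f \<in> borel_measurable borel" unfolding f_def by measurable
  have f_bdd: "norm (f x) \<le> 2 / (1 - exp (-1))\<^sup>2" for x
  proof (cases "x > 0")
    case True
    \<comment> \<open>The window decays only quadratically, so the exponential wins.\<close>
    have "exp x \<ge> 1 + x + x\<^sup>2 / 2" using exp_lower_Taylor_quadratic[of x] True by simp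
    hence e: "exp x * 2 \<ge> 1 + x\<^sup>2" using True zero_le_power2[of x] by linarith
    have q: "(1 - exp (-1 :: real))\<^sup>2 > 0" by simp
    have p: "1 + x\<^sup>2 > 0" by (simp add: add_pos_nonneg)
    have "exp (- x) / window x \<le> exp (- x) / ((1 - exp (-1))\<^sup>2 / (1 + x\<^sup>2))"
      using window_lower[of x] q p by (intro divide_left_mono mult_pos_pos window_pos) auto
    also have "\<dots> = (1 + x\<^sup>2) * exp (- x) / (1 - exp (-1))\<^sup>2" using p by (simp add: field_simps)
    also have "\<dots> \<le> 2 / (1 - exp (-1))\<^sup>2"
      using e q by (intro divide_right_mono) (auto simp: exp_minus field_simps)
    finally show ?thesis using True window_pos[of x] by (simp add: f_def)
  qed (simp add: f_def)
  have f_cont: "isCont f x" if "x \<noteq> 0" for x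
  proof (cases "x > 0")
    case True
    have "isCont (\<lambda>x. exp (- x) / window x) x"
      using window_pos[of x] by (intro continuous_intros continuous_window) auto
    moreover have "\<forall>\<^sub>F y in nhds x. f y = exp (- y) / window y"
      using eventually_nhds_in_open[of "{0<..}" x] True by (auto simp: f_def elim: eventually_mono)
    ultimately show ?thesis by (simp add: isCont_cong)
  next
    case False
    hence "\<forall>\<^sub>F y in nhds x. f y = 0"
      using eventually_nhds_in_open[of "{..<0}" x] that by (auto simp: f_def elim!: eventually_mono)
    thus ?thesis by (simp add: isCont_cong)
  qed
  have "(\<lambda>n. integral\<^sup>L (\<mu> n) f) \<longlonglongrightarrow> integral\<^sup>L \<mu>' f"
  proof (rule weak_conv_imp_bdd_ae_continuous_conv[OF d\<mu> d\<mu>' weak _ f_bdd f_meas])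
    have "{x. \<not> isCont f x} \<subseteq> {0}" using f_cont by auto
    hence cases: "{x. \<not> isCont f x} = {} \<or> {x. \<not> isCont f x} = {0}" by (rule subset_singletonD)
    have z: "{0::real} \<in> null_sets lborel" by (intro null_setsI) auto
    have "emeasure \<mu>' {0} = 0" unfolding \<mu>'_def
      by (subst emeasure_density) (simp_all only: nn_integral_null_set[OF z], simp_all)
    with cases show "emeasure \<mu>' {x. \<not> isCont f x} = 0" by (elim disjE) simp_all
  qed
  moreover have "integral\<^sup>L \<mu>' f = 1 / (2 * pi * window_hat 0)"
  proof -
    have "integral\<^sup>L \<mu>' f = (LINT x|lborel. (indicator {0<..} x *\<^sub>R exp (- x)) / (2 * pi * window_hat 0))"
      by (subst int_\<mu>'[OF f_meas], intro Bochner_Integration.integral_cong refl)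
         (use window_pos[THEN less_imp_neq, symmetric] in \<open>auto simp: f_def indicator_def\<close>)
    also have "\<dots> = 1 / (2 * pi * window_hat 0)"
      using has_bochner_integral_I0i_power_exp_m[of 0]
      by (simp add: has_bochner_integral_iff mult.commute)
    finally show ?thesis .
  qed
  moreover define Q where "Q = (\<lambda>n. h n * exp ((h n)\<^sup>2 / 2) * (card {\<omega>\<in>\<Omega> n. W n \<omega> > h n} / card (\<Omega> n)))"
  have "integral\<^sup>L (\<mu> n) f = Q n / Z n" for n
  proof -
    have "integral\<^sup>L (\<mu> n) f = (\<Sum>\<omega>\<in>\<Omega> n. if W n \<omega> > h n then h n * exp ((h n)\<^sup>2 / 2) / card (\<Omega> n) / Z n else 0)"
      unfolding int_\<mu>[OF f_meas]
    proof (intro sum.cong refl)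
      fix \<omega>
      have "wt n \<omega> * exp (- X n \<omega>) = h n * exp ((h n)\<^sup>2 / 2) / card (\<Omega> n)"
        by (simp add: wt_def X_def mult_exp_exp power2_eq_square algebra_simps)
      moreover have "X n \<omega> > 0 \<longleftrightarrow> W n \<omega> > h n" using pos[of n] by (simp add: X_def zero_less_mult_iff)
      ultimately show "(wt n \<omega> * window (X n \<omega>) / Z n) *\<^sub>R f (X n \<omega>)
          = (if W n \<omega> > h n then h n * exp ((h n)\<^sup>2 / 2) / card (\<Omega> n) / Z n else 0)"
        using window_pos[of "X n \<omega>"] by (auto simp: f_def)
    qed
    also have "\<dots> = Q n / Z n"
      using fin by (simp add: sum.If_cases Q_def Int_def)
    finally show ?thesis .
  qed
  ultimately have "(\<lambda>n. Q n / Z n) \<longlonglongrightarrow> 1 / (2 * pi * window_hat 0)" by simp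
  from tendsto_mult[OF tendsto_mult[OF tendsto_const this] Z_lim, of "sqrt (2 * pi)"]
  have "(\<lambda>n. sqrt (2 * pi) * (Q n / Z n) * Z n) \<longlonglongrightarrow> 
    sqrt (2 * pi) * (1 / (2 * pi * window_hat 0)) * (sqrt (2 * pi) * window_hat 0)" .
  moreover have "sqrt (2 * pi) * (1 / (2 * pi * window_hat 0)) * (sqrt (2 * pi) * window_hat 0) = 1"
  proof -
    have "sqrt (2 * pi) * (1 / (2 * pi * window_hat 0)) * (sqrt (2 * pi) * window_hat 0)
      = (sqrt (2 * pi))\<^sup>2 * window_hat 0 / (2 * pi * window_hat 0)"
      by (simp add: power2_eq_square)
    thus ?thesis using window_hat_0 by simp
  qed
  moreover have "sqrt (2 * pi) * (Q n / Z n) * Z n = h n * sqrt (2 * pi) * exp ((h n)\<^sup>2 / 2) * (card {\<omega>\<in>\<Omega> n. W n \<omega> > h n} / card (\<Omega> n))" for n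
    using Z[of n] by (simp add: Q_def)
  ultimately show ?thesis by simp
qed

section \<open>Moderate deviations of permutation statistics\<close>

text \<open>
  By symmetry the average over \<open>p\<close> does not depend on \<open>i\<close>, so one may average over \<open>i\<close> as well.
\<close>

lemma sum_permutations_one_point:
  fixes f :: "nat \<Rightarrow> real"
  assumes S: "finite S" "i \<in> S"
  shows "card S * (\<Sum>p | p permutes S. f (p i)) = fact (card S) * (\<Sum>j\<in>S. f j)"
proof -
  have eq: "(\<Sum>p | p permutes S. f (p k)) = (\<Sum>p | p permutes S. f (p i))" if k: "k \<in> S" for k
    by (subst sum_permutations_compose_right[OF permutes_swap_id[OF k S(2)]]) simp
  have "card S * (\<Sum>p | p permutes S. f (p i)) = (\<Sum>k\<in>S. \<Sum>p | p permutes S. f (p k))"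
    by (simp add: eq)
  also have "\<dots> = (\<Sum>p | p permutes S. \<Sum>k\<in>S. f (p k))" by (rule sum.swap)
  also have "\<dots> = (\<Sum>p | p permutes S. \<Sum>j\<in>S. f j)"
  proof (rule sum.cong[OF refl])
    fix p assume "p \<in> {p. p permutes S}"
    thus "(\<Sum>k\<in>S. f (p k)) = (\<Sum>j\<in>S. f j)" using sum.permute[of p S f] by (simp add: comp_def)
  qed
  finally show ?thesis using S(1) by (simp add: card_permutations[OF refl])
qed

text \<open>
  For \<open>i \<noteq> k\<close> the products \<open>b (p i) * b (p k)\<close> have the same average for all \<open>k\<close>, by symmetry. Summing over \<open>k\<close>
  and using that \<open>b\<close> sums to \<open>0\<close> expresses it by the average of \<open>(b (p i))\<^sup>2\<close>.
\<close>

lemma permutation_statistic_moments: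
  fixes a b :: "nat \<Rightarrow> real"
  assumes n: "n \<ge> 2" and a: "(\<Sum>i=1..n. a i) = 0" and b: "(\<Sum>i=1..n. b i) = 0"
  shows "(\<Sum>p | p permutes {1..n}. \<Sum>i=1..n. a i * b (p i)) = 0"
    and "(\<Sum>p | p permutes {1..n}. (\<Sum>i=1..n. a i * b (p i))\<^sup>2)
           = fact n * (\<Sum>i=1..n. (a i)\<^sup>2) * (\<Sum>i=1..n. (b i)\<^sup>2) / (n - 1)"
proof -
  let ?S = "{1..n}" and ?P = "{p. p permutes {1..n}}"
  define m where "m = fact n * (\<Sum>i\<in>?S. (b i)\<^sup>2) / n"
  have m1: "(\<Sum>p\<in>?P. b (p i)) = 0" and m2: "(\<Sum>p\<in>?P. (b (p i))\<^sup>2) = m" if "i \<in> ?S" for i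
    using sum_permutations_one_point[OF _ that, of b] sum_permutations_one_point[OF _ that, of "\<lambda>j. (b j)\<^sup>2"] n b
    by (auto simp: m_def field_simps simp del: One_nat_def)
  have "(\<Sum>p\<in>?P. \<Sum>i\<in>?S. a i * b (p i)) = (\<Sum>i\<in>?S. a i * (\<Sum>p\<in>?P. b (p i)))"
    by (subst sum.swap) (simp add: sum_distrib_left)
  thus "(\<Sum>p\<in>?P. \<Sum>i\<in>?S. a i * b (p i)) = 0" using m1 by simp
  have off: "(n - 1) * (\<Sum>p\<in>?P. b (p i) * b (p k)) = - m" if ik: "i \<in> ?S" "k \<in> ?S" "i \<noteq> k" for i k
  proof -
    have eq: "(\<Sum>p\<in>?P. b (p i) * b (p l)) = (\<Sum>p\<in>?P. b (p i) * b (p k))" if l: "l \<in> ?S - {i}" for l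
    proof -
      have "Transposition.transpose l k permutes ?S" using l ik by (intro permutes_swap_id) auto
      from sum_permutations_compose_right[OF this, of "\<lambda>p. b (p i) * b (p l)"]
      show ?thesis using l ik by (auto simp: transpose_apply_other)
    qed
    have "card (?S - {i}) = n - 1" using ik by simp
    hence "(n - 1) * (\<Sum>p\<in>?P. b (p i) * b (p k)) = (\<Sum>l\<in>?S - {i}. \<Sum>p\<in>?P. b (p i) * b (p k))"
      by (simp only: sum_constant)
    also have "\<dots> = (\<Sum>l\<in>?S - {i}. \<Sum>p\<in>?P. b (p i) * b (p l))"
      by (intro sum.cong refl eq[symmetric])
    also have "\<dots> = (\<Sum>p\<in>?P. b (p i) * (\<Sum>l\<in>?S - {i}. b (p l)))"
      by (subst sum.swap) (simp add: sum_distrib_left)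
    also have "\<dots> = (\<Sum>p\<in>?P. - (b (p i))\<^sup>2)"
    proof (intro sum.cong refl)
      fix p assume "p \<in> ?P"
      hence "(\<Sum>l\<in>?S. b (p l)) = 0"
        using b sum.permute[of p ?S b] by (simp add: comp_def del: One_nat_def)
      hence "(\<Sum>l\<in>?S - {i}. b (p l)) = - b (p i)"
        using ik by (simp add: sum_diff1 del: One_nat_def)
      thus "b (p i) * (\<Sum>l\<in>?S - {i}. b (p l)) = - (b (p i))\<^sup>2" by (simp add: power2_eq_square)
    qed
    finally show ?thesis using m2[OF ik(1)] by (simp add: sum_negf)
  qed
  have n1: "real (n - 1) > 0" "real (n - 1) = real n - 1" using n by auto
  define q where "q = - m / (n - 1)"
  have off': "(\<Sum>p\<in>?P. b (p i) * b (p k)) = q" if ik: "i \<in> ?S" "k \<in> ?S" "i \<noteq> k" for i k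
    using off[OF ik] n1 unfolding q_def by (simp add: field_simps)
  have "(\<Sum>p\<in>?P. (\<Sum>i\<in>?S. a i * b (p i))\<^sup>2) = (\<Sum>i\<in>?S. \<Sum>k\<in>?S. a i * a k * (\<Sum>p\<in>?P. b (p i) * b (p k)))"
  proof -
    have "(\<Sum>p\<in>?P. (\<Sum>i\<in>?S. a i * b (p i))\<^sup>2) = (\<Sum>p\<in>?P. \<Sum>i\<in>?S. \<Sum>k\<in>?S. a i * a k * (b (p i) * b (p k)))"
      by (simp add: power2_eq_square sum_product mult_ac)
    also have "\<dots> = (\<Sum>i\<in>?S. \<Sum>p\<in>?P. \<Sum>k\<in>?S. a i * a k * (b (p i) * b (p k)))" by (rule sum.swap)
    also have "\<dots> = (\<Sum>i\<in>?S. \<Sum>k\<in>?S. \<Sum>p\<in>?P. a i * a k * (b (p i) * b (p k)))"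
      by (intro sum.cong refl sum.swap)
    finally show ?thesis by (simp only: sum_distrib_left)
  qed
  also have "\<dots> = (\<Sum>i\<in>?S. (a i)\<^sup>2 * (m - q))"
  proof (intro sum.cong refl)
    fix i assume i: "i \<in> ?S"
    have "(\<Sum>k\<in>?S. a i * a k * (\<Sum>p\<in>?P. b (p i) * b (p k)))
        = a i * a i * (\<Sum>p\<in>?P. b (p i) * b (p i)) + (\<Sum>k\<in>?S - {i}. a i * a k * (\<Sum>p\<in>?P. b (p i) * b (p k)))"
      using i by (intro sum.remove) auto
    also have "(\<Sum>k\<in>?S - {i}. a i * a k * (\<Sum>p\<in>?P. b (p i) * b (p k))) = (\<Sum>k\<in>?S - {i}. a i * a k * q)"
      using i off' by (intro sum.cong refl) auto
    also have "\<dots> = a i * q * (\<Sum>k\<in>?S - {i}. a k)" by (simp add: sum_distrib_left mult_ac)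
    also have "(\<Sum>k\<in>?S - {i}. a k) = - a i" using i a by (simp add: sum_diff1 del: One_nat_def)
    also have "(\<Sum>p\<in>?P. b (p i) * b (p i)) = m" using m2[OF i] by (simp add: power2_eq_square)
    finally show "(\<Sum>k\<in>?S. a i * a k * (\<Sum>p\<in>?P. b (p i) * b (p k))) = (a i)\<^sup>2 * (m - q)"
      by (simp add: power2_eq_square algebra_simps)
  qed
  also have "m - q = fact n * (\<Sum>i\<in>?S. (b i)\<^sup>2) / (n - 1)"
    unfolding q_def m_def using n1 n by (simp add: field_simps)
  finally show "(\<Sum>p\<in>?P. (\<Sum>i\<in>?S. a i * b (p i))\<^sup>2)
           = fact n * (\<Sum>i\<in>?S. (a i)\<^sup>2) * (\<Sum>i\<in>?S. (b i)\<^sup>2) / (n - 1)"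
    unfolding sum_distrib_right[symmetric] by (simp add: mult_ac)
qed

text \<open>
  For \<open>\<bar>u\<bar> \<le> L t\<close> the remainder in \<open>mgf_perm_stat\<close> has order \<open>t\<^sup>3 / sqrt n\<close>, which tends to \<open>0\<close>; this is where
  \<open>t = o(n\<^bsup>1/6\<^esup>)\<close> enters.
\<close>

lemma permutation_moderate_deviation:
  fixes c :: "nat \<Rightarrow> nat \<Rightarrow> nat \<Rightarrow> real" and t :: "nat \<Rightarrow> real"
  assumes K: "K > 0"
    and c: "\<forall>\<^sub>F n in sequentially. \<forall>i\<in>{1..n}. \<forall>j\<in>{1..n}. \<bar>c n i j\<bar> \<le> K / sqrt n"
    and mean: "\<forall>\<^sub>F n in sequentially. (\<Sum>p | p permutes {1..n}. perm_stat n (c n) p) = 0"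
    and var: "\<forall>\<^sub>F n in sequentially. (\<Sum>p | p permutes {1..n}. (perm_stat n (c n) p)\<^sup>2) = fact n"
    and t: "filterlim t at_top sequentially" and t_small: "(\<lambda>n. t n ^ 3 / sqrt n) \<longlonglongrightarrow> 0"
  shows "(\<lambda>n. t n * sqrt (2 * pi) * exp ((t n)\<^sup>2 / 2) *
           (card {p. p permutes {1..n} \<and> perm_stat n (c n) p > t n} / fact n)) \<longlonglongrightarrow> 1"
proof -
  \<comment> \<open>\<open>sharp_upper_tail\<close> wants a positive threshold for every \<open>n\<close>.\<close>
  define h where "h = (\<lambda>n. max 1 (t n))"
  have ev: "\<forall>\<^sub>F n in sequentially. h n = t n"
    using filterlim_at_top_dense[THEN iffD1, OF t, rule_format, of 1] by eventually_elim (simp add: h_def)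
  have h: "filterlim h at_top sequentially"
    using t by (rule filterlim_at_top_mono) (simp add: h_def)
  have h1: "h n \<ge> 1" for n by (simp add: h_def)
  have h_small: "(\<lambda>n. h n ^ 3 / sqrt n) \<longlonglongrightarrow> 0"
    using t_small by (rule Lim_transform_eventually) (use ev in \<open>auto elim: eventually_mono\<close>)
  let ?P = "\<lambda>n::nat. {p. p permutes {1..n}}"
  have card: "card (?P n) = fact n" for n by (simp add: card_permutations[OF refl])
  have "(\<lambda>n. h n * sqrt (2 * pi) * exp ((h n)\<^sup>2 / 2) * (card {p\<in>?P n. perm_stat n (c n) p > h n} / card (?P n))) \<longlonglongrightarrow> 1"
  proof (rule sharp_upper_tail[OF _ _ h])
    show "finite (?P n)" for n by (rule finite_permutations) simp
    show "?P n \<noteq> {}" for n using permutes_id by blast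
    show "h n > 0" for n using h1[of n] by linarith
  next
    fix L \<epsilon> :: real assume L: "L > 0" and \<epsilon>: "\<epsilon> > 0"
    define C where "C = 192 * (28 * K) ^ 3 * (1 + L) ^ 3"
    have C: "C > 0" using K L by (simp add: C_def)
    have "min (1/2) (\<epsilon> / 2) / C > 0" using C \<epsilon> by simp
    from order_tendstoD(2)[OF h_small this]
    have s1: "\<forall>\<^sub>F n in sequentially. h n ^ 3 / sqrt n < min (1/2) (\<epsilon>/2) / C" .
    have "1 / (112 * K * (1 + L)) > 0" using K L by simp
    from order_tendstoD(2)[OF h_small this]
    have s2: "\<forall>\<^sub>F n in sequentially. h n ^ 3 / sqrt n < 1 / (112 * K * (1 + L))" .
    show "\<forall>\<^sub>F n in sequentially. \<forall>u. \<bar>u\<bar> \<le> L * h n \<longrightarrow>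
          norm ((\<Sum>\<omega>\<in>?P n. exp (Complex (h n) u * perm_stat n (c n) \<omega>)) / card (?P n) - exp ((Complex (h n) u)\<^sup>2 / 2))
            \<le> \<epsilon> * exp (((h n)\<^sup>2 - u\<^sup>2) / 2)"
      using s1 s2 c mean var eventually_ge_at_top[of 1]
    proof eventually_elim
      case (elim n)
      have n: "sqrt n > 0" using elim by simp
      show ?case
      proof (intro allI impI)
        fix u assume u: "\<bar>u\<bar> \<le> L * h n"
        define z where "z = Complex (h n) u"
        have "norm z \<le> \<bar>h n\<bar> + \<bar>u\<bar>" unfolding z_def using cmod_le[of "Complex (h n) u"] by simp
        also have "\<dots> \<le> (1 + L) * h n" using u h1[of n] by (simp add: algebra_simps)
        finally have nz: "norm z \<le> (1 + L) * h n" .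
        have "h n * 1 \<le> h n * (h n)\<^sup>2" using h1[of n] by (intro mult_left_mono) (auto simp: one_le_power)
        hence "h n \<le> h n ^ 3" by (simp add: power3_eq_cube power2_eq_square)
        also have "h n ^ 3 \<le> sqrt n / (112 * K * (1 + L))"
          using elim(2) n by (simp add: field_simps)
        finally have "(1 + L) * h n \<le> (1 + L) * (sqrt n / (112 * K * (1 + L)))"
          using L by (intro mult_left_mono) auto
        also have "\<dots> = sqrt n / (112 * K)"
        proof -
          have "M * (x / (112 * K * M)) = x / (112 * K)" if "M > 0" for M x :: real
            using that K by (simp add: field_simps)
          thus ?thesis using L by simp
        qed
        finally have z: "norm z \<le> sqrt n / (112 * K)" using nz by linarith
        obtain R where R: "norm R \<le> 192 * (28 * K) ^ 3 * norm z ^ 3 / sqrt n"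
          "(\<Sum>p\<in>?P n. exp (z * perm_stat n (c n) p)) / fact n = exp (z\<^sup>2 / 2 + R)"
          by (rule mgf_perm_stat[of n K "c n" z]) (use elim K z in auto)
        have "norm z ^ 3 \<le> ((1 + L) * h n) ^ 3" using nz by (intro power_mono) auto
        hence "192 * (28 * K) ^ 3 * norm z ^ 3 / sqrt n \<le> 192 * (28 * K) ^ 3 * ((1 + L) * h n) ^ 3 / sqrt n"
          using K n by (intro divide_right_mono mult_left_mono) auto
        also have "\<dots> = C * (h n ^ 3 / sqrt n)" by (simp add: C_def power_mult_distrib)
        also have "\<dots> \<le> C * (min (1/2) (\<epsilon>/2) / C)" using elim(1) C by (intro mult_left_mono) auto
        also have "\<dots> = min (1/2) (\<epsilon>/2)" using C by simp
        finally have nR: "norm R \<le> min (1/2) (\<epsilon>/2)" using R(1) by linarith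
        hence "norm (exp R - 1) \<le> 3/2 * norm R" by (intro norm_exp_bounds(2)) auto
        hence eR: "norm (exp R - 1) \<le> \<epsilon>" using nR \<epsilon> by linarith
        have "exp (z\<^sup>2 / 2 + R) - exp (z\<^sup>2 / 2) = exp (z\<^sup>2 / 2) * (exp R - 1)"
          by (simp add: exp_add algebra_simps)
        hence "norm (exp (z\<^sup>2 / 2 + R) - exp (z\<^sup>2 / 2)) = exp (Re (z\<^sup>2 / 2)) * norm (exp R - 1)"
          by (simp add: norm_mult)
        also have "\<dots> \<le> exp (Re (z\<^sup>2 / 2)) * \<epsilon>" using eR by (intro mult_left_mono) auto
        also have "Re (z\<^sup>2 / 2) = ((h n)\<^sup>2 - u\<^sup>2) / 2" by (simp add: z_def power2_eq_square)
        finally show "norm ((\<Sum>\<omega>\<in>?P n. exp (Complex (h n) u * perm_stat n (c n) \<omega>)) / card (?P n) - exp ((Complex (h n) u)\<^sup>2 / 2))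
            \<le> \<epsilon> * exp (((h n)\<^sup>2 - u\<^sup>2) / 2)"
          unfolding card using R(2) by (simp add: z_def mult.commute del: One_nat_def)
      qed
    qed
  qed
  thus ?thesis
    by (rule Lim_transform_eventually) (use ev in \<open>auto elim!: eventually_mono simp: card simp del: One_nat_def\<close>)
qed

lemma permutation_moderate_deviation_abs:
  fixes c :: "nat \<Rightarrow> nat \<Rightarrow> nat \<Rightarrow> real" and t :: "nat \<Rightarrow> real"
  assumes K: "K > 0"
    and c: "\<forall>\<^sub>F n in sequentially. \<forall>i\<in>{1..n}. \<forall>j\<in>{1..n}. \<bar>c n i j\<bar> \<le> K / sqrt n"
    and mean: "\<forall>\<^sub>F n in sequentially. (\<Sum>p | p permutes {1..n}. perm_stat n (c n) p) = 0"
    and var: "\<forall>\<^sub>F n in sequentially. (\<Sum>p | p permutes {1..n}. (perm_stat n (c n) p)\<^sup>2) = fact n"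
    and t: "filterlim t at_top sequentially" and t_small: "(\<lambda>n. t n ^ 3 / sqrt n) \<longlonglongrightarrow> 0"
  shows "(\<lambda>n. t n * sqrt (2 * pi) * exp ((t n)\<^sup>2 / 2) *
           (card {p. p permutes {1..n} \<and> \<bar>perm_stat n (c n) p\<bar> > t n} / fact n)) \<longlonglongrightarrow> 2"
proof -
  have minus: "perm_stat n (\<lambda>i j. - c n i j) p = - perm_stat n (c n) p" for n p
    by (simp add: perm_stat_def sum_negf)
  have "(\<lambda>n. t n * sqrt (2 * pi) * exp ((t n)\<^sup>2 / 2) *
           (card {p. p permutes {1..n} \<and> perm_stat n (\<lambda>i j. - c n i j) p > t n} / fact n)) \<longlonglongrightarrow> 1"
  proof (rule permutation_moderate_deviation[OF K _ _ _ t t_small])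
    show "\<forall>\<^sub>F n in sequentially. \<forall>i\<in>{1..n}. \<forall>j\<in>{1..n}. \<bar>- c n i j\<bar> \<le> K / sqrt n" using c by simp
    show "\<forall>\<^sub>F n in sequentially. (\<Sum>p | p permutes {1..n}. perm_stat n (\<lambda>i j. - c n i j) p) = 0"
      using mean by (simp add: minus sum_negf)
    show "\<forall>\<^sub>F n in sequentially. (\<Sum>p | p permutes {1..n}. (perm_stat n (\<lambda>i j. - c n i j) p)\<^sup>2) = fact n"
      using var by (simp add: minus)
  qed
  from tendsto_add[OF permutation_moderate_deviation[OF K c mean var t t_small] this]
  have "(\<lambda>n. t n * sqrt (2 * pi) * exp ((t n)\<^sup>2 / 2) * (card {p. p permutes {1..n} \<and> perm_stat n (c n) p > t n} / fact n)
         + t n * sqrt (2 * pi) * exp ((t n)\<^sup>2 / 2) * (card {p. p permutes {1..n} \<and> - perm_stat n (c n) p > t n} / fact n)) \<longlonglongrightarrow> 2"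
    by (simp add: minus)
  thus ?thesis
  proof (rule Lim_transform_eventually)
    show "\<forall>\<^sub>F n in sequentially. t n * sqrt (2 * pi) * exp ((t n)\<^sup>2 / 2) * (card {p. p permutes {1..n} \<and> perm_stat n (c n) p > t n} / fact n)
         + t n * sqrt (2 * pi) * exp ((t n)\<^sup>2 / 2) * (card {p. p permutes {1..n} \<and> - perm_stat n (c n) p > t n} / fact n)
       = t n * sqrt (2 * pi) * exp ((t n)\<^sup>2 / 2) * (card {p. p permutes {1..n} \<and> \<bar>perm_stat n (c n) p\<bar> > t n} / fact n)"
      using filterlim_at_top_dense[THEN iffD1, OF t, rule_format, of 0]
    proof eventually_elim
      case (elim n)
      have "{p. p permutes {1..n} \<and> \<bar>perm_stat n (c n) p\<bar> > t n}
          = {p. p permutes {1..n} \<and> perm_stat n (c n) p > t n} \<union> {p. p permutes {1..n} \<and> - perm_stat n (c n) p > t n}"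
        by auto
      moreover have "finite {p. p permutes {1..n} \<and> Q p}" for Q
        by (rule finite_subset[OF _ finite_permutations[of "{1..n}"]]) auto
      ultimately have "card {p. p permutes {1..n} \<and> \<bar>perm_stat n (c n) p\<bar> > t n}
          = card {p. p permutes {1..n} \<and> perm_stat n (c n) p > t n} + card {p. p permutes {1..n} \<and> - perm_stat n (c n) p > t n}"
        using elim by (simp only:) (rule card_Un_disjoint, auto)
      thus ?case by (simp add: add_divide_distrib ring_distribs)
    qed
  qed
qed

section \<open>Poisson approximation for the absence of events\<close>

lemma power_diff_bounded:
  fixes x :: real assumes "0 \<le> x" "x \<le> 1"
  shows "\<bar>x ^ (a + b) - x ^ a\<bar> \<le> real b"
proof (cases "b = 0")
  case False
  have "x ^ (a + b) \<le> x ^ a" using assms by (intro power_decreasing) auto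
  moreover have "x ^ a \<le> 1" "x ^ (a + b) \<ge> 0" using assms by (auto simp: power_le_one)
  moreover have "real b \<ge> 1" using False by simp
  ultimately show ?thesis by linarith
qed simp

lemma (in prob_space) integral_count_eq_sum:
  fixes N :: "'a \<Rightarrow> nat" and g :: "nat \<Rightarrow> real"
  assumes [measurable]: "N \<in> measurable M (count_space UNIV)" and "\<And>\<omega>. N \<omega> \<le> m"
  shows "expectation (\<lambda>\<omega>. g (N \<omega>)) = (\<Sum>k\<le>m. prob {\<omega>\<in>space M. N \<omega> = k} * g k)"
proof -
  have "g (N \<omega>) = (\<Sum>k\<le>m. indicator {\<omega>\<in>space M. N \<omega> = k} \<omega> * g k)" if "\<omega> \<in> space M" for \<omega>
  proof -
    have "(\<Sum>k\<le>m. indicator {\<omega>\<in>space M. N \<omega> = k} \<omega> * g k) = (\<Sum>k\<le>m. if k = N \<omega> then g k else 0)"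
      using that by (intro sum.cong) (auto simp: indicator_def)
    thus ?thesis using assms(2)[of \<omega>] by simp
  qed
  hence "expectation (\<lambda>\<omega>. g (N \<omega>)) = expectation (\<lambda>\<omega>. \<Sum>k\<le>m. indicator {\<omega>\<in>space M. N \<omega> = k} \<omega> * g k)"
    by (intro Bochner_Integration.integral_cong refl) simp
  also have "\<dots> = (\<Sum>k\<le>m. expectation (\<lambda>\<omega>. indicator {\<omega>\<in>space M. N \<omega> = k} \<omega> * g k))"
    by (intro Bochner_Integration.integral_sum integrable_mult_left integrable_real_indicator)
       (auto simp: emeasure_eq_measure)
  moreover have "{\<omega>\<in>space M. N \<omega> = k} \<inter> space M = {\<omega>\<in>space M. N \<omega> = k}" for k by auto
  ultimately show ?thesis by simp
qed

lemma abs_integral_le: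
  fixes f g :: "'a \<Rightarrow> real"
  assumes "integrable M f" "integrable M g" "\<And>x. x \<in> space M \<Longrightarrow> \<bar>f x\<bar> \<le> g x"
  shows "\<bar>\<integral>x. f x \<partial>M\<bar> \<le> (\<integral>x. g x \<partial>M)"
  using integral_abs_bound[of M f] integral_mono[OF integrable_abs[OF assms(1)] assms(2,3)] by linarith

text \<open>
  The Chen-Stein bound for the void probability, by interpolation. Let \<open>N\<close> count the events that occur, let
  \<open>G s = E ((1 - s)^N)\<close>, and let \<open>\<lambda>\<close> be the sum of the probabilities. Then \<open>G 0 = 1\<close>, \<open>G 1\<close> is the void
  probability, and \<open>- G' s\<close> is the sum over \<open>e\<close> of \<open>E (1\<^bsub>A e\<^esub> (1 - s)^(N - 1))\<close>. In each term, dropping the neighbours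
  of \<open>e\<close> from the exponent makes the two factors independent, and restoring them in \<open>G s\<close> gives
  \<open>\<lambda> G s\<close>; both changes are controlled by the two sums on the right. So \<open>exp (\<lambda> s) G s\<close>
  has a small derivative.
  
  Independence is expressed by set-valued random variables: the event as a subset of \<open>{e}\<close>, and
  the configuration of all the events outside the neighbourhood.
\<close>

theorem (in prob_space) poisson_approximation_no_event:
  fixes A :: "'e \<Rightarrow> 'a set" and nbh :: "'e \<Rightarrow> 'e set"
  assumes E: "finite E" and A: "\<And>e. e \<in> E \<Longrightarrow> A e \<in> events"
    and nbh: "\<And>e. e \<in> E \<Longrightarrow> e \<in> nbh e" "\<And>e. e \<in> E \<Longrightarrow> nbh e \<subseteq> E"
    and indep: "\<And>e. e \<in> E \<Longrightarrow> indep_var (count_space UNIV) (\<lambda>\<omega>. {f \<in> {e}. \<omega> \<in> A f})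
                              (count_space UNIV) (\<lambda>\<omega>. {f \<in> E - nbh e. \<omega> \<in> A f})"
  shows "\<bar>prob {\<omega>\<in>space M. \<forall>e\<in>E. \<omega> \<notin> A e} - exp (- (\<Sum>e\<in>E. prob (A e)))\<bar>
      \<le> (\<Sum>e\<in>E. \<Sum>f\<in>nbh e. prob (A e) * prob (A f)) + (\<Sum>e\<in>E. \<Sum>f\<in>nbh e - {e}. prob (A e \<inter> A f))"
    (is "_ \<le> ?b")
proof -
  define cnt where "cnt = (\<lambda>F \<omega>. card {f\<in>F. \<omega> \<in> A f})"
  have cnt_sum: "real (cnt F \<omega>) = (\<Sum>f\<in>F. indicator (A f) \<omega>)" if "F \<subseteq> E" for F \<omega>
    using finite_subset[OF that E] by (simp add: cnt_def indicator_def sum.If_cases Int_def)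
  have cnt_meas [measurable]: "cnt F \<in> measurable M (count_space UNIV)" if "F \<subseteq> E" for F
  proof -
    have [measurable]: "A f \<in> events" if "f \<in> F" for f using A \<open>F \<subseteq> E\<close> that by auto
    have "cnt F = (\<lambda>\<omega>. \<Sum>f\<in>F. if \<omega> \<in> A f then 1 else 0)"
      using finite_subset[OF that E] by (auto simp: cnt_def sum.If_cases Int_def)
    thus ?thesis by simp
  qed
  have cnt_le: "cnt F \<omega> \<le> card E" if "F \<subseteq> E" for F \<omega>
    unfolding cnt_def using that E by (intro card_mono) auto
  define lam where "lam = (\<Sum>e\<in>E. prob (A e))"
  define N where "N = cnt E"
  define G where "G = (\<lambda>s::real. expectation (\<lambda>\<omega>. (1 - s) ^ N \<omega>))"
  define G' where "G' = (\<lambda>s::real. expectation (\<lambda>\<omega>. real (N \<omega>) * (1 - s) ^ (N \<omega> - 1)))"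
  have Nm [measurable]: "N \<in> measurable M (count_space UNIV)" by (simp add: N_def cnt_meas)
  have Nle: "N \<omega> \<le> card E" for \<omega> by (simp add: N_def cnt_le)
  have G_deriv: "(G has_real_derivative - G' s) (at s)" for s
  proof -
    have "G = (\<lambda>s. \<Sum>k\<le>card E. prob {\<omega>\<in>space M. N \<omega> = k} * (1 - s) ^ k)"
      unfolding G_def by (intro ext integral_count_eq_sum Nm Nle)
    moreover have "G' s = (\<Sum>k\<le>card E. prob {\<omega>\<in>space M. N \<omega> = k} * (real k * (1 - s) ^ (k - 1)))"
      unfolding G'_def by (rule integral_count_eq_sum[OF Nm Nle])
    ultimately show ?thesis
      by (auto intro!: derivative_eq_intros sum.cong simp: sum_negf[symmetric])
  qed
  have bdd_int: "integrable M (\<lambda>\<omega>. f \<omega>)" if "f \<in> borel_measurable M" "\<And>\<omega>. \<bar>f \<omega>\<bar> \<le> C" for f :: "'a \<Rightarrow> real" and C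
    using that by (intro integrable_const_bound[where B=C]) auto
  have ind_int: "integrable M (indicator (A e) :: 'a \<Rightarrow> real)" if "e \<in> E" for e
    using A[OF that] by (simp add: emeasure_eq_measure)
  have key: "\<bar>lam * G s - G' s\<bar> \<le> ?b" if s: "0 \<le> s" "s \<le> 1" for s
  proof -
    let ?x = "1 - s"
    have x: "0 \<le> ?x" "?x \<le> 1" using s by auto
    have p1: "\<bar>?x ^ k\<bar> \<le> 1" for k using x by (simp add: power_le_one abs_le_iff)
    have one: "\<bar>prob (A e) * G s - expectation (\<lambda>\<omega>. indicator (A e) \<omega> * ?x ^ (N \<omega> - 1))\<bar>
        \<le> (\<Sum>f\<in>nbh e. prob (A e) * prob (A f)) + (\<Sum>f\<in>nbh e - {e}. prob (A e \<inter> A f))"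
      if e: "e \<in> E" for e
    proof -
      have fin: "finite (nbh e)" using nbh(2)[OF e] E finite_subset by blast
      have [measurable]: "A e \<in> events" by (rule A[OF e])
      define V where "V = cnt (E - nbh e)"
      have Vm [measurable]: "V \<in> measurable M (count_space UNIV)" by (simp add: V_def cnt_meas)
      have split: "N \<omega> = V \<omega> + cnt (nbh e) \<omega>" for \<omega>
      proof -
        have "{f \<in> E. \<omega> \<in> A f} = {f \<in> E - nbh e. \<omega> \<in> A f} \<union> {f \<in> nbh e. \<omega> \<in> A f}"
          using nbh(2)[OF e] by auto
        thus ?thesis unfolding N_def V_def cnt_def using E fin
          by (subst card_Un_disjoint[symmetric]) auto
      qed
      have split': "N \<omega> - 1 = V \<omega> + cnt (nbh e - {e}) \<omega>" if "\<omega> \<in> A e" for \<omega>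
      proof -
        have "{f \<in> nbh e. \<omega> \<in> A f} = insert e {f \<in> nbh e - {e}. \<omega> \<in> A f}"
          using nbh(1)[OF e] that by auto
        hence "cnt (nbh e) \<omega> = Suc (cnt (nbh e - {e}) \<omega>)"
          unfolding cnt_def using fin by simp
        thus ?thesis by (simp add: split)
      qed
      have indep_eq: "expectation (\<lambda>\<omega>. indicator (A e) \<omega> * ?x ^ V \<omega>) = prob (A e) * expectation (\<lambda>\<omega>. ?x ^ V \<omega>)"
      proof -
        have "indep_var borel ((\<lambda>F. if e \<in> F then 1 else 0 :: real) \<circ> (\<lambda>\<omega>. {f \<in> {e}. \<omega> \<in> A f}))
                        borel ((\<lambda>F. ?x ^ card F) \<circ> (\<lambda>\<omega>. {f \<in> E - nbh e. \<omega> \<in> A f}))"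
          by (rule indep_var_compose[OF indep[OF e]]) auto
        moreover have "(\<lambda>F. if e \<in> F then 1 else 0 :: real) \<circ> (\<lambda>\<omega>. {f \<in> {e}. \<omega> \<in> A f}) = indicator (A e)"
          by (auto simp: fun_eq_iff)
        moreover have "(\<lambda>F. ?x ^ card F) \<circ> (\<lambda>\<omega>. {f \<in> E - nbh e. \<omega> \<in> A f}) = (\<lambda>\<omega>. ?x ^ V \<omega>)"
          by (auto simp: V_def cnt_def)
        ultimately have "indep_var borel (indicator (A e)) borel (\<lambda>\<omega>. ?x ^ V \<omega>)" by simp
        from indep_var_lebesgue_integral[OF this ind_int[OF e] bdd_int[OF _ p1]]
        show ?thesis by simp
      qed
      have iN: "integrable M (\<lambda>\<omega>. ?x ^ N \<omega>)" and iV: "integrable M (\<lambda>\<omega>. ?x ^ V \<omega>)"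
        by (rule bdd_int[OF _ p1], measurable)+
      have "\<bar>G s - expectation (\<lambda>\<omega>. ?x ^ V \<omega>)\<bar> = \<bar>expectation (\<lambda>\<omega>. ?x ^ N \<omega> - ?x ^ V \<omega>)\<bar>"
        unfolding G_def by (simp only: Bochner_Integration.integral_diff[OF iN iV])
      also have "\<dots> \<le> expectation (\<lambda>\<omega>. \<Sum>f\<in>nbh e. indicator (A f) \<omega>)"
      proof (rule abs_integral_le)
        show "integrable M (\<lambda>\<omega>. ?x ^ N \<omega> - ?x ^ V \<omega>)"
          by (intro Bochner_Integration.integrable_diff iN iV)
        show "integrable M (\<lambda>\<omega>. \<Sum>f\<in>nbh e. indicator (A f) \<omega> :: real)"
          using ind_int nbh(2)[OF e] by (intro Bochner_Integration.integrable_sum) auto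
        show "\<bar>?x ^ N \<omega> - ?x ^ V \<omega>\<bar> \<le> (\<Sum>f\<in>nbh e. indicator (A f) \<omega>)" for \<omega>
          using power_diff_bounded[OF x] by (simp add: split flip: cnt_sum[OF nbh(2)[OF e]])
      qed
      also have "\<dots> = (\<Sum>f\<in>nbh e. prob (A f))"
        using ind_int nbh(2)[OF e] A
        by (subst Bochner_Integration.integral_sum) (auto intro!: sum.cong)
      finally have 1: "\<bar>G s - expectation (\<lambda>\<omega>. ?x ^ V \<omega>)\<bar> \<le> (\<Sum>f\<in>nbh e. prob (A f))" .
      have i2: "integrable M (\<lambda>\<omega>. indicator (A e) \<omega> * ?x ^ k \<omega>)" if "k \<in> measurable M (count_space UNIV)" for k
      proof (rule bdd_int)
        show "(\<lambda>\<omega>. indicator (A e) \<omega> * ?x ^ k \<omega>) \<in> borel_measurable M" using that by measurable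
        show "\<bar>indicator (A e) \<omega> * ?x ^ k \<omega>\<bar> \<le> 1" for \<omega> using p1[of "k \<omega>"] by (auto simp: indicator_def)
      qed
      have iAf: "integrable M (indicator (A e \<inter> A f) :: 'a \<Rightarrow> real)" if "f \<in> nbh e - {e}" for f
        using A nbh(2)[OF e] that e by (intro integrable_real_indicator) (auto simp: emeasure_eq_measure)
      have "\<bar>expectation (\<lambda>\<omega>. indicator (A e) \<omega> * ?x ^ V \<omega>) - expectation (\<lambda>\<omega>. indicator (A e) \<omega> * ?x ^ (N \<omega> - 1))\<bar>
          = \<bar>expectation (\<lambda>\<omega>. indicator (A e) \<omega> * ?x ^ V \<omega> - indicator (A e) \<omega> * ?x ^ (N \<omega> - 1))\<bar>"
        by (subst Bochner_Integration.integral_diff) (auto intro!: i2)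
      also have "\<dots> \<le> expectation (\<lambda>\<omega>. \<Sum>f\<in>nbh e - {e}. indicator (A e \<inter> A f) \<omega>)"
      proof (rule abs_integral_le)
        show "integrable M (\<lambda>\<omega>. indicator (A e) \<omega> * ?x ^ V \<omega> - indicator (A e) \<omega> * ?x ^ (N \<omega> - 1))"
          by (intro Bochner_Integration.integrable_diff i2) measurable
        show "integrable M (\<lambda>\<omega>. \<Sum>f\<in>nbh e - {e}. indicator (A e \<inter> A f) \<omega> :: real)"
          by (intro Bochner_Integration.integrable_sum iAf)
        show "\<bar>indicator (A e) \<omega> * ?x ^ V \<omega> - indicator (A e) \<omega> * ?x ^ (N \<omega> - 1)\<bar>
            \<le> (\<Sum>f\<in>nbh e - {e}. indicator (A e \<inter> A f) \<omega>)" for \<omega>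
        proof (cases "\<omega> \<in> A e")
          case True
          have "\<bar>?x ^ V \<omega> - ?x ^ (N \<omega> - 1)\<bar> \<le> real (cnt (nbh e - {e}) \<omega>)"
            using power_diff_bounded[OF x, of "V \<omega>" "cnt (nbh e - {e}) \<omega>"]
            unfolding split'[OF True] by (simp add: abs_minus_commute)
          also have "\<dots> = (\<Sum>f\<in>nbh e - {e}. indicator (A f) \<omega>)"
            using nbh(2)[OF e] by (intro cnt_sum) auto
          finally show ?thesis using True by (simp add: indicator_inter_arith)
        qed (simp add: sum_nonneg)
      qed
      also have "\<dots> = (\<Sum>f\<in>nbh e - {e}. prob (A e \<inter> A f))"
        using iAf A e nbh(2)[OF e]
        by (subst Bochner_Integration.integral_sum) (auto intro!: sum.cong)
      finally have 2: "\<bar>expectation (\<lambda>\<omega>. indicator (A e) \<omega> * ?x ^ V \<omega>) - expectation (\<lambda>\<omega>. indicator (A e) \<omega> * ?x ^ (N \<omega> - 1))\<bar>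
          \<le> (\<Sum>f\<in>nbh e - {e}. prob (A e \<inter> A f))" .
      have "\<bar>prob (A e) * G s - prob (A e) * expectation (\<lambda>\<omega>. ?x ^ V \<omega>)\<bar> \<le> prob (A e) * (\<Sum>f\<in>nbh e. prob (A f))"
        unfolding right_diff_distrib[symmetric] abs_mult using 1 by (intro mult_mono) auto
      thus ?thesis using 2 unfolding indep_eq by (simp add: sum_distrib_left)
    qed
    have N_ind: "real (N \<omega>) * ?x ^ (N \<omega> - 1) = (\<Sum>e\<in>E. indicator (A e) \<omega> * ?x ^ (N \<omega> - 1))" for \<omega>
      unfolding N_def by (simp add: cnt_sum sum_distrib_right)
    have "G' s = (\<Sum>e\<in>E. expectation (\<lambda>\<omega>. indicator (A e) \<omega> * ?x ^ (N \<omega> - 1)))"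
      unfolding G'_def N_ind
    proof (rule Bochner_Integration.integral_sum)
      fix e assume e: "e \<in> E"
      have [measurable]: "A e \<in> events" by (rule A[OF e])
      show "integrable M (\<lambda>\<omega>. indicator (A e) \<omega> * ?x ^ (N \<omega> - 1))"
      proof (rule bdd_int)
        show "(\<lambda>\<omega>. indicator (A e) \<omega> * ?x ^ (N \<omega> - 1)) \<in> borel_measurable M" by measurable
        show "\<bar>indicator (A e) \<omega> * ?x ^ (N \<omega> - 1)\<bar> \<le> 1" for \<omega> using p1[of "N \<omega> - 1"] by (auto simp: indicator_def)
      qed
    qed
    hence "lam * G s - G' s = (\<Sum>e\<in>E. prob (A e) * G s - expectation (\<lambda>\<omega>. indicator (A e) \<omega> * ?x ^ (N \<omega> - 1)))"
      by (simp add: lam_def sum_distrib_right sum_subtractf)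
    also have "\<bar>\<dots>\<bar> \<le> (\<Sum>e\<in>E. (\<Sum>f\<in>nbh e. prob (A e) * prob (A f)) + (\<Sum>f\<in>nbh e - {e}. prob (A e \<inter> A f)))"
      by (rule order_trans[OF sum_abs sum_mono[OF one]])
    finally show ?thesis by (simp add: sum.distrib)
  qed
  have b0: "?b \<ge> 0" by (intro add_nonneg_nonneg sum_nonneg mult_nonneg_nonneg) auto
  define H where "H = (\<lambda>s. exp (lam * s) * G s)"
  have lam0: "lam \<ge> 0" unfolding lam_def by (intro sum_nonneg) auto
  have "\<exists>s. 0 < s \<and> s < 1 \<and> H 1 - H 0 = (1 - 0) * (exp (lam * s) * (lam * G s - G' s))"
  proof (rule MVT2)
    show "(H has_real_derivative exp (lam * s) * (lam * G s - G' s)) (at s)" for s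
      unfolding H_def by (rule derivative_eq_intros G_deriv refl | simp add: algebra_simps)+
  qed simp
  then obtain s where s: "0 < s" "s < 1" "H 1 - H 0 = exp (lam * s) * (lam * G s - G' s)" by auto
  have "\<bar>H 1 - H 0\<bar> \<le> exp lam * ?b"
    unfolding s(3) abs_mult using key[of s] s lam0 b0 by (intro mult_mono) (auto simp: mult_left_le)
  moreover have "H 0 = 1" by (simp add: H_def G_def prob_space)
  moreover have "G 1 = prob {\<omega>\<in>space M. \<forall>e\<in>E. \<omega> \<notin> A e}"
  proof -
    have "G 1 = (\<Sum>k\<le>card E. prob {\<omega>\<in>space M. N \<omega> = k} * 0 ^ k)"
      unfolding G_def by (subst integral_count_eq_sum[OF Nm Nle]) simp
    also have "\<dots> = prob {\<omega>\<in>space M. N \<omega> = 0}" by (simp add: sum.atMost_shift)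
    also have "{\<omega>\<in>space M. N \<omega> = 0} = {\<omega>\<in>space M. \<forall>e\<in>E. \<omega> \<notin> A e}"
      using E by (auto simp: N_def cnt_def)
    finally show ?thesis .
  qed
  ultimately have *: "\<bar>exp lam * prob {\<omega>\<in>space M. \<forall>e\<in>E. \<omega> \<notin> A e} - 1\<bar> \<le> exp lam * ?b"
    by (simp add: H_def)
  have "exp lam * \<bar>prob {\<omega>\<in>space M. \<forall>e\<in>E. \<omega> \<notin> A e} - exp (- lam)\<bar>
      = \<bar>exp lam * (prob {\<omega>\<in>space M. \<forall>e\<in>E. \<omega> \<notin> A e} - exp (- lam))\<bar>" by (simp add: abs_mult)
  also have "\<dots> \<le> exp lam * ?b" using * by (simp add: right_diff_distrib mult_exp_exp)
  finally show ?thesis by (simp add: lam_def)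
qed

section \<open>Uniform variables on the vertices of a complete graph\<close>

text \<open>
  The variable may leave \<open>P\<close>, but only on a null set, and it always stays in the finite set \<open>F\<close>. For
  rank vectors, \<open>P\<close> consists of the permutations and \<open>F\<close> also contains the values that occur
  in the presence of ties. A finite \<open>F\<close> makes every function of such variables measurable.
\<close>

definition uniform_variable :: "'a measure \<Rightarrow> 'b set \<Rightarrow> 'b set \<Rightarrow> ('a \<Rightarrow> 'b) \<Rightarrow> bool" where
  "uniform_variable M F P Y \<longleftrightarrow> Y \<in> measurable M (count_space F) \<and> finite F \<and> P \<subseteq> F \<and> P \<noteq> {} \<and>
     (\<forall>y\<in>P. measure M {\<omega>\<in>space M. Y \<omega> = y} = 1 / card P)"

context prob_space
begin

lemma uniform_variable_event:
  assumes u: "uniform_variable M F P Y"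
  shows "{\<omega>\<in>space M. Y \<omega> \<in> C} \<in> events"
proof -
  have Y: "Y \<in> measurable M (count_space F)" using u by (simp add: uniform_variable_def)
  have "{\<omega>\<in>space M. Y \<omega> \<in> C} = Y -` (C \<inter> F) \<inter> space M"
    using measurable_space[OF Y] by auto
  thus ?thesis using measurable_sets[OF Y, of "C \<inter> F"] by simp
qed

lemma uniform_variable_prob_subset:
  assumes u: "uniform_variable M F P Y" and C: "C \<subseteq> P"
  shows "prob {\<omega>\<in>space M. Y \<omega> \<in> C} = card C / card P"
proof -
  have p: "prob {\<omega>\<in>space M. Y \<omega> = y} = 1 / card P" if "y \<in> P" for y
    using u that by (simp add: uniform_variable_def)
  have "finite C" using u C unfolding uniform_variable_def by (meson finite_subset)
  hence "prob (\<Union>y\<in>C. {\<omega>\<in>space M. Y \<omega> = y}) = (\<Sum>y\<in>C. prob {\<omega>\<in>space M. Y \<omega> = y})"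
    using uniform_variable_event[OF u, of "{y}" for y]
    by (intro finite_measure_finite_Union) (auto simp: disjoint_family_on_def)
  also have "\<dots> = card C / card P" using p C by (simp add: subset_iff)
  also have "(\<Union>y\<in>C. {\<omega>\<in>space M. Y \<omega> = y}) = {\<omega>\<in>space M. Y \<omega> \<in> C}" by auto
  finally show ?thesis .
qed

lemma uniform_variable_AE:
  assumes u: "uniform_variable M F P Y"
  shows "AE \<omega> in M. Y \<omega> \<in> P"
proof -
  have "finite P" "P \<noteq> {}" using u unfolding uniform_variable_def by (meson finite_subset)+
  hence "prob {\<omega>\<in>space M. Y \<omega> \<in> P} = 1"
    using uniform_variable_prob_subset[OF u subset_refl] by simp
  hence "AE \<omega> in M. \<omega> \<in> {\<omega>\<in>space M. Y \<omega> \<in> P}"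
    using uniform_variable_event[OF u] prob_eq_1 by blast
  thus ?thesis by (rule AE_mp) auto
qed

lemma uniform_variable_prob:
  assumes u: "uniform_variable M F P Y"
  shows "prob {\<omega>\<in>space M. B (Y \<omega>)} = card {y\<in>P. B y} / card P"
proof -
  have "prob {\<omega>\<in>space M. B (Y \<omega>)} = prob {\<omega>\<in>space M. Y \<omega> \<in> {y\<in>P. B y}}"
  proof (rule measure_eq_AE)
    show "AE \<omega> in M. (\<omega> \<in> {\<omega>\<in>space M. B (Y \<omega>)}) = (\<omega> \<in> {\<omega>\<in>space M. Y \<omega> \<in> {y\<in>P. B y}})"
      using uniform_variable_AE[OF u] by eventually_elim auto
  qed (use uniform_variable_event[OF u, of "{y. B y}"] uniform_variable_event[OF u, of "{y\<in>P. B y}"] in auto)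
  thus ?thesis using uniform_variable_prob_subset[OF u, of "{y\<in>P. B y}"] by auto
qed

lemma uniform_variable_expectation:
  fixes f :: "'b \<Rightarrow> real"
  assumes u: "uniform_variable M F P Y"
  shows "expectation (\<lambda>\<omega>. f (Y \<omega>)) = (\<Sum>y\<in>P. f y) / card P"
proof -
  have Y [measurable]: "Y \<in> measurable M (count_space F)" and F: "finite F" "P \<subseteq> F" "P \<noteq> {}"
    using u by (auto simp: uniform_variable_def)
  have YF: "Y \<omega> \<in> F" if "\<omega> \<in> space M" for \<omega> using measurable_space[OF Y that] by simp
  have ev: "{\<omega>\<in>space M. Y \<omega> = y} \<in> events" for y using uniform_variable_event[OF u, of "{y}"] by simp
  have "expectation (\<lambda>\<omega>. f (Y \<omega>)) = expectation (\<lambda>\<omega>. \<Sum>y\<in>F. f y * indicator {\<omega>\<in>space M. Y \<omega> = y} \<omega>)"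
  proof (rule Bochner_Integration.integral_cong[OF refl])
    fix \<omega> assume w: "\<omega> \<in> space M"
    have "(\<Sum>y\<in>F. f y * indicator {\<omega>\<in>space M. Y \<omega> = y} \<omega>) = (\<Sum>y\<in>F. if y = Y \<omega> then f y else 0)"
      using w by (intro sum.cong) (auto simp: indicator_def)
    thus "f (Y \<omega>) = (\<Sum>y\<in>F. f y * indicator {\<omega>\<in>space M. Y \<omega> = y} \<omega>)" using YF[OF w] F by simp
  qed
  also have "\<dots> = (\<Sum>y\<in>F. f y * prob {\<omega>\<in>space M. Y \<omega> = y})"
    using ev by (subst Bochner_Integration.integral_sum) (auto simp: emeasure_eq_measure Int_absorb2)
  also have "\<dots> = (\<Sum>y\<in>F. if y \<in> P then f y / card P else 0)"
  proof (intro sum.cong refl)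
    fix y
    have "{x \<in> P. x = y} = (if y \<in> P then {y} else {})" by auto
    thus "f y * prob {\<omega>\<in>space M. Y \<omega> = y} = (if y \<in> P then f y / card P else 0)"
      by (subst uniform_variable_prob[OF u]) auto
  qed
  also have "\<dots> = (\<Sum>y\<in>P. f y / card P)" using F by (simp add: sum.If_cases Int_absorb1)
  finally show ?thesis by (simp add: sum_divide_distrib)
qed

lemma indep_vars_finite_range_prob:
  assumes ind: "indep_vars (\<lambda>_. count_space F) Q I" and J: "finite J" "J \<noteq> {}" "J \<subseteq> I"
  shows "prob {\<omega>\<in>space M. \<forall>j\<in>J. B j (Q j \<omega>)} = (\<Prod>j\<in>J. prob {\<omega>\<in>space M. B j (Q j \<omega>)})"
proof -
  have Q: "Q j \<in> measurable M (count_space F)" if "j \<in> J" for j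
    using ind J that by (auto simp: indep_vars_def)
  have eq: "Q j -` {y\<in>F. B j y} \<inter> space M = {\<omega>\<in>space M. B j (Q j \<omega>)}" if "j \<in> J" for j
    using measurable_space[OF Q[OF that]] by auto
  have "(\<Inter>j\<in>J. Q j -` {y\<in>F. B j y} \<inter> space M) = {\<omega>\<in>space M. \<forall>j\<in>J. B j (Q j \<omega>)}"
  proof -
    have "(\<Inter>j\<in>J. Q j -` {y\<in>F. B j y} \<inter> space M) = (\<Inter>j\<in>J. {\<omega>\<in>space M. B j (Q j \<omega>)})"
      by (intro INF_cong refl eq)
    thus ?thesis using J by auto
  qed
  moreover have "(\<Prod>j\<in>J. prob (Q j -` {y\<in>F. B j y} \<inter> space M)) = (\<Prod>j\<in>J. prob {\<omega>\<in>space M. B j (Q j \<omega>)})"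
    by (intro prod.cong refl arg_cong[where f=prob] eq)
  moreover have "prob (\<Inter>j\<in>J. Q j -` {y\<in>F. B j y} \<inter> space M) = (\<Prod>j\<in>J. prob (Q j -` {y\<in>F. B j y} \<inter> space M))"
    by (rule indep_varsD[OF ind J(2,1,3)]) auto
  ultimately show ?thesis by (simp only:)
qed

lemma indep_var_cong_space:
  assumes ind: "indep_var S X T Y"
    and X: "\<And>\<omega>. \<omega> \<in> space M \<Longrightarrow> X \<omega> = X' \<omega>" and Y: "\<And>\<omega>. \<omega> \<in> space M \<Longrightarrow> Y \<omega> = Y' \<omega>"
  shows "indep_var S X' T Y'"
proof -
  have "X -` A \<inter> space M = X' -` A \<inter> space M" "Y -` B \<inter> space M = Y' -` B \<inter> space M" for A B
    using X Y by auto
  moreover have "random_variable S X = random_variable S X'" "random_variable T Y = random_variable T Y'"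
    using X Y by (auto cong: measurable_cong)
  ultimately show ?thesis using ind unfolding indep_var_eq by simp
qed

lemma prob_split_uniform:
  assumes u: "uniform_variable M F P Y" and E: "{\<omega>\<in>space M. E \<omega>} \<in> events"
  shows "prob {\<omega>\<in>space M. E \<omega>} = (\<Sum>y\<in>P. prob {\<omega>\<in>space M. Y \<omega> = y \<and> E \<omega>})"
proof -
  have P: "finite P" using u unfolding uniform_variable_def by (meson finite_subset)
  have "{\<omega>\<in>space M. Y \<omega> = y \<and> E \<omega>} = {\<omega>\<in>space M. Y \<omega> \<in> {y}} \<inter> {\<omega>\<in>space M. E \<omega>}" for y by auto
  hence ev2: "{\<omega>\<in>space M. Y \<omega> = y \<and> E \<omega>} \<in> events" for y
    using sets.Int[OF uniform_variable_event[OF u, of "{y}"] E] by simp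
  have "prob {\<omega>\<in>space M. E \<omega>} = prob (\<Union>y\<in>P. {\<omega>\<in>space M. Y \<omega> = y \<and> E \<omega>})"
  proof (rule measure_eq_AE)
    show "AE \<omega> in M. (\<omega> \<in> {\<omega>\<in>space M. E \<omega>}) = (\<omega> \<in> (\<Union>y\<in>P. {\<omega>\<in>space M. Y \<omega> = y \<and> E \<omega>}))"
      using uniform_variable_AE[OF u] by eventually_elim auto
  qed (use E ev2 P in auto)
  also have "\<dots> = (\<Sum>y\<in>P. prob {\<omega>\<in>space M. Y \<omega> = y \<and> E \<omega>})"
    using ev2 P by (intro finite_measure_finite_Union) (auto simp: disjoint_family_on_def)
  finally show ?thesis .
qed

end

definition vertex_pairs :: "nat \<Rightarrow> (nat \<times> nat) set" where
  "vertex_pairs d = {(j, k). 1 \<le> j \<and> j < k \<and> k \<le> d}"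

lemma finite_vertex_pairs [simp]: "finite (vertex_pairs d)"
  by (rule finite_subset[of _ "{1..d} \<times> {1..d}"]) (auto simp: vertex_pairs_def)

lemma card_vertex_pairs: "real (card (vertex_pairs d)) = real d * (real d - 1) / 2"
proof (induction d)
  case 0
  have "vertex_pairs 0 = {}" by (auto simp: vertex_pairs_def)
  thus ?case by simp
next
  case (Suc d)
  have "vertex_pairs (Suc d) = vertex_pairs d \<union> (\<lambda>j. (j, Suc d)) ` {1..d}"
    by (auto simp: vertex_pairs_def image_iff)
  moreover have "vertex_pairs d \<inter> (\<lambda>j. (j, Suc d)) ` {1..d} = {}"
    by (auto simp: vertex_pairs_def)
  moreover have "card ((\<lambda>j. (j, Suc d)) ` {1..d}) = d"
    by (subst card_image) (auto simp: inj_on_def)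
  ultimately have "card (vertex_pairs (Suc d)) = card (vertex_pairs d) + d"
    by (simp add: card_Un_disjoint)
  thus ?case using Suc by (simp add: field_simps)
qed

text \<open>
  If all rows and columns of \<open>R\<close> have equally many entries, fixing one end of an edge does not change its
  probability. Hence edges that share a vertex are pairwise independent, and both error sums of the
  Chen-Stein bound run over at most \<open>2 d\<close> neighbours with summands \<open>\<pi>\<^sup>2\<close>.
\<close>

theorem (in prob_space) no_edge_poisson:
  fixes R :: "'b \<Rightarrow> 'b \<Rightarrow> bool" and \<pi> :: real
  assumes ind: "indep_vars (\<lambda>_. count_space F) Q {1..d}"
    and unif: "\<And>j. j \<in> {1..d} \<Longrightarrow> uniform_variable M F P (Q j)"
    and R1: "\<And>p. p \<in> P \<Longrightarrow> card {q\<in>P. R p q} = m" and R2: "\<And>q. q \<in> P \<Longrightarrow> card {p\<in>P. R p q} = m"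
    and \<pi>: "\<pi> = m / card P"
  shows "\<bar>prob {\<omega>\<in>space M. \<forall>(j, k)\<in>vertex_pairs d. \<not> R (Q j \<omega>) (Q k \<omega>)} - exp (- (card (vertex_pairs d) * \<pi>))\<bar>
           \<le> 4 * real d * card (vertex_pairs d) * \<pi>\<^sup>2"
proof (cases "vertex_pairs d = {}")
  case True
  thus ?thesis by (simp add: prob_space)
next
  case False
  let ?E = "vertex_pairs d"
  have d: "1 \<in> {1..d}" using False by (auto simp: vertex_pairs_def)
  have F: "finite F" "P \<subseteq> F" "P \<noteq> {}" using unif[OF d] by (auto simp: uniform_variable_def)
  have P: "finite P" "card P > 0" using F finite_subset by (auto simp: card_gt_0_iff)
  have Q: "Q j \<in> measurable M (count_space F)" if "j \<in> {1..d}" for j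
    using ind that by (auto simp: indep_vars_def)
  have QF: "Q j \<omega> \<in> F" if "j \<in> {1..d}" "\<omega> \<in> space M" for j \<omega>
    using measurable_space[OF Q[OF that(1)] that(2)] by simp
  have restr: "(\<lambda>\<omega>. restrict (\<lambda>j. Q j \<omega>) J) \<in> measurable M (count_space (J \<rightarrow>\<^sub>E F))" if "J \<subseteq> {1..d}" for J
  proof -
    have "(\<lambda>\<omega>. restrict (\<lambda>j. Q j \<omega>) J) \<in> measurable M (Pi\<^sub>M J (\<lambda>_. count_space F))"
      using Q that by (intro measurable_restrict) auto
    moreover have "Pi\<^sub>M J (\<lambda>_. count_space F) = count_space (J \<rightarrow>\<^sub>E F)"
      using that F finite_subset by (intro count_space_PiM_finite) (auto intro: countable_finite)
    ultimately show ?thesis by simp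
  qed
  have event: "{\<omega>\<in>space M. B (restrict (\<lambda>j. Q j \<omega>) J)} \<in> events" if "J \<subseteq> {1..d}" for B J
  proof -
    have "{\<omega>\<in>space M. B (restrict (\<lambda>j. Q j \<omega>) J)}
        = (\<lambda>\<omega>. restrict (\<lambda>j. Q j \<omega>) J) -` {x \<in> J \<rightarrow>\<^sub>E F. B x} \<inter> space M"
      using QF that by auto
    thus ?thesis using measurable_sets[OF restr[OF that], of "{x \<in> J \<rightarrow>\<^sub>E F. B x}"] by simp
  qed
  define A where "A = (\<lambda>(j, k). {\<omega>\<in>space M. R (Q j \<omega>) (Q k \<omega>)})"
  define nbh where "nbh = (\<lambda>e. {f\<in>?E. {fst f, snd f} \<inter> {fst e, snd e} \<noteq> {}})"
  have A_event: "A e \<in> events" if "e \<in> ?E" for e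
    using event[of "{fst e, snd e}" "\<lambda>x. R (x (fst e)) (x (snd e))"] that
    by (auto simp: A_def vertex_pairs_def)
  \<comment> \<open>\<open>R\<close> with the arguments in the order of the vertices, seen from the vertex \<open>s\<close>\<close>
  define adj where "adj = (\<lambda>(s::nat) a p q. if s < a then R p q else R q p)"
  have adj: "card {q\<in>P. adj s a p q} = m" if "p \<in> P" for s a p
    using R1[OF that] R2[OF that] by (cases "s < a") (simp_all add: adj_def)
  have single: "prob {\<omega>\<in>space M. adj s a p (Q a \<omega>)} = \<pi>" if "p \<in> P" "a \<in> {1..d}" for s a p
    using uniform_variable_prob[OF unif[OF that(2)]] adj[OF that(1)] by (simp add: \<pi>)
  have at_point: "prob {\<omega>\<in>space M. Q s \<omega> = p} = 1 / card P" if "s \<in> {1..d}" "p \<in> P" for s p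
    using unif[OF that(1)] that(2) by (simp add: uniform_variable_def)
  have edge: "prob {\<omega>\<in>space M. adj s a (Q s \<omega>) (Q a \<omega>)} = \<pi>"
    if sa: "s \<in> {1..d}" "a \<in> {1..d}" "s \<noteq> a" for s a
  proof -
    have "{\<omega>\<in>space M. adj s a (Q s \<omega>) (Q a \<omega>)} \<in> events"
      using event[of "{s, a}" "\<lambda>x. adj s a (x s) (x a)"] sa by auto
    hence "prob {\<omega>\<in>space M. adj s a (Q s \<omega>) (Q a \<omega>)}
        = (\<Sum>p\<in>P. prob {\<omega>\<in>space M. Q s \<omega> = p \<and> adj s a (Q s \<omega>) (Q a \<omega>)})"
      by (rule prob_split_uniform[OF unif[OF sa(1)]])
    also have "\<dots> = (\<Sum>p\<in>P. 1 / card P * \<pi>)"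
    proof (intro sum.cong refl)
      fix p assume p: "p \<in> P"
      have "{\<omega>\<in>space M. Q s \<omega> = p \<and> adj s a (Q s \<omega>) (Q a \<omega>)}
          = {\<omega>\<in>space M. \<forall>j\<in>{s, a}. (if j = s then (\<lambda>q. q = p) else adj s a p) (Q j \<omega>)}"
        using sa(3) by auto
      thus "prob {\<omega>\<in>space M. Q s \<omega> = p \<and> adj s a (Q s \<omega>) (Q a \<omega>)} = 1 / card P * \<pi>"
        using indep_vars_finite_range_prob[OF ind, of "{s, a}" "\<lambda>j. if j = s then (\<lambda>q. q = p) else adj s a p"]
          sa single[OF p sa(2), of s] at_point[OF sa(1) p] by simp
    qed
    also have "\<dots> = \<pi>" using F(3) P by simp
    finally show ?thesis .
  qed
  have two_edges: "prob {\<omega>\<in>space M. adj s a (Q s \<omega>) (Q a \<omega>) \<and> adj s b (Q s \<omega>) (Q b \<omega>)} = \<pi>\<^sup>2"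
    if sab: "s \<in> {1..d}" "a \<in> {1..d}" "b \<in> {1..d}" "s \<noteq> a" "s \<noteq> b" "a \<noteq> b" for s a b
  proof -
    have "{\<omega>\<in>space M. adj s a (Q s \<omega>) (Q a \<omega>) \<and> adj s b (Q s \<omega>) (Q b \<omega>)} \<in> events"
      using event[of "{s, a, b}" "\<lambda>x. adj s a (x s) (x a) \<and> adj s b (x s) (x b)"] sab by auto
    hence "prob {\<omega>\<in>space M. adj s a (Q s \<omega>) (Q a \<omega>) \<and> adj s b (Q s \<omega>) (Q b \<omega>)}
        = (\<Sum>p\<in>P. prob {\<omega>\<in>space M. Q s \<omega> = p \<and> adj s a (Q s \<omega>) (Q a \<omega>) \<and> adj s b (Q s \<omega>) (Q b \<omega>)})"
      by (rule prob_split_uniform[OF unif[OF sab(1)]])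
    also have "\<dots> = (\<Sum>p\<in>P. 1 / card P * (\<pi> * \<pi>))"
    proof (intro sum.cong refl)
      fix p assume p: "p \<in> P"
      have "{\<omega>\<in>space M. Q s \<omega> = p \<and> adj s a (Q s \<omega>) (Q a \<omega>) \<and> adj s b (Q s \<omega>) (Q b \<omega>)}
          = {\<omega>\<in>space M. \<forall>j\<in>{s, a, b}. (if j = s then (\<lambda>q. q = p) else adj s j p) (Q j \<omega>)}"
        using sab by auto
      thus "prob {\<omega>\<in>space M. Q s \<omega> = p \<and> adj s a (Q s \<omega>) (Q a \<omega>) \<and> adj s b (Q s \<omega>) (Q b \<omega>)} = 1 / card P * (\<pi> * \<pi>)"
        using indep_vars_finite_range_prob[OF ind, of "{s, a, b}" "\<lambda>j. if j = s then (\<lambda>q. q = p) else adj s j p"]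
          sab single[OF p sab(2), of s] single[OF p sab(3), of s] at_point[OF sab(1) p] by simp
    qed
    also have "\<dots> = \<pi>\<^sup>2" using F(3) P by (simp add: power2_eq_square)
    finally show ?thesis .
  qed
  have A_adj: "A (j, k) = {\<omega>\<in>space M. adj j k (Q j \<omega>) (Q k \<omega>)}"
    "A (j, k) = {\<omega>\<in>space M. adj k j (Q k \<omega>) (Q j \<omega>)}" if "(j, k) \<in> ?E" for j k
    using that by (auto simp: A_def adj_def vertex_pairs_def)
  have pA: "prob (A e) = \<pi>" if "e \<in> ?E" for e
  proof -
    obtain j k where "e = (j, k)" by (cases e)
    thus ?thesis using that edge[of j k] A_adj(1)[of j k] by (auto simp: vertex_pairs_def)
  qed
  have pAA: "prob (A e \<inter> A f) = \<pi>\<^sup>2" if ef: "e \<in> ?E" "f \<in> nbh e - {e}" for e f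
  proof -
    \<comment> \<open>\<open>s\<close> is the common vertex of the two edges.\<close>
    obtain s a b where s: "s \<in> {1..d}" "a \<in> {1..d}" "b \<in> {1..d}" "s \<noteq> a" "s \<noteq> b" "a \<noteq> b"
      "A e = {\<omega>\<in>space M. adj s a (Q s \<omega>) (Q a \<omega>)}" "A f = {\<omega>\<in>space M. adj s b (Q s \<omega>) (Q b \<omega>)}"
    proof -
      obtain j k where e: "e = (j, k)" by (cases e)
      obtain j' k' where f: "f = (j', k')" by (cases f)
      have fE: "f \<in> ?E" using ef by (simp add: nbh_def)
      have r: "j \<in> {1..d}" "k \<in> {1..d}" "j' \<in> {1..d}" "k' \<in> {1..d}" "j < k" "j' < k'"
        using ef(1) fE by (auto simp: e f vertex_pairs_def)
      note Ae = A_adj[OF ef(1)[unfolded e], folded e] and Af = A_adj[OF fE[unfolded f], folded f]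
      have "f \<noteq> e" using ef by simp
      consider "j' = j" "k' \<noteq> k" | "k' = j" | "j' = k" | "k' = k" "j' \<noteq> j"
        using ef \<open>f \<noteq> e\<close> by (auto simp: nbh_def e f)
      thus thesis
      proof cases
        case 1 thus ?thesis using that[of j k k'] r Ae(1) Af(1) by auto
      next
        case 2 thus ?thesis using that[of j k j'] r Ae(1) Af(2) by auto
      next
        case 3 thus ?thesis using that[of k j k'] r Ae(2) Af(1) by auto
      next
        case 4 thus ?thesis using that[of k j j'] r Ae(2) Af(2) by auto
      qed
    qed
    have "A e \<inter> A f = {\<omega>\<in>space M. adj s a (Q s \<omega>) (Q a \<omega>) \<and> adj s b (Q s \<omega>) (Q b \<omega>)}"
      unfolding s(7,8) by auto
    thus ?thesis using two_edges[OF s(1-6)] by simp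
  qed
  have card_nbh: "card (nbh e) \<le> 2 * d" if "e \<in> ?E" for e
  proof -
    have "nbh e \<subseteq> (\<lambda>(v, w). (min v w, max v w)) ` ({fst e, snd e} \<times> {1..d})"
    proof
      fix f assume "f \<in> nbh e"
      then obtain j k where f: "f = (j, k)" "j < k" "j \<in> {1..d}" "k \<in> {1..d}" "j \<in> {fst e, snd e} \<or> k \<in> {fst e, snd e}"
        by (cases f) (auto simp: nbh_def vertex_pairs_def)
      from f(5) show "f \<in> (\<lambda>(v, w). (min v w, max v w)) ` ({fst e, snd e} \<times> {1..d})"
      proof
        assume "j \<in> {fst e, snd e}"
        thus ?thesis using f by (intro image_eqI[of _ _ "(j, k)"]) auto
      next
        assume "k \<in> {fst e, snd e}"
        thus ?thesis using f by (intro image_eqI[of _ _ "(k, j)"]) auto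
      qed
    qed
    hence "card (nbh e) \<le> card ({fst e, snd e} \<times> {1..d})"
      by (meson card_image_le card_mono finite_SigmaI finite_atLeastAtMost finite.intros finite_imageI order_trans)
    also have "\<dots> \<le> 2 * d" by (simp add: card_cartesian_product card_insert_if)
    finally show ?thesis .
  qed
  have "\<bar>prob {\<omega>\<in>space M. \<forall>e\<in>?E. \<omega> \<notin> A e} - exp (- (\<Sum>e\<in>?E. prob (A e)))\<bar>
      \<le> (\<Sum>e\<in>?E. \<Sum>f\<in>nbh e. prob (A e) * prob (A f)) + (\<Sum>e\<in>?E. \<Sum>f\<in>nbh e - {e}. prob (A e \<inter> A f))"
  proof (rule poisson_approximation_no_event)
    fix e assume e: "e \<in> ?E"
    show "A e \<in> events" by (rule A_event[OF e])
    show "e \<in> nbh e" using e by (simp add: nbh_def)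
    show "nbh e \<subseteq> ?E" by (auto simp: nbh_def)
    let ?J = "{fst e, snd e}" let ?L = "{1..d} - {fst e, snd e}"
    have J: "?J \<subseteq> {1..d}" using e by (auto simp: vertex_pairs_def)
    have c: "Pi\<^sub>M J (\<lambda>_. count_space F) = count_space (J \<rightarrow>\<^sub>E F)" if "J \<subseteq> {1..d}" for J
      using that F finite_subset by (intro count_space_PiM_finite) (auto intro: countable_finite)
    let ?g = "\<lambda>G x. {f\<in>G. R (x (fst f)) (x (snd f))}"
    have "indep_var (Pi\<^sub>M ?J (\<lambda>_. count_space F)) (\<lambda>\<omega>. restrict (\<lambda>j. Q j \<omega>) ?J)
                    (Pi\<^sub>M ?L (\<lambda>_. count_space F)) (\<lambda>\<omega>. restrict (\<lambda>j. Q j \<omega>) ?L)"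
      by (rule indep_var_restrict[OF ind]) (use J in auto)
    hence "indep_var (count_space UNIV) (?g {e} \<circ> (\<lambda>\<omega>. restrict (\<lambda>j. Q j \<omega>) ?J))
                     (count_space UNIV) (?g (?E - nbh e) \<circ> (\<lambda>\<omega>. restrict (\<lambda>j. Q j \<omega>) ?L))"
      by (rule indep_var_compose) (simp_all only: c[OF J] c[OF Diff_subset] measurable_count_space_eq1, simp_all)
    moreover have "(?g {e} \<circ> (\<lambda>\<omega>. restrict (\<lambda>j. Q j \<omega>) ?J)) \<omega> = {f\<in>{e}. \<omega> \<in> A f}" if "\<omega> \<in> space M" for \<omega>
    proof -
      have "R (restrict (\<lambda>j. Q j \<omega>) ?J (fst e)) (restrict (\<lambda>j. Q j \<omega>) ?J (snd e)) \<longleftrightarrow> \<omega> \<in> A e"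
        using that by (simp add: A_def split_beta)
      thus ?thesis by (simp only: comp_def) (rule Collect_cong, blast)
    qed
    moreover have "(?g (?E - nbh e) \<circ> (\<lambda>\<omega>. restrict (\<lambda>j. Q j \<omega>) ?L)) \<omega> = {f \<in> ?E - nbh e. \<omega> \<in> A f}"
      if "\<omega> \<in> space M" for \<omega>
    proof -
      have "fst f \<in> ?L" "snd f \<in> ?L" if "f \<in> ?E - nbh e" for f
        using that by (auto simp: nbh_def vertex_pairs_def)
      hence "R (restrict (\<lambda>j. Q j \<omega>) ?L (fst f)) (restrict (\<lambda>j. Q j \<omega>) ?L (snd f)) \<longleftrightarrow> \<omega> \<in> A f"
        if "f \<in> ?E - nbh e" for f
        using that \<open>\<omega> \<in> space M\<close> by (simp add: A_def split_beta)
      thus ?thesis by (simp only: comp_def) (rule Collect_cong, blast)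
    qed
    ultimately show "indep_var (count_space UNIV) (\<lambda>\<omega>. {f\<in>{e}. \<omega> \<in> A f}) (count_space UNIV) (\<lambda>\<omega>. {f \<in> ?E - nbh e. \<omega> \<in> A f})"
      by (rule indep_var_cong_space)
  qed simp
  also have "\<dots> \<le> (\<Sum>e\<in>?E. 2 * real d * \<pi>\<^sup>2) + (\<Sum>e\<in>?E. 2 * real d * \<pi>\<^sup>2)"
  proof (rule add_mono)
    show "(\<Sum>e\<in>?E. \<Sum>f\<in>nbh e. prob (A e) * prob (A f)) \<le> (\<Sum>e\<in>?E. 2 * real d * \<pi>\<^sup>2)"
    proof (rule sum_mono)
      fix e assume e: "e \<in> ?E"
      have "(\<Sum>f\<in>nbh e. prob (A e) * prob (A f)) = (\<Sum>f\<in>nbh e. \<pi>\<^sup>2)"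
        using e by (intro sum.cong refl) (auto simp: pA nbh_def power2_eq_square)
      also have "\<dots> = real (card (nbh e)) * \<pi>\<^sup>2" by simp
      also have "\<dots> \<le> real (2 * d) * \<pi>\<^sup>2" by (intro mult_right_mono of_nat_mono card_nbh e) auto
      finally show "(\<Sum>f\<in>nbh e. prob (A e) * prob (A f)) \<le> 2 * real d * \<pi>\<^sup>2" by simp
    qed
    show "(\<Sum>e\<in>?E. \<Sum>f\<in>nbh e - {e}. prob (A e \<inter> A f)) \<le> (\<Sum>e\<in>?E. 2 * real d * \<pi>\<^sup>2)"
    proof (rule sum_mono)
      fix e assume e: "e \<in> ?E"
      have "(\<Sum>f\<in>nbh e - {e}. prob (A e \<inter> A f)) = (\<Sum>f\<in>nbh e - {e}. \<pi>\<^sup>2)"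
        using e by (intro sum.cong refl pAA)
      also have "\<dots> = real (card (nbh e - {e})) * \<pi>\<^sup>2" by simp
      also have "card (nbh e - {e}) \<le> 2 * d"
        using card_nbh[OF e] card_Diff1_le[of "nbh e" e] by linarith
      finally show "(\<Sum>f\<in>nbh e - {e}. prob (A e \<inter> A f)) \<le> 2 * real d * \<pi>\<^sup>2"
        by (simp add: mult_right_mono)
    qed
  qed
  finally have "\<bar>prob {\<omega>\<in>space M. \<forall>e\<in>?E. \<omega> \<notin> A e} - exp (- (\<Sum>e\<in>?E. prob (A e)))\<bar>
      \<le> (\<Sum>e\<in>?E. 2 * real d * \<pi>\<^sup>2) + (\<Sum>e\<in>?E. 2 * real d * \<pi>\<^sup>2)" .
  moreover have "(\<Sum>e\<in>?E. prob (A e)) = card ?E * \<pi>" by (simp add: pA)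
  moreover have "{\<omega>\<in>space M. \<forall>e\<in>?E. \<omega> \<notin> A e} = {\<omega>\<in>space M. \<forall>(j, k)\<in>?E. \<not> R (Q j \<omega>) (Q k \<omega>)}"
    by (auto simp: A_def)
  ultimately show ?thesis by (simp add: mult_ac)
qed

section \<open>Rank vectors of independent samples\<close>

(* Otherwise simplification destroys the interval {1..n}, on which the facts below are stated. *)
declare One_nat_def [simp del]

text \<open>
  The identity outside \<open>{1..n}\<close>, so that it is a permutation in the sense of \<open>permutes\<close> if there are no ties.
\<close>

definition rank_vector :: "nat \<Rightarrow> (nat \<Rightarrow> real) \<Rightarrow> nat \<Rightarrow> nat" where
  "rank_vector n x = (\<lambda>i. if i \<in> {1..n} then rank_of n x i else i)"

definition rank_vectors :: "nat \<Rightarrow> (nat \<Rightarrow> nat) set" where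
  "rank_vectors n = {f. (\<forall>i\<in>{1..n}. f i \<in> {..n}) \<and> (\<forall>i. i \<notin> {1..n} \<longrightarrow> f i = i)}"

lemma rank_vector_in: "rank_vector n x \<in> rank_vectors n"
proof -
  have "rank_of n x i \<le> n" for i
  proof -
    have "card {l\<in>{1..n}. x l \<le> x i} \<le> card {1..n}" by (intro card_mono) auto
    thus ?thesis by (simp add: rank_of_def)
  qed
  thus ?thesis by (auto simp: rank_vector_def rank_vectors_def)
qed

lemma finite_rank_vectors [simp]: "finite (rank_vectors n)"
proof -
  have "rank_vectors n \<subseteq> (\<lambda>g i. if i \<in> {1..n} then g i else i) ` ({1..n} \<rightarrow>\<^sub>E {..n})"
  proof
    fix f assume f: "f \<in> rank_vectors n"
    have "f = (\<lambda>i. if i \<in> {1..n} then restrict f {1..n} i else i)"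
      using f by (auto simp: rank_vectors_def fun_eq_iff)
    moreover have "restrict f {1..n} \<in> {1..n} \<rightarrow>\<^sub>E {..n}"
      using f by (auto simp: rank_vectors_def)
    ultimately show "f \<in> (\<lambda>g i. if i \<in> {1..n} then g i else i) ` ({1..n} \<rightarrow>\<^sub>E {..n})" by blast
  qed
  thus ?thesis by (rule finite_subset) (simp add: finite_PiE)
qed

lemma permutations_subset_rank_vectors: "{p. p permutes {1..n}} \<subseteq> rank_vectors n"
proof
  fix p assume "p \<in> {p. p permutes {1..n}}"
  hence p: "p permutes {1..n}" by simp
  have "p i \<in> {..n}" if "i \<in> {1..n}" for i
    using permutes_in_image[OF p, of i] that by simp
  thus "p \<in> rank_vectors n" using permutes_not_in[OF p] by (auto simp: rank_vectors_def)
qed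

text \<open>
  Each rank is a sum of indicators of comparisons of two coordinates.
\<close>

lemma measurable_rank_vector [measurable]:
  "rank_vector n \<in> measurable (Pi\<^sub>M {1..n} (\<lambda>_. borel)) (count_space (rank_vectors n))"
proof (subst measurable_count_space_eq2)
  show "finite (rank_vectors n)" by simp
  show "rank_vector n \<in> space (Pi\<^sub>M {1..n} (\<lambda>_. borel)) \<rightarrow> rank_vectors n \<and>
      (\<forall>q\<in>rank_vectors n. rank_vector n -` {q} \<inter> space (Pi\<^sub>M {1..n} (\<lambda>_. borel)) \<in> sets (Pi\<^sub>M {1..n} (\<lambda>_. borel)))"
  proof (intro conjI ballI funcsetI rank_vector_in)
    fix q assume q: "q \<in> rank_vectors n"
    have eq: "rank_vector n -` {q} \<inter> space (Pi\<^sub>M {1..n} (\<lambda>_. borel))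
      = {x\<in>space (Pi\<^sub>M {1..n} (\<lambda>_. borel)). \<forall>i\<in>{1..n}. (\<Sum>l\<in>{1..n}. if x l \<le> x i then 1 else 0) = q i}"
      using q by (auto simp: rank_vector_def rank_vectors_def rank_of_def fun_eq_iff sum.If_cases Int_def)
    show "rank_vector n -` {q} \<inter> space (Pi\<^sub>M {1..n} (\<lambda>_. borel)) \<in> sets (Pi\<^sub>M {1..n} (\<lambda>_. borel :: real measure))"
      unfolding eq by measurable
  qed
qed

lemma rank_vector_restrict: "rank_vector n (restrict x {1..n}) = rank_vector n x"
  by (auto simp: rank_vector_def rank_of_def fun_eq_iff intro!: arg_cong[where f=card])

lemma rank_vector_permute:
  assumes s: "s permutes {1..n}"
  shows "rank_vector n (x \<circ> s) = rank_vector n x \<circ> s"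
proof
  fix i
  show "rank_vector n (x \<circ> s) i = (rank_vector n x \<circ> s) i"
  proof (cases "i \<in> {1..n}")
    case True
    have "{l \<in> {1..n}. x l \<le> x (s i)} = s ` {l \<in> {1..n}. x (s l) \<le> x (s i)}"
      using permutes_image[OF s] permutes_in_image[OF s] by (auto simp: image_iff) (metis permutes_inverses(1)[OF s] permutes_in_image[OF s] permutes_inv[OF s] atLeastAtMost_iff)
    moreover have "inj_on s A" for A using permutes_inj[OF s] inj_on_subset by blast
    ultimately have "rank_of n x (s i) = rank_of n (x \<circ> s) i"
      by (simp add: rank_of_def card_image)
    thus ?thesis using True permutes_in_image[OF s, of i] by (simp add: rank_vector_def)
  next
    case False
    moreover have "s i = i" by (rule permutes_not_in[OF s False])
    ultimately show ?thesis by (auto simp: rank_vector_def)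
  qed
qed

lemma rank_vector_permutes:
  assumes inj: "inj_on x {1..n}"
  shows "rank_vector n x permutes {1..n}"
proof (rule bij_imp_permutes)
  let ?r = "rank_vector n x"
  have less: "rank_of n x i < rank_of n x l" if "i \<in> {1..n}" "l \<in> {1..n}" "x i < x l" for i l
  proof -
    have "{m \<in> {1..n}. x m \<le> x i} \<subseteq> {m \<in> {1..n}. x m \<le> x l}" using that by auto
    moreover have "l \<in> {m \<in> {1..n}. x m \<le> x l}" "l \<notin> {m \<in> {1..n}. x m \<le> x i}" using that by auto
    ultimately show ?thesis unfolding rank_of_def by (intro psubset_card_mono, simp) blast
  qed
  have "inj_on ?r {1..n}"
  proof (rule inj_onI)
    fix i l assume il: "i \<in> {1..n}" "l \<in> {1..n}" "?r i = ?r l"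
    hence "\<not> x i < x l" "\<not> x l < x i" using less[of i l] less[of l i] by (auto simp: rank_vector_def)
    hence "x i = x l" by simp
    thus "i = l" using inj_onD[OF inj] il(1,2) by blast
  qed
  moreover have "?r ` {1..n} \<subseteq> {1..n}"
  proof
    fix r assume "r \<in> ?r ` {1..n}"
    then obtain i where i: "i \<in> {1..n}" "r = rank_of n x i" by (auto simp: rank_vector_def)
    have "card {i} \<le> rank_of n x i" unfolding rank_of_def using i by (intro card_mono) auto
    moreover have "rank_of n x i \<le> card {1..n}" unfolding rank_of_def by (intro card_mono) auto
    ultimately show "r \<in> {1..n}" using i by simp
  qed
  ultimately show "bij_betw ?r {1..n} {1..n}"
    using endo_inj_surj[of "{1..n}" ?r] by (simp add: bij_betw_def)
qed (auto simp: rank_vector_def)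

text \<open>
  The joint law is a power of one measure and hence invariant under permutations of the sample, and permuting the
  sample composes the rank vector with the permutation. So all permutations are equally likely, and
  their probabilities add up to \<open>1\<close> because ties are null events.
\<close>

lemma (in prob_space) uniform_rank_vector:
  assumes n: "n \<ge> 1" and ind: "indep_vars (\<lambda>_. borel) T {1..n}"
    and distr: "\<And>i. i \<in> {1..n} \<Longrightarrow> distr M borel (T i) = D"
    and atomless: "\<And>i x. i \<in> {1..n} \<Longrightarrow> prob {\<omega>\<in>space M. T i \<omega> = x} = 0"
  shows "uniform_variable M (rank_vectors n) {p. p permutes {1..n}} (\<lambda>\<omega>. rank_vector n (\<lambda>i. T i \<omega>))"
proof -
  let ?I = "{1..n}" let ?P = "{p. p permutes {1..n}}"
  let ?B = "Pi\<^sub>M ?I (\<lambda>_. borel :: real measure)" let ?D = "Pi\<^sub>M ?I (\<lambda>_. D)"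
  have T: "T i \<in> borel_measurable M" if "i \<in> ?I" for i
    using ind that by (auto simp: indep_vars_def)
  let ?T = "\<lambda>\<omega>. \<lambda>i\<in>?I. T i \<omega>"
  have Tm: "?T \<in> measurable M ?B" using T by (intro measurable_restrict) auto
  have Q: "(\<lambda>\<omega>. rank_vector n (\<lambda>i. T i \<omega>)) = (\<lambda>\<omega>. rank_vector n (?T \<omega>))"
    by (simp only: rank_vector_restrict)
  have Qm: "(\<lambda>\<omega>. rank_vector n (\<lambda>i. T i \<omega>)) \<in> measurable M (count_space (rank_vectors n))"
    unfolding Q by (rule measurable_compose[OF Tm measurable_rank_vector])
  have sD: "sets D = sets borel" "space D = UNIV"
    using distr[of 1] n by (auto simp flip: distr)
  have pD: "prob_space D" using distr[of 1] n T[of 1] prob_space_distr by auto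
  have joint: "distr M ?B ?T = ?D"
  proof -
    have "distr M ?B ?T = (\<Pi>\<^sub>M i\<in>?I. distr M borel (T i))"
      using ind T n by (subst indep_vars_iff_distr_eq_PiM'[symmetric]) auto
    also have "\<dots> = ?D" using distr by (intro PiM_cong refl) simp
    finally show ?thesis .
  qed
  have sBD: "sets ?D = sets ?B" using sD by (intro sets_PiM_cong refl) simp
  define r where "r = (\<lambda>q. prob {\<omega>\<in>space M. rank_vector n (\<lambda>i. T i \<omega>) = q})"
  have ev: "rank_vector n -` {q} \<inter> space ?B \<in> sets ?B" if "q \<in> ?P" for q
  proof -
    have "{q} \<subseteq> rank_vectors n" using that permutations_subset_rank_vectors[of n] by blast
    thus ?thesis using measurable_sets[OF measurable_rank_vector, of "{q}" n] by simp
  qed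
  have r_eq: "r q = measure ?D (rank_vector n -` {q} \<inter> space ?B)" if "q \<in> ?P" for q
  proof -
    have "measure ?D (rank_vector n -` {q} \<inter> space ?B) = prob (?T -` (rank_vector n -` {q} \<inter> space ?B) \<inter> space M)"
      using measure_distr[OF Tm ev[OF that]] by (simp only: joint)
    also have "?T -` (rank_vector n -` {q} \<inter> space ?B) \<inter> space M = {\<omega>\<in>space M. rank_vector n (\<lambda>i. T i \<omega>) = q}"
    proof -
      have "?T \<omega> \<in> space ?B" for \<omega> by (simp add: space_PiM)
      thus ?thesis by (simp add: rank_vector_restrict vimage_def Int_def conj_commute)
    qed
    finally show ?thesis by (simp add: r_def)
  qed
  have r_const: "r (q \<circ> inv s) = r q" if q: "q \<in> ?P" and s: "s \<in> ?P" for q s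
  proof -
    have s': "s permutes ?I" and q': "q permutes ?I" using s q by auto
    let ?f = "\<lambda>x::nat \<Rightarrow> real. \<lambda>i\<in>?I. x (s i)"
    have re: "distr ?D ?D ?f = ?D"
      using distr_PiM_reindex[of ?I "\<lambda>_. D" s ?I] pD permutes_inj_on[OF s'] permutes_in_image[OF s'] by auto
    have fm: "?f \<in> measurable ?D ?D"
      using permutes_in_image[OF s'] by (intro measurable_restrict measurable_component_singleton) auto
    have "r q = measure (distr ?D ?D ?f) (rank_vector n -` {q} \<inter> space ?B)" by (simp only: re r_eq[OF q])
    also have "\<dots> = measure ?D (?f -` (rank_vector n -` {q} \<inter> space ?B) \<inter> space ?D)"
      using fm ev[OF q] sBD by (intro measure_distr) auto
    also have "?f -` (rank_vector n -` {q} \<inter> space ?B) \<inter> space ?D = rank_vector n -` {q \<circ> inv s} \<inter> space ?B"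
    proof -
      have "rank_vector n (?f x) = q \<longleftrightarrow> rank_vector n x = q \<circ> inv s" for x
      proof -
        have eq: "rank_vector n (?f x) = rank_vector n x \<circ> s"
          using rank_vector_permute[OF s', of x] rank_vector_restrict[of n "x \<circ> s"] by (simp add: comp_def)
        have "a \<circ> s = q \<longleftrightarrow> a = q \<circ> inv s" for a :: "nat \<Rightarrow> nat"
          using permutes_inv_o[OF s'] by (metis comp_assoc comp_id)
        thus ?thesis by (simp only: eq)
      qed
      moreover have "space ?D = space ?B" using sBD by (rule sets_eq_imp_space_eq)
      moreover have "?f x \<in> space ?B" for x by (simp add: space_PiM)
      ultimately show ?thesis
        by (intro set_eqI) (simp only: vimage_eq Int_iff singleton_iff simp_thms)
    qed
    also have "measure ?D \<dots> = r (q \<circ> inv s)"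
      using permutes_compose[OF permutes_inv[OF s'] q'] by (subst r_eq) auto
    finally show ?thesis by simp
  qed
  have r_id: "r q = r id" if "q \<in> ?P" for q
  proof -
    have "r (q \<circ> inv q) = r q" using that by (intro r_const)
    thus ?thesis using that permutes_inv_o(1)[of q ?I] by simp
  qed
  have no_ties: "prob {\<omega>\<in>space M. T i \<omega> = T l \<omega>} = 0" if il: "i \<in> ?I" "l \<in> ?I" "i \<noteq> l" for i l
  proof -
    have "indep_var borel (T i) borel (T l)"
      using indep_var_compose[OF indep_var_restrict[OF ind, of "{i}" "{l}"], of "\<lambda>x. x i" borel "\<lambda>x. x l" borel] il
      by (simp add: comp_def)
    hence J: "distr M (borel \<Otimes>\<^sub>M borel) (\<lambda>\<omega>. (T i \<omega>, T l \<omega>)) = D \<Otimes>\<^sub>M D"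
      using distr il by (simp add: indep_var_distribution_eq)
    interpret D: prob_space D by (rule pD)
    interpret DD: pair_sigma_finite D D ..
    let ?S = "{z :: real \<times> real. fst z = snd z}"
    have S: "?S \<in> sets (borel \<Otimes>\<^sub>M borel)" unfolding borel_prod
      by (intro borel_closed closed_Collect_eq continuous_intros)
    have Sm: "?S \<in> sets (D \<Otimes>\<^sub>M D)" using S sD by (simp cong: sets_pair_measure_cong)
    have at: "emeasure D {x} = 0" for x
    proof -
      have "emeasure D {x} = emeasure M (T i -` {x} \<inter> space M)"
        using distr[OF il(1)] T[OF il(1)] by (simp add: emeasure_distr flip: distr[OF il(1)])
      also have "T i -` {x} \<inter> space M = {\<omega>\<in>space M. T i \<omega> = x}" by auto
      finally show ?thesis using atomless[OF il(1)] by (simp add: emeasure_eq_measure)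
    qed
    have "emeasure (D \<Otimes>\<^sub>M D) ?S = (\<integral>\<^sup>+x. emeasure D (Pair x -` ?S) \<partial>D)"
      by (rule D.emeasure_pair_measure_alt[OF Sm])
    also have "\<dots> = (\<integral>\<^sup>+x. 0 \<partial>D)"
    proof (intro nn_integral_cong)
      fix x
      have "Pair x -` ?S = {x}" by auto
      thus "emeasure D (Pair x -` ?S) = 0" by (simp add: at)
    qed
    finally have "emeasure (D \<Otimes>\<^sub>M D) ?S = 0" by simp
    hence "emeasure M ((\<lambda>\<omega>. (T i \<omega>, T l \<omega>)) -` ?S \<inter> space M) = 0"
      unfolding J[symmetric] using T il S by (subst (asm) emeasure_distr) auto
    moreover have "(\<lambda>\<omega>. (T i \<omega>, T l \<omega>)) -` ?S \<inter> space M = {\<omega>\<in>space M. T i \<omega> = T l \<omega>}" by auto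
    ultimately show ?thesis by (simp add: measure_def)
  qed
  have evQ: "{\<omega>\<in>space M. rank_vector n (\<lambda>i. T i \<omega>) \<in> C} \<in> events" if "C \<subseteq> rank_vectors n" for C
  proof -
    have "{\<omega>\<in>space M. rank_vector n (\<lambda>i. T i \<omega>) \<in> C} = (\<lambda>\<omega>. rank_vector n (\<lambda>i. T i \<omega>)) -` C \<inter> space M" by auto
    thus ?thesis using measurable_sets[OF Qm, of C] that by simp
  qed
  have fP: "finite ?P" by (rule finite_permutations) simp
  have cP: "card ?P > 0" by (simp add: card_permutations[OF refl])
  have "AE \<omega> in M. \<forall>i\<in>?I. \<forall>l\<in>?I. i \<noteq> l \<longrightarrow> T i \<omega> \<noteq> T l \<omega>"
  proof (intro AE_ball_countable[THEN iffD2] ballI countable_finite finite_atLeastAtMost)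
    fix i l assume il: "i \<in> ?I" "l \<in> ?I"
    show "AE \<omega> in M. i \<noteq> l \<longrightarrow> T i \<omega> \<noteq> T l \<omega>"
    proof (cases "i = l")
      case False
      have m: "{\<omega>\<in>space M. T i \<omega> = T l \<omega>} \<in> events" using T il by measurable
      have "{\<omega>\<in>space M. T i \<omega> = T l \<omega>} \<in> null_sets M"
        using no_ties[OF il False] m by (intro null_setsI) (auto simp: emeasure_eq_measure)
      hence "AE \<omega> in M. \<omega> \<notin> {\<omega>\<in>space M. T i \<omega> = T l \<omega>}" by (rule AE_not_in)
      thus ?thesis by (rule AE_mp) (auto intro!: AE_I2)
    qed simp
  qed
  hence "AE \<omega> in M. rank_vector n (\<lambda>i. T i \<omega>) \<in> ?P"
  proof (rule AE_mp, intro AE_I2 impI CollectI)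
    fix \<omega> assume "\<forall>i\<in>?I. \<forall>l\<in>?I. i \<noteq> l \<longrightarrow> T i \<omega> \<noteq> T l \<omega>"
    thus "rank_vector n (\<lambda>i. T i \<omega>) permutes ?I"
      by (intro rank_vector_permutes) (auto simp: inj_on_def)
  qed
  hence "prob {\<omega>\<in>space M. rank_vector n (\<lambda>i. T i \<omega>) \<in> ?P} = 1"
    using evQ[OF permutations_subset_rank_vectors] by (intro prob_eq_1[THEN iffD2]) (auto elim: AE_mp)
  moreover have "{\<omega>\<in>space M. rank_vector n (\<lambda>i. T i \<omega>) \<in> ?P} = (\<Union>q\<in>?P. {\<omega>\<in>space M. rank_vector n (\<lambda>i. T i \<omega>) = q})"
    by auto
  moreover have "prob (\<Union>q\<in>?P. {\<omega>\<in>space M. rank_vector n (\<lambda>i. T i \<omega>) = q}) = (\<Sum>q\<in>?P. r q)"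
    unfolding r_def using fP evQ[of "{q}" for q] permutations_subset_rank_vectors
    by (intro finite_measure_finite_Union) (auto simp: disjoint_family_on_def)
  ultimately have "(\<Sum>q\<in>?P. r q) = 1" by simp
  moreover have "(\<Sum>q\<in>?P. r q) = (\<Sum>q\<in>?P. r id)" by (intro sum.cong refl r_id)
  ultimately have "card ?P * r id = 1" by simp
  hence "r q = 1 / card ?P" if "q \<in> ?P" for q using r_id[OF that] cP by (simp add: field_simps)
  moreover have "?P \<noteq> {}" using cP by (metis card.empty less_irrefl)
  ultimately show ?thesis
    using Qm permutations_subset_rank_vectors[of n] by (simp add: uniform_variable_def r_def)
qed

text \<open>
  The rows of the data matrix are independent, and so are the entries in each row; hence all the entries are
  independent, and regrouping them gives independent columns.
\<close>

lemma independent_uniform_rank_vectors: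
  fixes S :: "nat \<Rightarrow> 'a \<Rightarrow> nat \<Rightarrow> real"
  assumes X: "continuous_random_vector N d X" and copies: "independent_copies M n d S N X"
    and H0: "independent_components N d X" and n: "n \<ge> 1" and d: "d \<ge> 1"
  shows "prob_space.indep_vars M (\<lambda>_. count_space (rank_vectors n)) (\<lambda>j \<omega>. rank_vector n (\<lambda>i. S i \<omega> j)) {1..d}"
    and "\<And>j. j \<in> {1..d} \<Longrightarrow> uniform_variable M (rank_vectors n) {p. p permutes {1..n}} (\<lambda>\<omega>. rank_vector n (\<lambda>i. S i \<omega> j))"
proof -
  interpret M: prob_space M using copies by (simp add: independent_copies_def)
  interpret N: prob_space N using X by (simp add: continuous_random_vector_def)
  have S_ind: "M.indep_vars (\<lambda>_. vec_space d) S {1..n}"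
    and S_distr: "\<And>i. i \<in> {1..n} \<Longrightarrow> distr M (vec_space d) (S i) = distr N (vec_space d) X"
    using copies by (auto simp: independent_copies_def)
  have Sm: "S i \<in> measurable M (vec_space d)" if "i \<in> {1..n}" for i
    using S_ind that by (auto simp: M.indep_vars_def)
  have Xm: "X \<in> measurable N (vec_space d)" using X by (simp add: continuous_random_vector_def)
  have X_ind: "N.indep_vars (\<lambda>_. borel) (\<lambda>j \<omega>. X \<omega> j) {1..d}"
    using H0 by (simp add: independent_components_def)
  have entry: "(\<lambda>\<omega>. S i \<omega> j) \<in> borel_measurable M" if "i \<in> {1..n}" "j \<in> {1..d}" for i j
    using measurable_compose[OF Sm[OF that(1)] measurable_component_singleton[OF that(2)]] by simp
  have Xj: "(\<lambda>\<omega>. X \<omega> j) \<in> borel_measurable N" if "j \<in> {1..d}" for j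
    using measurable_compose[OF Xm measurable_component_singleton[OF that]] by simp
  have law: "M.prob (S i -` B \<inter> space M) = N.prob (X -` B \<inter> space N)"
    if "i \<in> {1..n}" "B \<in> sets (vec_space d)" for i B
    using measure_distr[OF Sm[OF that(1)] that(2)] measure_distr[OF Xm that(2)] S_distr[OF that(1)] by simp
  have entry_law: "M.prob ((\<lambda>\<omega>. S i \<omega> j) -` A \<inter> space M) = N.prob ((\<lambda>\<omega>. X \<omega> j) -` A \<inter> space N)"
    if ij: "i \<in> {1..n}" "j \<in> {1..d}" and A: "A \<in> sets borel" for i j A
  proof -
    let ?B = "(\<lambda>x. x j) -` A \<inter> space (vec_space d)"
    have B: "?B \<in> sets (vec_space d)"
      using measurable_sets[OF measurable_component_singleton[OF ij(2), of "\<lambda>_. borel"] A] .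
    have "S i -` ?B \<inter> space M = (\<lambda>\<omega>. S i \<omega> j) -` A \<inter> space M"
      using measurable_space[OF Sm[OF ij(1)]] by auto
    moreover have "X -` ?B \<inter> space N = (\<lambda>\<omega>. X \<omega> j) -` A \<inter> space N"
      using measurable_space[OF Xm] by auto
    ultimately show ?thesis using law[OF ij(1) B] by simp
  qed
  let ?I = "{1..n} \<times> {1..d}" and ?Z = "\<lambda>(i, j) \<omega>. S i \<omega> j"
  have entries: "M.indep_vars (\<lambda>_. borel) ?Z ?I"
  proof (subst M.indep_vars_finite[where E="\<lambda>_. sets borel"])
    show "\<forall>A\<in>(\<Pi> e\<in>?I. sets borel). M.prob (\<Inter>e\<in>?I. ?Z e -` A e \<inter> space M)
        = (\<Prod>e\<in>?I. M.prob (?Z e -` A e \<inter> space M))"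
    proof
      fix A :: "nat \<times> nat \<Rightarrow> real set" assume A: "A \<in> (\<Pi> e\<in>?I. sets borel)"
      have A': "A (i, j) \<in> sets borel" if "i \<in> {1..n}" "j \<in> {1..d}" for i j
        using A that by (auto simp: Pi_iff)
      define B where "B = (\<lambda>i. \<Pi>\<^sub>E j\<in>{1..d}. A (i, j))"
      have B: "B i \<in> sets (vec_space d)" if "i \<in> {1..n}" for i
        unfolding B_def using A' that by (intro sets_PiM_I_finite) auto
      have "(\<Inter>e\<in>?I. ?Z e -` A e \<inter> space M) = (\<Inter>i\<in>{1..n}. S i -` B i \<inter> space M)"
      proof (intro set_eqI iffI)
        fix \<omega> assume w: "\<omega> \<in> (\<Inter>e\<in>?I. ?Z e -` A e \<inter> space M)"
        have "(1, 1) \<in> ?I" using n d by simp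
        hence sp: "\<omega> \<in> space M" using w by blast
        have "S i \<omega> \<in> B i" if i: "i \<in> {1..n}" for i
        proof -
          have "S i \<omega> \<in> space (vec_space d)" using measurable_space[OF Sm[OF i] sp] .
          moreover have "S i \<omega> j \<in> A (i, j)" if "j \<in> {1..d}" for j
            using w i that by fastforce
          ultimately show ?thesis by (auto simp: B_def space_PiM PiE_iff)
        qed
        thus "\<omega> \<in> (\<Inter>i\<in>{1..n}. S i -` B i \<inter> space M)" using sp by auto
      next
        fix \<omega> assume w: "\<omega> \<in> (\<Inter>i\<in>{1..n}. S i -` B i \<inter> space M)"
        show "\<omega> \<in> (\<Inter>e\<in>?I. ?Z e -` A e \<inter> space M)"
          using w by (auto simp: B_def PiE_iff)
      qed
      also have "M.prob \<dots> = (\<Prod>i\<in>{1..n}. M.prob (S i -` B i \<inter> space M))"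
        using n B by (intro M.indep_varsD[OF S_ind]) auto
      also have "\<dots> = (\<Prod>i\<in>{1..n}. \<Prod>j\<in>{1..d}. M.prob ((\<lambda>\<omega>. S i \<omega> j) -` A (i, j) \<inter> space M))"
      proof (intro prod.cong refl)
        fix i assume i: "i \<in> {1..n}"
        have "M.prob (S i -` B i \<inter> space M) = N.prob (X -` B i \<inter> space N)" by (rule law[OF i B[OF i]])
        also have "X -` B i \<inter> space N = (\<Inter>j\<in>{1..d}. (\<lambda>\<omega>. X \<omega> j) -` A (i, j) \<inter> space N)"
        proof -
          have "1 \<in> {1..d}" using d by simp
          thus ?thesis using measurable_space[OF Xm] by (fastforce simp: B_def space_PiM PiE_iff)
        qed
        also have "N.prob \<dots> = (\<Prod>j\<in>{1..d}. N.prob ((\<lambda>\<omega>. X \<omega> j) -` A (i, j) \<inter> space N))"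
          using d A' i by (intro N.indep_varsD[OF X_ind]) auto
        also have "\<dots> = (\<Prod>j\<in>{1..d}. M.prob ((\<lambda>\<omega>. S i \<omega> j) -` A (i, j) \<inter> space M))"
          using i A' by (intro prod.cong refl entry_law[symmetric]) auto
        finally show "M.prob (S i -` B i \<inter> space M) = (\<Prod>j\<in>{1..d}. M.prob ((\<lambda>\<omega>. S i \<omega> j) -` A (i, j) \<inter> space M))" .
      qed
      also have "\<dots> = (\<Prod>(i, j)\<in>?I. M.prob ((\<lambda>\<omega>. S i \<omega> j) -` A (i, j) \<inter> space M))"
        by (rule prod.cartesian_product)
      finally show "M.prob (\<Inter>e\<in>?I. ?Z e -` A e \<inter> space M)
        = (\<Prod>e\<in>?I. M.prob (?Z e -` A e \<inter> space M))"
        by (simp add: split_beta)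
    qed
  next
    fix e assume "e \<in> ?I"
    thus "?Z e \<in> borel_measurable M"
      using entry by (auto simp: split_beta)
    show "sets (borel :: real measure) = sigma_sets (space borel) (sets borel)"
      by (rule sets.sigma_sets_eq[symmetric])
    show "Int_stable (sets (borel :: real measure))" by (rule sets.Int_stable)
    show "sets (borel :: real measure) \<subseteq> Pow (space borel)" by (rule sets.space_closed)
  qed (use n d in auto)
  have col: "rank_vector n (\<lambda>i. S i \<omega> j) = rank_vector n (\<lambda>i. restrict (\<lambda>e. ?Z e \<omega>) ({1..n} \<times> {j}) (i, j))"
    for \<omega> j
  proof -
    have "restrict (\<lambda>i. restrict (\<lambda>e. ?Z e \<omega>) ({1..n} \<times> {j}) (i, j)) {1..n}
        = restrict (\<lambda>i. S i \<omega> j) {1..n}"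
      by (auto simp: fun_eq_iff)
    thus ?thesis by (metis rank_vector_restrict)
  qed
  have "M.indep_vars (\<lambda>j. Pi\<^sub>M ({1..n} \<times> {j}) (\<lambda>_. borel))
      (\<lambda>j \<omega>. restrict (\<lambda>e. ?Z e \<omega>) ({1..n} \<times> {j})) {1..d}"
    by (rule M.indep_vars_restrict[OF entries]) (auto simp: disjoint_family_on_def)
  hence "M.indep_vars (\<lambda>_. count_space (rank_vectors n))
      (\<lambda>j \<omega>. rank_vector n (\<lambda>i. restrict (\<lambda>e. ?Z e \<omega>) ({1..n} \<times> {j}) (i, j))) {1..d}"
  proof (rule M.indep_vars_compose2)
    fix j
    have "(\<lambda>x. restrict (\<lambda>i. x (i, j)) {1..n}) \<in> measurable (Pi\<^sub>M ({1..n} \<times> {j}) (\<lambda>_. borel)) (Pi\<^sub>M {1..n} (\<lambda>_. borel :: real measure))"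
      by (intro measurable_restrict measurable_component_singleton) auto
    from measurable_compose[OF this measurable_rank_vector]
    show "(\<lambda>x. rank_vector n (\<lambda>i. x (i, j))) \<in> measurable (Pi\<^sub>M ({1..n} \<times> {j}) (\<lambda>_. borel)) (count_space (rank_vectors n))"
      by (simp only: rank_vector_restrict)
  qed
  thus "M.indep_vars (\<lambda>_. count_space (rank_vectors n)) (\<lambda>j \<omega>. rank_vector n (\<lambda>i. S i \<omega> j)) {1..d}"
    by (simp only: col[symmetric])
  fix j assume j: "j \<in> {1..d}"
  show "uniform_variable M (rank_vectors n) {p. p permutes {1..n}} (\<lambda>\<omega>. rank_vector n (\<lambda>i. S i \<omega> j))"
  proof (rule M.uniform_rank_vector[OF n])
    have "M.indep_vars (\<lambda>_. borel) (\<lambda>i \<omega>. (\<lambda>x. x j) (S i \<omega>)) {1..n}"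
      by (rule M.indep_vars_compose2[OF S_ind]) (rule measurable_component_singleton[OF j])
    thus "M.indep_vars (\<lambda>_. borel) (\<lambda>i \<omega>. S i \<omega> j) {1..n}" by simp
    show "distr M borel (\<lambda>\<omega>. S i \<omega> j) = distr N borel (\<lambda>\<omega>. X \<omega> j)" if i: "i \<in> {1..n}" for i
    proof (rule measure_eqI)
      fix A assume "A \<in> sets (distr M borel (\<lambda>\<omega>. S i \<omega> j))"
      hence A: "A \<in> sets borel" by simp
      show "emeasure (distr M borel (\<lambda>\<omega>. S i \<omega> j)) A = emeasure (distr N borel (\<lambda>\<omega>. X \<omega> j)) A"
        using entry_law[OF i j A] entry[OF i j] Xj[OF j] A
        by (simp add: emeasure_distr M.emeasure_eq_measure N.emeasure_eq_measure)
    qed simp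
    show "M.prob {\<omega>\<in>space M. S i \<omega> j = x} = 0" if i: "i \<in> {1..n}" for i x
    proof -
      have "M.prob ((\<lambda>\<omega>. S i \<omega> j) -` {x} \<inter> space M) = N.prob ((\<lambda>\<omega>. X \<omega> j) -` {x} \<inter> space N)"
        by (rule entry_law[OF i j]) simp
      moreover have "(\<lambda>\<omega>. S i \<omega> j) -` {x} \<inter> space M = {\<omega>\<in>space M. S i \<omega> j = x}"
        "(\<lambda>\<omega>. X \<omega> j) -` {x} \<inter> space N = {\<omega>\<in>space N. X \<omega> j = x}" by auto
      ultimately show ?thesis using X j by (simp add: continuous_random_vector_def)
    qed
  qed
qed

section \<open>Rank statistics as functions of the relative permutation\<close>

text \<open>
  The rank statistic in terms of the two rank vectors. Like the original one it is a total function, so that the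
  identification with it holds also where there are ties.
\<close>

definition pair_stat :: "nat \<Rightarrow> (nat \<Rightarrow> real) \<Rightarrow> (real \<Rightarrow> real) \<Rightarrow> (nat \<Rightarrow> nat) \<Rightarrow> (nat \<Rightarrow> nat) \<Rightarrow> real" where
  "pair_stat n c g p q =
     (\<Sum>i=1..n. c i * g (real (THE r. \<exists>i'\<in>{1..n}. p i' = i \<and> r = q i') / (real n + 1)))"

definition score_stat :: "nat \<Rightarrow> (nat \<Rightarrow> real) \<Rightarrow> (real \<Rightarrow> real) \<Rightarrow> (nat \<Rightarrow> nat) \<Rightarrow> real" where
  "score_stat n c g p = (\<Sum>i=1..n. c i * g (real (p i) / (real n + 1)))"

text \<open>
  The identity holds at every sample point, which makes the statistic measurable.
\<close>

lemma rank_stat_eq_pair_stat: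
  "rank_stat n c g S j k \<omega> = pair_stat n c g (rank_vector n (\<lambda>l. S l \<omega> j)) (rank_vector n (\<lambda>l. S l \<omega> k))"
proof -
  have "(\<exists>i'\<in>{1..n}. rank_of n x i' = i \<and> r = rank_of n y i')
      \<longleftrightarrow> (\<exists>i'\<in>{1..n}. rank_vector n x i' = i \<and> r = rank_vector n y i')" for x y :: "nat \<Rightarrow> real" and i r
    by (auto simp: rank_vector_def)
  thus ?thesis by (simp only: rank_stat_def pair_stat_def relative_rank_def)
qed

lemma pair_stat_permutes:
  assumes p: "p permutes {1..n}"
  shows "pair_stat n c g p q = score_stat n c g (q \<circ> inv p)"
  unfolding pair_stat_def score_stat_def
proof (intro sum.cong refl)
  fix i assume i: "i \<in> {1..n}"
  have "(THE r. \<exists>i'\<in>{1..n}. p i' = i \<and> r = q i') = q (inv p i)"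
  proof (rule the_equality)
    show "\<exists>i'\<in>{1..n}. p i' = i \<and> q (inv p i) = q i'"
      using permutes_in_image[OF permutes_inv[OF p], of i] i permutes_inverses(1)[OF p] by blast
    show "r = q (inv p i)" if "\<exists>i'\<in>{1..n}. p i' = i \<and> r = q i'" for r
      using that permutes_inverses(2)[OF p] by auto
  qed
  thus "c i * g (real (THE r. \<exists>i'\<in>{1..n}. p i' = i \<and> r = q i') / (real n + 1))
      = c i * g (real ((q \<circ> inv p) i) / (real n + 1))" by simp
qed

lemma bij_betw_compose_inv:
  assumes p: "p permutes S"
  shows "bij_betw (\<lambda>q. q \<circ> inv p) {q. q permutes S} {q. q permutes S}"
    and "bij_betw (\<lambda>q. p \<circ> inv q) {q. q permutes S} {q. q permutes S}"
proof -
  show "bij_betw (\<lambda>q. q \<circ> inv p) {q. q permutes S} {q. q permutes S}"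
  proof (rule bij_betw_byWitness[where f'="\<lambda>q. q \<circ> p"])
    show "\<forall>q\<in>{q. q permutes S}. (q \<circ> inv p) \<circ> p = q"
      using permutes_inv_o(2)[OF p] by (simp add: comp_assoc)
    show "\<forall>q\<in>{q. q permutes S}. (q \<circ> p) \<circ> inv p = q"
      using permutes_inv_o(1)[OF p] by (simp add: comp_assoc)
  qed (use permutes_compose p permutes_inv in blast)+
  show "bij_betw (\<lambda>q. p \<circ> inv q) {q. q permutes S} {q. q permutes S}"
  proof (rule bij_betw_byWitness[where f'="\<lambda>q. inv q \<circ> p"])
    have *: "inv (p \<circ> inv q) = q \<circ> inv p" "inv (inv q \<circ> p) = inv p \<circ> q" if "q permutes S" for q
      using permutes_bij[OF p] permutes_bij[OF that] permutes_bij[OF permutes_inv[OF that]]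
      by (simp_all add: o_inv_distrib permutes_inv_inv[OF that])
    show "\<forall>q\<in>{q. q permutes S}. inv (p \<circ> inv q) \<circ> p = q"
      using * permutes_inv_o(2)[OF p] by (simp add: comp_assoc)
    show "\<forall>q\<in>{q. q permutes S}. p \<circ> inv (inv q \<circ> p) = q"
      using * permutes_inv_o(1)[OF p] by (simp add: comp_assoc[symmetric])
  qed (use permutes_compose p permutes_inv in blast)+
qed

text \<open>
  Both \<open>q \<mapsto> q \<circ> inv p\<close> and \<open>p \<mapsto> q \<circ> inv p\<close> permute the set of permutations.
\<close>

lemma card_pair_stat:
  fixes B :: "real \<Rightarrow> bool"
  shows "p permutes {1..n} \<Longrightarrow> card {q\<in>{q. q permutes {1..n}}. B (pair_stat n c g p q)}
           = card {\<pi>. \<pi> permutes {1..n} \<and> B (score_stat n c g \<pi>)}"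
    and "q permutes {1..n} \<Longrightarrow> card {p\<in>{p. p permutes {1..n}}. B (pair_stat n c g p q)}
           = card {\<pi>. \<pi> permutes {1..n} \<and> B (score_stat n c g \<pi>)}"
proof -
  have count: "card {q\<in>P. D (f q)} = card {q\<in>P. D q}" if "bij_betw f P P" for f and P :: "(nat \<Rightarrow> nat) set" and D
  proof -
    have "bij_betw f {q\<in>P. D (f q)} {q\<in>P. D q}"
      using that by (rule bij_betw_subset) (use that in \<open>auto simp: bij_betw_def\<close>)
    thus ?thesis by (rule bij_betw_same_card)
  qed
  show "card {q\<in>{q. q permutes {1..n}}. B (pair_stat n c g p q)}
           = card {\<pi>. \<pi> permutes {1..n} \<and> B (score_stat n c g \<pi>)}" if p: "p permutes {1..n}"
    using count[OF bij_betw_compose_inv(1)[OF p], of "\<lambda>\<pi>. B (score_stat n c g \<pi>)"]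
    by (simp add: pair_stat_permutes[OF p])
  show "card {p\<in>{p. p permutes {1..n}}. B (pair_stat n c g p q)}
           = card {\<pi>. \<pi> permutes {1..n} \<and> B (score_stat n c g \<pi>)}" if q: "q permutes {1..n}"
    using count[OF bij_betw_compose_inv(2)[OF q], of "\<lambda>\<pi>. B (score_stat n c g \<pi>)"]
    by (simp add: pair_stat_permutes cong: conj_cong)
qed

text \<open>
  For independent uniform \<open>p\<close> and \<open>q\<close>, the permutation \<open>q \<circ> inv p\<close> is uniform.
\<close>

lemma (in prob_space) expectation_pair_stat:
  fixes f :: "real \<Rightarrow> real"
  assumes ind: "indep_vars (\<lambda>_. count_space (rank_vectors n)) Q I"
    and unif: "\<And>j. j \<in> I \<Longrightarrow> uniform_variable M (rank_vectors n) {p. p permutes {1..n}} (Q j)"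
    and jk: "j \<in> I" "k \<in> I" "j \<noteq> k"
  shows "expectation (\<lambda>\<omega>. f (pair_stat n c g (Q j \<omega>) (Q k \<omega>)))
           = (\<Sum>\<pi> | \<pi> permutes {1..n}. f (score_stat n c g \<pi>)) / fact n"
proof -
  let ?P = "{p. p permutes {1..n}}" and ?F = "rank_vectors n"
  have card: "card ?P = fact n" by (simp add: card_permutations[OF refl])
  have Qm: "Q i \<in> measurable M (count_space ?F)" if "i \<in> I" for i
    using ind that by (auto simp: indep_vars_def)
  have "uniform_variable M (?F \<times> ?F) (?P \<times> ?P) (\<lambda>\<omega>. (Q j \<omega>, Q k \<omega>))"
    unfolding uniform_variable_def
  proof (intro conjI ballI)
    have "(\<lambda>\<omega>. (Q j \<omega>, Q k \<omega>)) \<in> measurable M (count_space ?F \<Otimes>\<^sub>M count_space ?F)"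
      using Qm jk by (intro measurable_Pair) auto
    thus "(\<lambda>\<omega>. (Q j \<omega>, Q k \<omega>)) \<in> measurable M (count_space (?F \<times> ?F))"
      by (simp add: pair_measure_countable countable_finite)
    show "?P \<times> ?P \<subseteq> ?F \<times> ?F" using permutations_subset_rank_vectors by (intro Sigma_mono)
    show "?P \<times> ?P \<noteq> {}" using permutes_id by blast
    fix y assume "y \<in> ?P \<times> ?P"
    then obtain p q where y: "y = (p, q)" "p \<in> ?P" "q \<in> ?P" by auto
    have "prob {\<omega>\<in>space M. \<forall>i\<in>{j, k}. Q i \<omega> = (if i = j then p else q)}
        = (\<Prod>i\<in>{j, k}. prob {\<omega>\<in>space M. Q i \<omega> = (if i = j then p else q)})"
      using indep_vars_finite_range_prob[OF ind, of "{j, k}" "\<lambda>i x. x = (if i = j then p else q)"] jk by simp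
    moreover have "prob {\<omega>\<in>space M. Q i \<omega> = x} = 1 / fact n" if "i \<in> I" "x \<in> ?P" for i x
      using unif[OF that(1)] that(2) by (simp add: uniform_variable_def card)
    moreover have "{\<omega>\<in>space M. \<forall>i\<in>{j, k}. Q i \<omega> = (if i = j then p else q)} = {\<omega>\<in>space M. (Q j \<omega>, Q k \<omega>) = y}"
      using jk y by auto
    ultimately show "prob {\<omega>\<in>space M. (Q j \<omega>, Q k \<omega>) = y} = 1 / card (?P \<times> ?P)"
      using jk y by (simp add: card_cartesian_product card)
  qed simp
  from uniform_variable_expectation[OF this, of "\<lambda>(p, q). f (pair_stat n c g p q)"]
  have "expectation (\<lambda>\<omega>. f (pair_stat n c g (Q j \<omega>) (Q k \<omega>)))
      = (\<Sum>(p, q)\<in>?P \<times> ?P. f (pair_stat n c g p q)) / (fact n * fact n)"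
    by (simp add: card_cartesian_product card)
  also have "(\<Sum>(p, q)\<in>?P \<times> ?P. f (pair_stat n c g p q)) = (\<Sum>p\<in>?P. \<Sum>q\<in>?P. f (pair_stat n c g p q))"
    by (rule sum.cartesian_product[symmetric])
  also have "\<dots> = (\<Sum>p\<in>?P. \<Sum>\<pi>\<in>?P. f (score_stat n c g \<pi>))"
  proof (rule sum.cong[OF refl])
    fix p assume "p \<in> ?P"
    hence p: "p permutes {1..n}" by simp
    show "(\<Sum>q\<in>?P. f (pair_stat n c g p q)) = (\<Sum>\<pi>\<in>?P. f (score_stat n c g \<pi>))"
      using sum.reindex_bij_betw[OF bij_betw_compose_inv(1)[OF p], of "\<lambda>\<pi>. f (score_stat n c g \<pi>)"]
      by (simp add: pair_stat_permutes[OF p])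
  qed
  finally show ?thesis by (simp add: card)
qed

section \<open>Scores and thresholds\<close>

text \<open>
  A number \<open>m\<close> cannot be close to both \<open>g u\<close> and \<open>g v\<close>. By continuity \<open>g\<close> stays away from \<open>m\<close> on an
  interval next to one of these points, and a positive fraction of the grid lies in that interval.
\<close>

lemma score_variation_lower_bound:
  fixes g :: "real \<Rightarrow> real"
  assumes lip: "B-lipschitz_on {0<..<1} g" and u: "u \<in> {0<..<1}" and v: "v \<in> {0<..<1}" and uv: "g u \<noteq> g v"
  obtains \<beta> where "\<beta> > 0" "\<forall>\<^sub>F n in sequentially. \<forall>m. \<beta> * real n \<le> (\<Sum>i=1..n. (g (real i / (real n + 1)) - m)\<^sup>2)"
proof -
  define \<delta> where "\<delta> = \<bar>g u - g v\<bar> / 4"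
  have \<delta>: "\<delta> > 0" using uv by (simp add: \<delta>_def)
  have B: "B \<ge> 0" using lip by (rule lipschitz_on_nonneg)
  define \<rho> where "\<rho> = Min {\<delta> / (B + 1), (1 - u) / 2, (1 - v) / 2}"
  have \<rho>: "\<rho> > 0" "\<rho> \<le> \<delta> / (B + 1)" "\<rho> < 1 - u" "\<rho> < 1 - v"
  proof -
    show "\<rho> > 0" using \<delta> B u v by (simp add: \<rho>_def)
    show "\<rho> \<le> \<delta> / (B + 1)" unfolding \<rho>_def by (rule Min_le) auto
    have "\<rho> \<le> (1 - u) / 2" "\<rho> \<le> (1 - v) / 2" unfolding \<rho>_def by (rule Min_le; simp)+
    thus "\<rho> < 1 - u" "\<rho> < 1 - v" using u v by auto
  qed
  have B\<rho>: "B * \<rho> \<le> \<delta>"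
  proof -
    have "B * \<rho> \<le> B * (\<delta> / (B + 1))" using \<rho> B by (intro mult_left_mono) auto
    also have "\<dots> \<le> \<delta>" using B \<delta> by (simp add: field_simps)
    finally show ?thesis .
  qed
  have near: "\<bar>g x - g w\<bar> \<le> \<delta>" if "w \<in> {0<..<1}" "x \<in> {0<..<1}" "\<bar>x - w\<bar> \<le> \<rho>" for x w
  proof -
    have "\<bar>g x - g w\<bar> \<le> B * \<bar>x - w\<bar>" using lipschitz_onD[OF lip that(2,1)] by (simp add: dist_real_def)
    also have "\<dots> \<le> B * \<rho>" using that B by (intro mult_left_mono) auto
    finally show ?thesis using B\<rho> by linarith
  qed
  show ?thesis
  proof (rule that[of "\<rho> * \<delta>\<^sup>2 / 2"])
    show "\<rho> * \<delta>\<^sup>2 / 2 > 0" using \<rho> \<delta> by simp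
    have "filterlim (\<lambda>n. \<rho> / 2 * real n) at_top sequentially"
      using \<rho> by (intro filterlim_tendsto_pos_mult_at_top[OF tendsto_const _ filterlim_real_sequentially]) auto
    hence "\<forall>\<^sub>F n in sequentially. \<rho> / 2 * real n \<ge> 1" unfolding filterlim_at_top by blast
    thus "\<forall>\<^sub>F n in sequentially. \<forall>m. \<rho> * \<delta>\<^sup>2 / 2 * real n \<le> (\<Sum>i=1..n. (g (real i / (real n + 1)) - m)\<^sup>2)"
    proof eventually_elim
      case (elim n)
      show ?case
      proof
        fix m
        \<comment> \<open>\<open>w\<close> is the point at which \<open>g\<close> is far from \<open>m\<close>; the grid points just to the right of \<open>w\<close> are used.\<close>
        obtain w where w: "w \<in> {u, v}" "\<bar>m - g w\<bar> \<ge> 2 * \<delta>"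
        proof (cases "\<bar>m - g u\<bar> \<ge> 2 * \<delta>")
          case False
          moreover have "\<bar>g u - g v\<bar> \<le> \<bar>m - g u\<bar> + \<bar>m - g v\<bar>" by linarith
          moreover have "\<bar>g u - g v\<bar> = 4 * \<delta>" by (simp add: \<delta>_def)
          ultimately have "\<bar>m - g v\<bar> \<ge> 2 * \<delta>" by linarith
          thus ?thesis using that by blast
        qed (use that in blast)
        have w01: "w \<in> {0<..<1}" "\<rho> < 1 - w" using w u v \<rho> by auto
        define k where "k = nat \<lfloor>(real n + 1) * w\<rfloor>"
        define L where "L = nat \<lfloor>(real n + 1) * \<rho>\<rfloor>"
        have kw: "real k \<le> (real n + 1) * w" "(real n + 1) * w < real k + 1"
          using w01 by (auto simp: k_def)
        have L: "real L \<le> (real n + 1) * \<rho>" "(real n + 1) * \<rho> < real L + 1"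
          using \<rho> by (auto simp: L_def)
        have in01: "\<bar>g (real i / (real n + 1)) - g w\<bar> \<le> \<delta>" "i \<in> {1..n}" if i: "i \<in> {k+1..k+L}" for i
        proof -
          have i1: "real i > (real n + 1) * w" using i kw by simp
          have "real i \<le> real k + real L" using i by simp
          hence i2: "real i \<le> (real n + 1) * (w + \<rho>)" using kw L by (simp add: ring_distribs)
          have q1: "real i / (real n + 1) > w" using i1 by (simp add: field_simps)
          have q2: "real i / (real n + 1) \<le> w + \<rho>" using i2 by (simp add: field_simps)
          have lt1: "real i / (real n + 1) < 1" using q2 w01 by linarith
          show "\<bar>g (real i / (real n + 1)) - g w\<bar> \<le> \<delta>"
            using q1 q2 lt1 w01 by (intro near) auto
          have "real i < real n + 1" using lt1 by simp
          hence "i \<le> n" by linarith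
          thus "i \<in> {1..n}" using i by auto
        qed
        have "\<rho> * \<delta>\<^sup>2 / 2 * real n = (\<rho> / 2 * real n) * \<delta>\<^sup>2" by simp
        also have "\<dots> \<le> real L * \<delta>\<^sup>2"
        proof (intro mult_right_mono)
          have "(real n + 1) * \<rho> \<ge> \<rho> / 2 * real n + \<rho> / 2 * real n" using \<rho> by (simp add: ring_distribs)
          thus "\<rho> / 2 * real n \<le> real L" using L elim by linarith
        qed auto
        also have "\<dots> = (\<Sum>i\<in>{k+1..k+L}. \<delta>\<^sup>2)" by simp
        also have "\<dots> \<le> (\<Sum>i\<in>{k+1..k+L}. (g (real i / (real n + 1)) - m)\<^sup>2)"
        proof (rule sum_mono)
          fix i assume i: "i \<in> {k+1..k+L}"
          have "\<bar>g (real i / (real n + 1)) - m\<bar> \<ge> \<delta>" using in01(1)[OF i] w(2) by linarith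
          hence "\<bar>\<delta>\<bar> \<le> \<bar>g (real i / (real n + 1)) - m\<bar>" using \<delta> by simp
          thus "\<delta>\<^sup>2 \<le> (g (real i / (real n + 1)) - m)\<^sup>2" by (simp only: abs_le_square_iff)
        qed
        also have "\<dots> \<le> (\<Sum>i\<in>{1..n}. (g (real i / (real n + 1)) - m)\<^sup>2)"
          using in01(2) by (intro sum_mono2) auto
        finally show "\<rho> * \<delta>\<^sup>2 / 2 * real n \<le> (\<Sum>i=1..n. (g (real i / (real n + 1)) - m)\<^sup>2)" .
      qed
    qed
  qed
qed

lemma sum_centred: "n \<ge> 1 \<Longrightarrow> (\<Sum>i=1..n. f i - mean_upto n f) = 0"
  by (simp add: sum_subtractf mean_upto_def)

lemma score_stat_centred:
  fixes c :: "nat \<Rightarrow> real" and g :: "real \<Rightarrow> real"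
  assumes n: "n \<ge> 1" and p: "p permutes {1..n}"
  defines "a \<equiv> \<lambda>i. c i - mean_upto n c" and "b \<equiv> \<lambda>i. g (real i / (real n + 1)) - mean_upto n (\<lambda>i. g (real i / (real n + 1)))"
  shows "score_stat n c g p = (\<Sum>i=1..n. a i * b (p i)) + real n * mean_upto n c * mean_upto n (\<lambda>i. g (real i / (real n + 1)))"
proof -
  let ?m = "mean_upto n c" and ?h = "mean_upto n (\<lambda>i. g (real i / (real n + 1)))"
  have b: "(\<Sum>i=1..n. b (p i)) = 0"
    using sum.permute[OF p, of b] sum_centred[OF n] by (simp add: b_def comp_def)
  have a: "(\<Sum>i=1..n. a i) = 0" unfolding a_def by (rule sum_centred[OF n])
  have "score_stat n c g p = (\<Sum>i=1..n. a i * b (p i) + ?m * b (p i) + ?h * a i + ?m * ?h)"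
    unfolding score_stat_def a_def b_def by (intro sum.cong refl) (simp add: algebra_simps)
  also have "\<dots> = (\<Sum>i=1..n. a i * b (p i)) + ?m * (\<Sum>i=1..n. b (p i)) + ?h * (\<Sum>i=1..n. a i) + real n * (?m * ?h)"
    by (simp add: sum.distrib sum_distrib_left)
  finally show ?thesis by (simp add: a b)
qed

text \<open>
  The threshold is made for \<open>d\<^sup>2 exp (- t\<^sup>2 / 2) / t\<close> to converge: the term \<open>- log log d\<close> offsets the factor
  \<open>1 / t\<close>, which has order \<open>(log d)\<^bsup>-1/2\<^esup>\<close>.
\<close>

lemma poisson_rate_limit:
  fixes y :: real and d :: "nat \<Rightarrow> nat"
  assumes d: "filterlim d at_top sequentially"
    and t: "\<And>n. t n = sqrt (4 * ln (real (d n)) - ln (ln (real (d n))) + y)"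
    and \<pi>: "(\<lambda>n. t n * sqrt (2 * pi) * exp ((t n)\<^sup>2 / 2) * \<pi> n) \<longlonglongrightarrow> 2"
  shows "(\<lambda>n. real (d n) * (real (d n) - 1) / 2 * \<pi> n) \<longlonglongrightarrow> (8 * pi) powr (-1/2) * exp (- y / 2)"
proof -
  define f where "f = (\<lambda>x. x * (x - 1) / 2 / (sqrt (4 * ln x - ln (ln x) + y) * sqrt (2 * pi) * exp ((4 * ln x - ln (ln x) + y) / 2)))"
  have dr: "filterlim (\<lambda>n. real (d n)) at_top sequentially"
    by (rule filterlim_compose[OF filterlim_real_sequentially d])
  have "(f \<longlongrightarrow> inverse (root 2 (2 * pi)) * inverse (exp (y / 2)) / 4) at_top"
    unfolding f_def by real_asymp
  also have "inverse (root 2 (2 * pi)) * inverse (exp (y / 2)) / 4 = exp (- y / 2) / (4 * sqrt (2 * pi))"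
  proof -
    have "exp (- y / 2) = inverse (exp (y / 2))" by (simp add: exp_minus[symmetric])
    thus ?thesis by (simp only: sqrt_def divide_inverse inverse_mult_distrib mult_ac)
  qed
  finally have "(f \<longlongrightarrow> exp (- y / 2) / (4 * sqrt (2 * pi))) at_top" .
  hence lim: "(\<lambda>n. f (real (d n))) \<longlonglongrightarrow> exp (- y / 2) / (4 * sqrt (2 * pi))"
    using dr by (rule filterlim_compose)
  have pos: "\<forall>\<^sub>F x in at_top. 4 * ln x - ln (ln x) + y > (0::real)" by real_asymp
  have ev: "\<forall>\<^sub>F n in sequentially. 4 * ln (real (d n)) - ln (ln (real (d n))) + y > 0"
    using eventually_compose_filterlim[OF pos dr] .
  have "(\<lambda>n. f (real (d n)) * (t n * sqrt (2 * pi) * exp ((t n)\<^sup>2 / 2) * \<pi> n)) \<longlonglongrightarrow> exp (- y / 2) / (4 * sqrt (2 * pi)) * 2"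
    by (rule tendsto_mult[OF lim \<pi>])
  also have "exp (- y / 2) / (4 * sqrt (2 * pi)) * 2 = (8 * pi) powr (-1/2) * exp (- y / 2)"
  proof -
    have "(8 * pi) powr (-1/2) = (8 * pi) powr (- (1/2))" by (rule arg_cong[where f="\<lambda>x. (8 * pi) powr x"]) simp
    also have "\<dots> = inverse ((8 * pi) powr (1/2))" by (rule powr_minus)
    also have "(8 * pi) powr (1/2) = sqrt (4 * (2 * pi))" by (subst powr_half_sqrt) (simp_all only: mult.assoc[symmetric], simp_all)
    also have "\<dots> = sqrt 4 * sqrt (2 * pi)" by (rule real_sqrt_mult)
    also have "sqrt 4 = (2::real)" by (rule real_sqrt_four)
    finally have eq: "(8 * pi) powr (-1/2) = inverse (2 * sqrt (2 * pi))" .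
    have fl: "x / (4 * s) * 2 = inverse (2 * s) * x" if "s > 0" for x s :: real
      using that by (simp add: field_simps)
    show ?thesis unfolding eq by (rule fl) simp
  qed
  finally show ?thesis
  proof (rule Lim_transform_eventually)
    show "\<forall>\<^sub>F n in sequentially. f (real (d n)) * (t n * sqrt (2 * pi) * exp ((t n)\<^sup>2 / 2) * \<pi> n) = real (d n) * (real (d n) - 1) / 2 * \<pi> n"
      using ev
    proof eventually_elim
      case (elim n)
      let ?\<tau> = "4 * ln (real (d n)) - ln (ln (real (d n))) + y"
      have t2: "(t n)\<^sup>2 = ?\<tau>" using elim by (simp add: t)
      have "sqrt ?\<tau> * sqrt (2 * pi) * exp (?\<tau> / 2) \<noteq> 0" using elim by simp
      thus ?case unfolding t2 unfolding t f_def by simp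
    qed
  qed
qed

text \<open>
  Since \<open>t\<^sup>2 \<sim> 4 log d\<close>, the condition \<open>log d = o(n\<^bsup>1/3\<^esup>)\<close> says \<open>t = o(n\<^bsup>1/6\<^esup>)\<close>.
\<close>

lemma threshold_growth:
  fixes y :: real and d :: "nat \<Rightarrow> nat"
  assumes d: "filterlim d at_top sequentially"
    and log_d: "(\<lambda>n. ln (real (d n))) \<in> o(\<lambda>n. real n powr (1/3))"
    and t: "\<And>n. t n = sqrt (4 * ln (real (d n)) - ln (ln (real (d n))) + y)"
  shows "filterlim t at_top sequentially" and "(\<lambda>n. t n ^ 3 / sqrt n) \<longlonglongrightarrow> 0"
proof -
  have dr: "filterlim (\<lambda>n. real (d n)) at_top sequentially"
    by (rule filterlim_compose[OF filterlim_real_sequentially d])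
  have "filterlim (\<lambda>x. sqrt (4 * ln x - ln (ln x) + y)) at_top at_top" by real_asymp
  thus "filterlim t at_top sequentially"
    using filterlim_compose[OF _ dr] by (simp add: t[abs_def])
  have pos: "\<forall>\<^sub>F x in at_top. 4 * ln x - ln (ln x) + y > (0::real)" by real_asymp
  have ev: "\<forall>\<^sub>F n in sequentially. 4 * ln (real (d n)) - ln (ln (real (d n))) + y > 0"
    using eventually_compose_filterlim[OF pos dr] .
  have "((\<lambda>x. (4 * ln x - ln (ln x) + y) / ln x) \<longlongrightarrow> 4) at_top" by real_asymp
  from filterlim_compose[OF this dr]
  have r: "(\<lambda>n. (4 * ln (real (d n)) - ln (ln (real (d n))) + y) / ln (real (d n))) \<longlonglongrightarrow> 4" .
  have ln_pos: "\<forall>\<^sub>F n in sequentially. ln (real (d n)) > 0"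
  proof -
    have "\<forall>\<^sub>F x in at_top. ln x > (0::real)" by real_asymp
    from eventually_compose_filterlim[OF this dr] show ?thesis .
  qed
  have l: "(\<lambda>n. ln (real (d n)) / real n powr (1/3)) \<longlonglongrightarrow> 0"
    using log_d by (rule smalloD_tendsto)
  have "(\<lambda>n. (4 * ln (real (d n)) - ln (ln (real (d n))) + y) / ln (real (d n)) * (ln (real (d n)) / real n powr (1/3))) \<longlonglongrightarrow> 4 * 0"
    by (rule tendsto_mult[OF r l])
  from tendsto_real_sqrt[OF tendsto_power[OF this, of 3]]
  have "(\<lambda>n. sqrt (((4 * ln (real (d n)) - ln (ln (real (d n))) + y) / ln (real (d n)) * (ln (real (d n)) / real n powr (1/3))) ^ 3)) \<longlonglongrightarrow> 0"
    by simp
  thus "(\<lambda>n. t n ^ 3 / sqrt n) \<longlonglongrightarrow> 0"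
  proof (rule Lim_transform_eventually)
    show "\<forall>\<^sub>F n in sequentially. sqrt (((4 * ln (real (d n)) - ln (ln (real (d n))) + y) / ln (real (d n)) * (ln (real (d n)) / real n powr (1/3))) ^ 3) = t n ^ 3 / sqrt n"
      using ev ln_pos eventually_gt_at_top[of 0]
    proof eventually_elim
      case (elim n)
      have n3: "(real n powr (1/3)) ^ 3 = real n" using elim(3) by (simp add: powr_power)
      show ?case using elim
        by (simp add: t power_divide real_sqrt_divide real_sqrt_power n3)
    qed
  qed
qed

section \<open>The limiting distribution of the maximum\<close>

lemma score_stat_moments:
  fixes c :: "nat \<Rightarrow> real" and g :: "real \<Rightarrow> real"
  assumes n: "n \<ge> 2"
  defines "s \<equiv> \<lambda>i. g (real i / (real n + 1))"
  defines "\<mu> \<equiv> real n * mean_upto n c * mean_upto n s"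
  shows "(\<Sum>p | p permutes {1..n}. score_stat n c g p) / fact n = \<mu>"
    and "(\<Sum>p | p permutes {1..n}. (score_stat n c g p - \<mu>)\<^sup>2) / fact n
          = (\<Sum>i=1..n. (c i - mean_upto n c)\<^sup>2) * (\<Sum>i=1..n. (s i - mean_upto n s)\<^sup>2) / (n - 1)"
proof -
  let ?P = "{p. p permutes {1..n}}"
  define a where "a = (\<lambda>i. c i - mean_upto n c)"
  define b where "b = (\<lambda>i. s i - mean_upto n s)"
  have n1: "n \<ge> 1" using n by simp
  have a: "(\<Sum>i=1..n. a i) = 0" and b: "(\<Sum>i=1..n. b i) = 0"
    unfolding a_def b_def by (rule sum_centred[OF n1])+
  have centred: "score_stat n c g p - \<mu> = (\<Sum>i=1..n. a i * b (p i))" if "p \<in> ?P" for p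
    using score_stat_centred[OF n1, of p c g] that by (simp add: a_def b_def s_def \<mu>_def)
  note moments = permutation_statistic_moments[OF n a b]
  have "(\<Sum>p\<in>?P. score_stat n c g p - \<mu>) = 0"
    using moments(1) by (simp only: sum.cong[OF refl centred])
  hence "(\<Sum>p\<in>?P. score_stat n c g p) = fact n * \<mu>"
    by (simp add: sum_subtractf card_permutations[OF refl])
  thus "(\<Sum>p\<in>?P. score_stat n c g p) / fact n = \<mu>" by simp
  have "(\<Sum>p\<in>?P. (score_stat n c g p - \<mu>)\<^sup>2) = (\<Sum>p\<in>?P. (\<Sum>i=1..n. a i * b (p i))\<^sup>2)"
    by (rule sum.cong[OF refl]) (simp only: centred)
  thus "(\<Sum>p\<in>?P. (score_stat n c g p - \<mu>)\<^sup>2) / fact n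
      = (\<Sum>i=1..n. (c i - mean_upto n c)\<^sup>2) * (\<Sum>i=1..n. (s i - mean_upto n s)\<^sup>2) / (n - 1)"
    using moments(2) by (simp add: a_def b_def)
qed

text \<open>
  The deviation from the mean is an average of differences.
\<close>

lemma abs_centred_le:
  assumes n: "n \<ge> 1" and close: "\<And>i j. i \<in> {1..n} \<Longrightarrow> j \<in> {1..n} \<Longrightarrow> \<bar>f i - f j\<bar> \<le> B" and j: "j \<in> {1..n}"
  shows "\<bar>f j - mean_upto n f\<bar> \<le> B"
proof -
  have "real n * (f j - mean_upto n f) = (\<Sum>i=1..n. f j - f i)"
    using n by (simp add: mean_upto_def sum_subtractf right_diff_distrib)
  also have "\<bar>\<dots>\<bar> \<le> (\<Sum>i=1..n. B)" by (rule order_trans[OF sum_abs sum_mono]) (use close j in auto)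
  finally have "real n * \<bar>f j - mean_upto n f\<bar> \<le> real n * B" by (simp add: abs_mult)
  thus ?thesis using n by simp
qed

theorem theorem1:
  fixes N :: "nat \<Rightarrow> 'b measure" and X :: "nat \<Rightarrow> 'b \<Rightarrow> nat \<Rightarrow> real"
    and M :: "nat \<Rightarrow> 'a measure" and S :: "nat \<Rightarrow> nat \<Rightarrow> 'a \<Rightarrow> nat \<Rightarrow> real"
    and d :: "nat \<Rightarrow> nat" and c :: "nat \<Rightarrow> nat \<Rightarrow> real" and g :: "real \<Rightarrow> real"
    and C1 C2 y :: real
  assumes X: "\<And>n. continuous_random_vector (N n) (d n) (X n)"
    and copies: "\<And>n. independent_copies (M n) n (d n) (S n) (N n) (X n)"
    and H0: "\<And>n. independent_components (N n) (d n) (X n)"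
    and d_infinity: "filterlim d at_top sequentially"
    and log_d: "(\<lambda>n. ln (real (d n))) \<in> o(\<lambda>n. real n powr (1/3))"
    and c_nonzero: "\<And>n. n \<ge> 1 \<Longrightarrow> (\<Sum>i=1..n. (c n i)\<^sup>2) > 0"
    and c_max: "\<And>n. n \<ge> 1 \<Longrightarrow>
      (MAX i\<in>{1..n}. \<bar>c n i - mean_upto n (c n)\<bar>\<^sup>2)
        \<le> C1\<^sup>2 / real n * (\<Sum>i=1..n. (c n i - mean_upto n (c n))\<^sup>2)"
    and c_cubes: "\<And>n. n \<ge> 1 \<Longrightarrow>
      \<bar>\<Sum>i=1..n. (c n i - mean_upto n (c n)) ^ 3\<bar>\<^sup>2
        \<le> C2\<^sup>2 / real n * (\<Sum>i=1..n. (c n i - mean_upto n (c n))\<^sup>2) ^ 3"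
    and g_differentiable: "g differentiable_on {0<..<1}"
    and g_lipschitz: "\<exists>B. B-lipschitz_on {0<..<1} g"
    and sigma_pos: "\<forall>\<^sub>F n in sequentially. sigma_V_sq (M n) n (c n) g (S n) > 0"
  shows "(\<lambda>n. \<bar>measure (M n) {\<omega> \<in> space (M n).
              real n * (max_rank_stat (M n) n (d n) (c n) g (S n) \<omega>)\<^sup>2
                / sigma_V_sq (M n) n (c n) g (S n)
                - 4 * ln (real (d n)) + ln (ln (real (d n))) \<le> y}
            - exp (- ((8 * pi) powr (-1/2) * exp (- y / 2)))\<bar>) \<longlonglongrightarrow> 0"
proof -
  define a where "a = (\<lambda>n i. c n i - mean_upto n (c n))"
  define s where "s = (\<lambda>n i. g (real i / (real n + 1)))"
  define b where "b = (\<lambda>n i. s n i - mean_upto n (s n))"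
  define \<mu> where "\<mu> = (\<lambda>n. real n * mean_upto n (c n) * mean_upto n (s n))"
  define A where "A = (\<lambda>n. \<Sum>i=1..n. (a n i)\<^sup>2)"
  define B where "B = (\<lambda>n. \<Sum>i=1..n. (b n i)\<^sup>2)"
  define V where "V = (\<lambda>n. A n * B n / real (n - 1))"
  define Q where "Q = (\<lambda>n j \<omega>. rank_vector n (\<lambda>i. S n i \<omega> j))"
  define t where "t = (\<lambda>n. sqrt (4 * ln (real (d n)) - ln (ln (real (d n))) + y))"
  let ?P = "\<lambda>n::nat. {p. p permutes {1..n}}"

  have d2: "\<forall>\<^sub>F n in sequentially. d n \<ge> 2" using d_infinity by (simp add: filterlim_at_top)
  have indQ: "prob_space.indep_vars (M n) (\<lambda>_. count_space (rank_vectors n)) (Q n) {1..d n}"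
    and unifQ: "\<And>j. j \<in> {1..d n} \<Longrightarrow> uniform_variable (M n) (rank_vectors n) (?P n) (Q n j)"
    if "n \<ge> 1" "d n \<ge> 1" for n
    using independent_uniform_rank_vectors[OF X copies H0 that] by (simp_all add: Q_def)
  have prM: "prob_space (M n)" for n using copies by (simp add: independent_copies_def)
  have stat: "rank_stat n (c n) g (S n) j k = (\<lambda>\<omega>. pair_stat n (c n) g (Q n j \<omega>) (Q n k \<omega>))" for n j k
    by (rule ext) (simp add: rank_stat_eq_pair_stat Q_def)
  have transfer: "prob_space.expectation (M n) (\<lambda>\<omega>. f (rank_stat n (c n) g (S n) j k \<omega>))
      = (\<Sum>p\<in>?P n. f (score_stat n (c n) g p)) / fact n"
    if "n \<ge> 1" "(j, k) \<in> vertex_pairs (d n)" for n j k and f :: "real \<Rightarrow> real"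
  proof -
    interpret prob_space "M n" by (rule prM)
    have "1 \<le> d n" using that by (auto simp: vertex_pairs_def)
    thus ?thesis unfolding stat using that
      by (intro expectation_pair_stat[OF indQ unifQ]) (auto simp: vertex_pairs_def)
  qed
  have mean: "prob_space.expectation (M n) (rank_stat n (c n) g (S n) j k) = \<mu> n"
    if "n \<ge> 2" "(j, k) \<in> vertex_pairs (d n)" for n j k
    using transfer[of n j k "\<lambda>x. x"] score_stat_moments(1)[OF that(1), of "c n" g] that
    by (simp add: \<mu>_def s_def)
  have sigma: "sigma_V_sq (M n) n (c n) g (S n) = real n * V n" if "n \<ge> 2" "d n \<ge> 2" for n
  proof -
    have e: "(1, 2) \<in> vertex_pairs (d n)" using that by (simp add: vertex_pairs_def)
    have "prob_space.variance (M n) (rank_stat n (c n) g (S n) 1 2)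
        = (\<Sum>p\<in>?P n. (score_stat n (c n) g p - \<mu> n)\<^sup>2) / fact n"
      unfolding mean[OF that(1) e] using that by (intro transfer[OF _ e]) auto
    also have "\<dots> = V n"
      using score_stat_moments(2)[OF that(1), of "c n" g]
      by (simp add: \<mu>_def s_def V_def A_def B_def a_def b_def)
    finally show ?thesis by (simp add: sigma_V_sq_def)
  qed
  have V_pos: "\<forall>\<^sub>F n in sequentially. V n > 0"
    using sigma_pos d2 eventually_ge_at_top[of 2]
    by eventually_elim (simp add: sigma zero_less_mult_iff)

  obtain L where L: "L-lipschitz_on {0<..<1} g" using g_lipschitz by blast
  have L0: "L \<ge> 0" using L by (rule lipschitz_on_nonneg)
  have grid: "real i / (real n + 1) \<in> {0<..<1}" if "i \<in> {1..n}" for i n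
    using that by simp
  have b_le: "\<bar>b n j\<bar> \<le> L" if "j \<in> {1..n}" for n j
    unfolding b_def
  proof (rule abs_centred_le)
    show "n \<ge> 1" using that by simp
    fix i k assume ik: "i \<in> {1..n}" "k \<in> {1..n}"
    have "\<bar>s n i - s n k\<bar> \<le> L * \<bar>real i / (real n + 1) - real k / (real n + 1)\<bar>"
      using lipschitz_onD[OF L grid[OF ik(1)] grid[OF ik(2)]] by (simp add: s_def dist_real_def)
    also have "\<dots> \<le> L * 1"
      using grid[OF ik(1)] grid[OF ik(2)] L0 unfolding greaterThanLessThan_iff
      by (intro mult_left_mono) linarith+
    finally show "\<bar>s n i - s n k\<bar> \<le> L" by simp
  qed (rule that)

  \<comment> \<open>Constant scores would give the variance \<open>0\<close>.\<close>
  have "\<exists>u\<in>{0<..<1}. \<exists>v\<in>{0<..<1}. g u \<noteq> g v"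
  proof (rule ccontr)
    assume "\<not> (\<exists>u\<in>{0<..<1}. \<exists>v\<in>{0<..<1}. g u \<noteq> g v)"
    hence const: "g u = g v" if "u \<in> {0<..<1}" "v \<in> {0<..<1}" for u v using that by blast
    have "V n = 0" for n
    proof -
      have "b n j = 0" if j: "j \<in> {1..n}" for j
      proof -
        have "\<bar>b n j\<bar> \<le> 0" unfolding b_def
        proof (rule abs_centred_le)
          show "n \<ge> 1" using j by simp
          show "\<bar>s n i - s n k\<bar> \<le> 0" if "i \<in> {1..n}" "k \<in> {1..n}" for i k
            using const[OF grid[OF that(1)] grid[OF that(2)]] by (simp add: s_def)
        qed (rule j)
        thus ?thesis by simp
      qed
      thus ?thesis by (simp add: V_def B_def)
    qed
    thus False using V_pos by simp
  qed
  then obtain u v where uv: "u \<in> {0<..<1}" "v \<in> {0<..<1}" "g u \<noteq> g v" by blast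
  obtain \<beta> where \<beta>: "\<beta> > 0" "\<forall>\<^sub>F n in sequentially. \<forall>m. \<beta> * real n \<le> (\<Sum>i=1..n. (g (real i / (real n + 1)) - m)\<^sup>2)"
    by (rule score_variation_lower_bound[OF L uv])
  have B_ge: "\<forall>\<^sub>F n in sequentially. B n \<ge> \<beta> * real n"
    using \<beta>(2) by eventually_elim (simp add: B_def b_def s_def)

  \<comment> \<open>the entries of the standardised statistic\<close>
  define C where "C = (\<lambda>n i j. a n i * b n j / sqrt (V n))"
  define K where "K = \<bar>C1\<bar> * L / sqrt \<beta> + 1"
  have K: "K > 0" unfolding K_def using L0 \<beta> by (intro add_nonneg_pos divide_nonneg_nonneg mult_nonneg_nonneg) auto
  have C_stat: "perm_stat n (C n) p = (score_stat n (c n) g p - \<mu> n) / sqrt (V n)" if "n \<ge> 1" "p \<in> ?P n" for n p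
    using score_stat_centred[OF that(1), of p "c n" g] that(2)
    by (simp add: perm_stat_def C_def a_def b_def s_def \<mu>_def sum_divide_distrib)
  have C_bound: "\<forall>\<^sub>F n in sequentially. \<forall>i\<in>{1..n}. \<forall>j\<in>{1..n}. \<bar>C n i j\<bar> \<le> K / sqrt n"
    using V_pos B_ge eventually_ge_at_top[of 2]
  proof eventually_elim
    case (elim n)
    show ?case
    proof (intro ballI)
      fix i j assume ij: "i \<in> {1..n}" "j \<in> {1..n}"
      have n: "real n > 0" "real (n - 1) > 0" "real (n - 1) \<le> real n" using elim by auto
      have B0: "B n > 0" using elim \<beta> n by (meson less_le_trans mult_pos_pos)
      have A0: "A n > 0" using elim(1) B0 n by (auto simp: V_def zero_less_divide_iff zero_less_mult_iff)
      have "\<bar>a n i\<bar>\<^sup>2 \<le> (MAX i\<in>{1..n}. \<bar>c n i - mean_upto n (c n)\<bar>\<^sup>2)"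
        unfolding a_def using ij by (intro Max_ge) auto
      also have "\<dots> \<le> C1\<^sup>2 / real n * A n"
        using c_max[of n] elim by (simp add: A_def a_def)
      finally have a2: "(a n i)\<^sup>2 \<le> C1\<^sup>2 / real n * A n" by simp
      have b2: "(b n j)\<^sup>2 \<le> L\<^sup>2" using b_le[OF ij(2)] L0 by (metis abs_of_nonneg abs_le_square_iff)
      have "(C n i j)\<^sup>2 = (a n i)\<^sup>2 * (b n j)\<^sup>2 / V n"
        using elim(1) by (simp add: C_def power_mult_distrib power_divide)
      also have "\<dots> \<le> (C1\<^sup>2 / real n * A n) * L\<^sup>2 / V n"
        using elim(1) A0 n by (intro divide_right_mono mult_mono a2 b2) auto
      also have "\<dots> = C1\<^sup>2 * L\<^sup>2 / real n * (real (n - 1) / B n)"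
        using A0 B0 n by (simp add: V_def field_simps)
      also have "\<dots> \<le> C1\<^sup>2 * L\<^sup>2 / real n * (1 / \<beta>)"
      proof (rule mult_left_mono)
        have "real (n - 1) * \<beta> \<le> B n" using elim(2) n \<beta>(1)
          by (smt (verit, best) mult.commute mult_left_mono)
        thus "real (n - 1) / B n \<le> 1 / \<beta>" using B0 \<beta>(1) by (simp add: field_simps)
      qed auto
      also have "\<dots> = (\<bar>C1\<bar> * L / sqrt \<beta> / sqrt n)\<^sup>2"
        using \<beta>(1) by (simp add: power_divide power_mult_distrib)
      finally have "\<bar>C n i j\<bar> \<le> \<bar>\<bar>C1\<bar> * L / sqrt \<beta> / sqrt n\<bar>"
        by (simp only: abs_le_square_iff)
      also have "\<dots> = \<bar>C1\<bar> * L / sqrt \<beta> / sqrt n"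
        using L0 \<beta>(1) by (intro abs_of_nonneg divide_nonneg_nonneg mult_nonneg_nonneg) auto
      also have "\<dots> \<le> K / sqrt n" unfolding K_def by (intro divide_right_mono) auto
      finally show "\<bar>C n i j\<bar> \<le> K / sqrt n" .
    qed
  qed
  have C_mean: "\<forall>\<^sub>F n in sequentially. (\<Sum>p\<in>?P n. perm_stat n (C n) p) = 0"
    using eventually_ge_at_top[of 2]
  proof eventually_elim
    case (elim n)
    have "(\<Sum>p\<in>?P n. perm_stat n (C n) p) = ((\<Sum>p\<in>?P n. score_stat n (c n) g p) - fact n * \<mu> n) / sqrt (V n)"
    proof -
      have "(\<Sum>p\<in>?P n. perm_stat n (C n) p) = (\<Sum>p\<in>?P n. (score_stat n (c n) g p - \<mu> n) / sqrt (V n))"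
        using elim by (intro sum.cong[OF refl] C_stat) auto
      thus ?thesis by (simp add: sum_divide_distrib[symmetric] sum_subtractf card_permutations[OF refl])
    qed
    also have "(\<Sum>p\<in>?P n. score_stat n (c n) g p) = fact n * \<mu> n"
      using score_stat_moments(1)[OF elim, of "c n" g] by (simp add: \<mu>_def s_def field_simps)
    finally show ?case by simp
  qed
  have C_var: "\<forall>\<^sub>F n in sequentially. (\<Sum>p\<in>?P n. (perm_stat n (C n) p)\<^sup>2) = fact n"
    using V_pos eventually_ge_at_top[of 2]
  proof eventually_elim
    case (elim n)
    have "(\<Sum>p\<in>?P n. (perm_stat n (C n) p)\<^sup>2) = (\<Sum>p\<in>?P n. (score_stat n (c n) g p - \<mu> n)\<^sup>2) / V n"
    proof -
      have "(\<Sum>p\<in>?P n. (perm_stat n (C n) p)\<^sup>2) = (\<Sum>p\<in>?P n. (score_stat n (c n) g p - \<mu> n)\<^sup>2 / V n)"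
      proof (rule sum.cong[OF refl])
        fix p assume "p \<in> ?P n"
        thus "(perm_stat n (C n) p)\<^sup>2 = (score_stat n (c n) g p - \<mu> n)\<^sup>2 / V n"
          using C_stat[of n p] elim by (simp add: power_divide)
      qed
      thus ?thesis by (simp add: sum_divide_distrib)
    qed
    also have "(\<Sum>p\<in>?P n. (score_stat n (c n) g p - \<mu> n)\<^sup>2) = fact n * V n"
      using score_stat_moments(2)[OF elim(2), of "c n" g]
      by (simp add: \<mu>_def s_def V_def A_def B_def a_def b_def field_simps)
    finally show ?case using elim(1) by simp
  qed

  define \<pi> where "\<pi> = (\<lambda>n. card {p. p permutes {1..n} \<and> \<bar>perm_stat n (C n) p\<bar> > t n} / fact n :: real)"
  define rate where "rate = (8 * pi) powr (-1/2) * exp (- y / 2)"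
  have t_eq: "t n = sqrt (4 * ln (real (d n)) - ln (ln (real (d n))) + y)" for n by (simp add: t_def)
  note growth = threshold_growth[OF d_infinity log_d t_eq]
  have "(\<lambda>n. t n * sqrt (2 * pi) * exp ((t n)\<^sup>2 / 2) * \<pi> n) \<longlonglongrightarrow> 2"
    unfolding \<pi>_def by (rule permutation_moderate_deviation_abs[OF K C_bound C_mean C_var growth])
  from poisson_rate_limit[OF d_infinity t_eq this]
  have edge_rate: "(\<lambda>n. card (vertex_pairs (d n)) * \<pi> n) \<longlonglongrightarrow> rate"
    by (simp add: card_vertex_pairs rate_def)

  let ?p = "\<lambda>n. measure (M n) {\<omega> \<in> space (M n).
              real n * (max_rank_stat (M n) n (d n) (c n) g (S n) \<omega>)\<^sup>2
                / sigma_V_sq (M n) n (c n) g (S n)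
                - 4 * ln (real (d n)) + ln (ln (real (d n))) \<le> y}"
  have t_pos: "\<forall>\<^sub>F n in sequentially. t n > 0"
    using filterlim_at_top_dense[THEN iffD1, OF growth(1), rule_format, of 0] .
  have main: "\<forall>\<^sub>F n in sequentially. \<bar>?p n - exp (- (card (vertex_pairs (d n)) * \<pi> n))\<bar>
      \<le> 8 / (real (d n) - 1) * (card (vertex_pairs (d n)) * \<pi> n)\<^sup>2"
    using V_pos t_pos d2 eventually_ge_at_top[of 2]
  proof eventually_elim
    case (elim n)
    interpret prob_space "M n" by (rule prM)
    let ?E = "vertex_pairs (d n)"
    have n1: "n \<ge> 1" and d1: "d n \<ge> 1" using elim by auto
    define R where "R = (\<lambda>p q. \<bar>pair_stat n (c n) g p q - \<mu> n\<bar> > t n * sqrt (V n))"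
    define m where "m = card {p. p permutes {1..n} \<and> \<bar>score_stat n (c n) g p - \<mu> n\<bar> > t n * sqrt (V n)}"
    have cardP: "card (?P n) = fact n" by (simp add: card_permutations[OF refl])
    have "{p. p permutes {1..n} \<and> \<bar>score_stat n (c n) g p - \<mu> n\<bar> > t n * sqrt (V n)}
        = {p. p permutes {1..n} \<and> \<bar>perm_stat n (C n) p\<bar> > t n}"
      using C_stat[OF n1] elim(1) by (auto simp: abs_divide pos_less_divide_eq)
    hence \<pi>_m: "\<pi> n = m / card (?P n)" by (simp add: \<pi>_def m_def cardP)
    have poisson: "\<bar>prob {\<omega>\<in>space (M n). \<forall>(j, k)\<in>?E. \<not> R (Q n j \<omega>) (Q n k \<omega>)} - exp (- (card ?E * \<pi> n))\<bar>
        \<le> 4 * real (d n) * card ?E * (\<pi> n)\<^sup>2"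
    proof (rule no_edge_poisson[OF indQ[OF n1 d1] unifQ[OF n1 d1] _ _ \<pi>_m])
      show "card {q \<in> ?P n. R p q} = m" if "p \<in> ?P n" for p
        using card_pair_stat(1)[of p n "\<lambda>x. \<bar>x - \<mu> n\<bar> > t n * sqrt (V n)" "c n" g] that by (simp add: R_def m_def)
      show "card {p \<in> ?P n. R p q} = m" if "q \<in> ?P n" for q
        using card_pair_stat(2)[of q n "\<lambda>x. \<bar>x - \<mu> n\<bar> > t n * sqrt (V n)" "c n" g] that by (simp add: R_def m_def)
    qed
    have event: "(real n * (max_rank_stat (M n) n (d n) (c n) g (S n) \<omega>)\<^sup>2
                / sigma_V_sq (M n) n (c n) g (S n)
                - 4 * ln (real (d n)) + ln (ln (real (d n))) \<le> y)
        \<longleftrightarrow> (\<forall>(j, k)\<in>?E. \<not> R (Q n j \<omega>) (Q n k \<omega>))" for \<omega>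
    proof -
      define W where "W = (\<lambda>(j, k). \<bar>pair_stat n (c n) g (Q n j \<omega>) (Q n k \<omega>) - \<mu> n\<bar>)"
      define mx where "mx = max_rank_stat (M n) n (d n) (c n) g (S n) \<omega>"
      have ne: "?E \<noteq> {}"
      proof -
        have "(1, 2) \<in> ?E" using elim by (simp add: vertex_pairs_def)
        thus ?thesis by blast
      qed
      have "{\<bar>rank_stat n (c n) g (S n) j k \<omega> - expectation (rank_stat n (c n) g (S n) j k)\<bar> | j k.
            1 \<le> j \<and> j < k \<and> k \<le> d n} = W ` ?E"
      proof -
        have "\<bar>rank_stat n (c n) g (S n) j k \<omega> - expectation (rank_stat n (c n) g (S n) j k)\<bar> = W (j, k)"
          if "(j, k) \<in> ?E" for j k
          using mean[OF elim(4) that] by (simp add: W_def stat)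
        thus ?thesis by (auto simp: vertex_pairs_def image_iff) metis+
      qed
      hence mx: "mx = Max (W ` ?E)" by (simp add: mx_def max_rank_stat_def)
      have W0: "W e \<ge> 0" for e by (simp add: W_def split_beta)
      have "mx \<in> W ` ?E" unfolding mx using ne by (intro Max_in) auto
      hence mx0: "mx \<ge> 0" using W0 by auto
      have t2: "(t n)\<^sup>2 = 4 * ln (real (d n)) - ln (ln (real (d n))) + y"
        using elim(2) by (simp add: t_def)
      have "real n * mx\<^sup>2 / sigma_V_sq (M n) n (c n) g (S n) = mx\<^sup>2 / V n"
        using elim by (simp add: sigma)
      hence "real n * mx\<^sup>2 / sigma_V_sq (M n) n (c n) g (S n) - 4 * ln (real (d n)) + ln (ln (real (d n))) \<le> y
          \<longleftrightarrow> mx\<^sup>2 / V n \<le> (t n)\<^sup>2" unfolding t2 by linarith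
      also have "\<dots> \<longleftrightarrow> mx\<^sup>2 \<le> (t n * sqrt (V n))\<^sup>2"
        using elim(1) by (simp add: power_mult_distrib pos_divide_le_eq)
      also have "\<dots> \<longleftrightarrow> mx \<le> t n * sqrt (V n)"
      proof -
        have "t n * sqrt (V n) \<ge> 0" using elim by simp
        thus ?thesis using mx0 by (simp only: abs_le_square_iff[symmetric] abs_of_nonneg)
      qed
      also have "\<dots> \<longleftrightarrow> (\<forall>e\<in>?E. W e \<le> t n * sqrt (V n))"
        unfolding mx using ne by (subst Max_le_iff) auto
      also have "\<dots> \<longleftrightarrow> (\<forall>(j, k)\<in>?E. \<not> R (Q n j \<omega>) (Q n k \<omega>))"
        by (auto simp: W_def R_def not_less)
      finally show ?thesis by (simp only: mx_def)
    qed
    have "?p n = prob {\<omega>\<in>space (M n). \<forall>(j, k)\<in>?E. \<not> R (Q n j \<omega>) (Q n k \<omega>)}"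
      by (simp only: event)
    moreover have "4 * real (d n) * card ?E * (\<pi> n)\<^sup>2 = 8 / (real (d n) - 1) * (card ?E * \<pi> n)\<^sup>2"
    proof -
      have "real (d n) - 1 > 0" using elim by simp
      thus ?thesis unfolding card_vertex_pairs by (simp add: field_simps power2_eq_square)
    qed
    ultimately show ?case using poisson by simp
  qed
  have "(\<lambda>n. 8 / (real (d n) - 1) * (card (vertex_pairs (d n)) * \<pi> n)\<^sup>2) \<longlonglongrightarrow> 0 * rate\<^sup>2"
  proof (intro tendsto_mult tendsto_power edge_rate)
    have dr: "filterlim (\<lambda>n. real (d n)) at_top sequentially"
      by (rule filterlim_compose[OF filterlim_real_sequentially d_infinity])
    have "((\<lambda>x::real. 8 / (x - 1)) \<longlongrightarrow> 0) at_top" by real_asymp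
    thus "(\<lambda>n. 8 / (real (d n) - 1)) \<longlonglongrightarrow> 0" using dr by (rule filterlim_compose)
  qed
  hence err: "(\<lambda>n. 8 / (real (d n) - 1) * (card (vertex_pairs (d n)) * \<pi> n)\<^sup>2) \<longlonglongrightarrow> 0" by simp
  have "(\<lambda>n. ?p n - exp (- (card (vertex_pairs (d n)) * \<pi> n))) \<longlonglongrightarrow> 0"
    by (rule Lim_null_comparison[OF _ err]) (use main in simp)
  moreover have "(\<lambda>n. exp (- (card (vertex_pairs (d n)) * \<pi> n))) \<longlonglongrightarrow> exp (- rate)"
    by (intro tendsto_exp tendsto_minus edge_rate)
  ultimately have "(\<lambda>n. (?p n - exp (- (card (vertex_pairs (d n)) * \<pi> n))) + exp (- (card (vertex_pairs (d n)) * \<pi> n)) - exp (- rate))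
      \<longlonglongrightarrow> 0 + exp (- rate) - exp (- rate)"
    by (intro tendsto_diff tendsto_add tendsto_const)
  hence "(\<lambda>n. ?p n - exp (- rate)) \<longlonglongrightarrow> 0" by simp
  from tendsto_rabs_zero[OF this] show ?thesis by (simp only: rate_def)
qed

end
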